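(* Let $\{X_n, n\ge 1\}$ be a stationary sequence of associated random variables with $|X_n|<C_1<\infty$ for all $n\ge 1$. Let $F$ be the distribution function of $X_1$ and assume that $X_1$ has a bounded density function. Assume that $\sum_{j=1}^{\infty}[\mathrm{Cov}(X_1,X_j)]^{\gamma}<\infty$ for some $0<\gamma<1/6$. Let $\rho(x,y)$ be a symmetric real-valued kernel on $[-C_1,C_1]^2$ which is of bounded Hardy-Krause variation and left-continuous, and let $$U_n=\binom{n}{2}^{-1}\sum_{1\le i<j\le n}\rho(X_i,X_j),\qquad \theta=\int\!\!\int \rho(x,y)\,dF(x)\,dF(y),\qquad \rho_1(x)=\int\rho(x,y)\,dF(y).$$ Put $\sigma_1^2=\mathrm{Var}(\rho_1(X_1))$ and $\sigma_{1j}^2=\mathrm{Cov}(\rho_1(X_1),\rho_1(X_{1+j}))$ for $j\ge 1$. Assume $\sigma_1^2<\infty$, that $\sum_{j=1}^{\infty}\sigma_{1j}^2<\infty$ (the series converges), and that $$\sigma_U^2:=\sigma_1^2+2\sum_{j=1}^{\infty}\sigma_{1j}^2>0 .$$ Suppose there exists a function $\tilde\rho_1$ such that $\rho_1\ll\tilde\rho_1$ and $$\sum_{j=1}^{\infty}\mathrm{Cov}(\tilde\rho_1(X_1),\tilde\rho_1(X_j))<\infty .$$ Then $$\frac{\sqrt{n}\,(U_n-\theta)}{2\sigma_U}\xrightarrow{\ \mathcal L\ }N(0,1)\quad\text{as } n\to\infty .$$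
   Context: Association: a finite collection $X_1,\dots,X_n$ of random variables is associated if $\mathrm{Cov}(h(X_1,\dots,X_n),g(X_1,\dots,X_n))\ge 0$ for all component-wise nondecreasing $h,g:\mathbb R^n\to\mathbb R$ for which the covariance exists; an infinite collection is associated if every finite sub-collection is. (In particular $\mathrm{Cov}(X_i,X_j)\ge 0$.) Stationary means strictly stationary. The relation $\ll$: for real-valued functions, $f\ll f_1$ means that $f_1+f$ and $f_1-f$ are both coordinate-wise nondecreasing. Vitali variation: for $a,b\in\mathbb R^k$ let $[a,b]=\{x\in\mathbb R^k: a\le x\le b\}$ (componentwise). For $f:[a,b]\to\mathbb R$ and a $k$-dimensional rectangle $R=[c,d]\subseteq[a,b]$ put $\Delta_R f=\sum_{I\subseteq\{1,\dots,k\}}(-1)^{|I|}f(x_I)$, where $x_I$ has $i$-th coordinate $c_i$ if $i\in I$ and $d_i$ if $i\notin I$. Then $\|f\|_V=\sup\sum_{R\in\mathbb A}|\Delta_R f|$, the supremum being over all finite collections $\mathbb A$ of $k$-dimensional rectangles with pairwise disjoint interiors whose union is $[a,b]$. Hardy-Krause variation: $\|f\|_{HK}=\sum_{\emptyset\ne I\subseteq\{1,\dots,k\}}\|f_I\|_V$, where $f_I$ is the function on $\prod_{i\in I}[a_i,b_i]$ obtained from $f$ by setting the $i$-th argument equal to $b_i$ for every $i\notin I$. $f$ is of bounded Hardy-Krause variation if $\|f\|_{HK}<\infty$. Left-continuity: if $f$ on $[a,b]$ is of bounded Hardy-Krause variation, then for each $x\in(a,b]$ there is a value $f^-(x)$ such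 that $f(x_m)\to f^-(x)$ for every sequence $x_m\in[a,x)$ converging to $x$ (intervals being products of the coordinate intervals); set $f^-(x)=f(x)$ for $x\notin(a,b]$. $f$ is left-continuous if $f_I=f_I^-$ for all non-empty $I\subseteq\{1,\dots,k\}$. *)

theory Defs
  imports "HOL-Probability.Probability"
begin

definition cov :: "'a measure \<Rightarrow> ('a \<Rightarrow> real) \<Rightarrow> ('a \<Rightarrow> real) \<Rightarrow> real" where
  "cov M Y Z =
     (LINT \<omega>|M. (Y \<omega> - (LINT \<omega>'|M. Y \<omega>')) * (Z \<omega> - (LINT \<omega>'|M. Z \<omega>')))"

(* The covariance exists as a finite real number; integrability includes measurability,
   which is not automatic for a nondecreasing function of several random variables. *)
definition cov_exists :: "'a measure \<Rightarrow> ('a \<Rightarrow> real) \<Rightarrow> ('a \<Rightarrow> real) \<Rightarrow> bool" where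
  "cov_exists M Y Z \<longleftrightarrow>
     integrable M Y \<and> integrable M Z \<and> integrable M (\<lambda>\<omega>. Y \<omega> * Z \<omega>)"

(* Vectors indexed by a finite set J are the extensional functions in
   PiE J (%_. UNIV); on these the pointwise order of the function type is the
   componentwise order, so mono_on means componentwise nondecreasing. *)
definition associated_finite :: "'a measure \<Rightarrow> 'i set \<Rightarrow> ('i \<Rightarrow> 'a \<Rightarrow> real) \<Rightarrow> bool" where
  "associated_finite M J X \<longleftrightarrow>
     (\<forall>h g :: ('i \<Rightarrow> real) \<Rightarrow> real.
        mono_on (PiE J (\<lambda>_. UNIV)) h \<longrightarrow> mono_on (PiE J (\<lambda>_. UNIV)) g \<longrightarrow>
        cov_exists M (\<lambda>\<omega>. h (\<lambda>j\<in>J. X j \<omega>)) (\<lambda>\<omega>. g (\<lambda>j\<in>J. X j \<omega>)) \<longrightarrow>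
        cov M (\<lambda>\<omega>. h (\<lambda>j\<in>J. X j \<omega>)) (\<lambda>\<omega>. g (\<lambda>j\<in>J. X j \<omega>)) \<ge> 0)"

definition associated :: "'a measure \<Rightarrow> 'i set \<Rightarrow> ('i \<Rightarrow> 'a \<Rightarrow> real) \<Rightarrow> bool" where
  "associated M I X \<longleftrightarrow>
     (\<forall>J. J \<subseteq> I \<longrightarrow> finite J \<longrightarrow> J \<noteq> {} \<longrightarrow> associated_finite M J X)"

(* Strict stationarity of a sequence X 1, X 2, ...; X 0 plays no role. *)
definition strictly_stationary :: "'a measure \<Rightarrow> (nat \<Rightarrow> 'a \<Rightarrow> real) \<Rightarrow> bool" where
  "strictly_stationary M X \<longleftrightarrow>
     (\<forall>J k. J \<subseteq> {1..} \<longrightarrow> finite J \<longrightarrow>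
        distr M (PiM J (\<lambda>_. borel)) (\<lambda>\<omega>. \<lambda>j\<in>J. X (j + k) \<omega>) =
        distr M (PiM J (\<lambda>_. borel)) (\<lambda>\<omega>. \<lambda>j\<in>J. X j \<omega>))"

definition ll_on :: "'a::order set \<Rightarrow> ('a \<Rightarrow> real) \<Rightarrow> ('a \<Rightarrow> real) \<Rightarrow> bool" where
  "ll_on D f f1 \<longleftrightarrow>
     mono_on D (\<lambda>x. f1 x + f x) \<and> mono_on D (\<lambda>x. f1 x - f x)"

(* Points of R^k, and of its coordinate subspaces, are extensional functions on a finite
   set of coordinates. The endpoints a, b are read only at those coordinates. *)
definition rect :: "'i set \<Rightarrow> ('i \<Rightarrow> real) \<Rightarrow> ('i \<Rightarrow> real) \<Rightarrow> ('i \<Rightarrow> real) set" where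
  "rect I a b = PiE I (\<lambda>i. {a i..b i})"

definition rect_interior :: "'i set \<Rightarrow> ('i \<Rightarrow> real) \<Rightarrow> ('i \<Rightarrow> real) \<Rightarrow> ('i \<Rightarrow> real) set" where
  "rect_interior I a b = PiE I (\<lambda>i. {a i<..<b i})"

definition rect_increment ::
    "'i set \<Rightarrow> (('i \<Rightarrow> real) \<Rightarrow> real) \<Rightarrow> ('i \<Rightarrow> real) \<Rightarrow> ('i \<Rightarrow> real) \<Rightarrow> real" where
  "rect_increment I f c d =
     (\<Sum>J\<in>Pow I. (- 1) ^ card J * f (\<lambda>i\<in>I. if i \<in> J then c i else d i))"

(* A rectangle [c,d] is represented by its pair (c,d) of corners. *)
definition rect_partitions ::
    "'i set \<Rightarrow> ('i \<Rightarrow> real) \<Rightarrow> ('i \<Rightarrow> real) \<Rightarrow> (('i \<Rightarrow> real) \<times> ('i \<Rightarrow> real)) set set" where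
  "rect_partitions I a b =
     {\<A>. finite \<A> \<and>
          (\<forall>(c, d)\<in>\<A>. c \<in> rect I a b \<and> d \<in> rect I a b \<and> (\<forall>i\<in>I. c i < d i)) \<and>
          (\<forall>(c, d)\<in>\<A>. \<forall>(c', d')\<in>\<A>. (c, d) \<noteq> (c', d') \<longrightarrow>
              rect_interior I c d \<inter> rect_interior I c' d' = {}) \<and>
          (\<Union>(c, d)\<in>\<A>. rect I c d) = rect I a b}"

definition vitali_variation ::
    "'i set \<Rightarrow> ('i \<Rightarrow> real) \<Rightarrow> ('i \<Rightarrow> real) \<Rightarrow> (('i \<Rightarrow> real) \<Rightarrow> real) \<Rightarrow> ennreal" where
  "vitali_variation I a b f =
     (SUP \<A>\<in>rect_partitions I a b. \<Sum>(c, d)\<in>\<A>. ennreal \<bar>rect_increment I f c d\<bar>)"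

(* The function f_I on the product over I: coordinates in K - I are frozen at b. *)
definition upper_face ::
    "'i set \<Rightarrow> ('i \<Rightarrow> real) \<Rightarrow> (('i \<Rightarrow> real) \<Rightarrow> real) \<Rightarrow> 'i set \<Rightarrow> ('i \<Rightarrow> real) \<Rightarrow> real" where
  "upper_face K b f I = (\<lambda>x. f (\<lambda>i\<in>K. if i \<in> I then x i else b i))"

definition hk_variation ::
    "'i set \<Rightarrow> ('i \<Rightarrow> real) \<Rightarrow> ('i \<Rightarrow> real) \<Rightarrow> (('i \<Rightarrow> real) \<Rightarrow> real) \<Rightarrow> ennreal" where
  "hk_variation K a b f =
     (\<Sum>I\<in>Pow K - {{}}. vitali_variation I a b (upper_face K b f I))"

definition bounded_hk_variation ::
    "'i set \<Rightarrow> ('i \<Rightarrow> real) \<Rightarrow> ('i \<Rightarrow> real) \<Rightarrow> (('i \<Rightarrow> real) \<Rightarrow> real) \<Rightarrow> bool" where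
  "bounded_hk_variation K a b f \<longleftrightarrow> hk_variation K a b f < \<infinity>"

(* f^-; the limit exists when f has bounded Hardy-Krause variation on [a,b], which is the
   only case in which this definition is meaningful. *)
definition left_version ::
    "'i set \<Rightarrow> ('i \<Rightarrow> real) \<Rightarrow> ('i \<Rightarrow> real) \<Rightarrow> (('i \<Rightarrow> real) \<Rightarrow> real) \<Rightarrow> ('i \<Rightarrow> real) \<Rightarrow> real" where
  "left_version I a b f x =
     (if x \<in> PiE I (\<lambda>i. {a i<..b i})
      then THE l. \<forall>s. (\<forall>m. s m \<in> PiE I (\<lambda>i. {a i..<x i})) \<longrightarrow>
                      (\<forall>i\<in>I. (\<lambda>m::nat. s m i) \<longlonglongrightarrow> x i) \<longrightarrow>
                      (\<lambda>m. f (s m)) \<longlonglongrightarrow> l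
      else f x)"

definition left_continuous_hk ::
    "'i set \<Rightarrow> ('i \<Rightarrow> real) \<Rightarrow> ('i \<Rightarrow> real) \<Rightarrow> (('i \<Rightarrow> real) \<Rightarrow> real) \<Rightarrow> bool" where
  "left_continuous_hk K a b f \<longleftrightarrow>
     (\<forall>I. I \<subseteq> K \<longrightarrow> I \<noteq> {} \<longrightarrow>
        (\<forall>x\<in>rect I a b.
           upper_face K b f I x = left_version I a b (upper_face K b f I) x))"

end

theory Submission
  imports Defs
begin

text \<open>Write \<open>h\<close> for the degenerate part of the kernel in the Hoeffding decomposition
  \<open>\<rho> x y = h x y + \<rho>\<^sub>1 x + \<rho>\<^sub>1 y - \<theta>\<close>. Since \<open>\<rho>\<close> has bounded Hardy-Krause variation, it is a uniform
  limit of step kernels for which \<open>\<Sum>i j. h (X i) (X j)\<close> equals \<open>\<Sum>s t. \<Delta> s t * Z s * Z t\<close>, where the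
  \<open>Z s\<close> are centred sums of indicators of up-sets at \<open>X i\<close> and \<open>\<Sum>s t. \<bar>\<Delta> s t\<bar>\<close> is at most the Vitali
  variation. The bounded density gives \<open>Cov (1 {X i > s}, 1 {X j > s}) \<le> K * Cov (X i, X j) powr (1/3)\<close>,
  so \<open>E (Z s)\<^sup>2 = O(n)\<close>, the degenerate double sum is \<open>O(n)\<close> in \<open>L\<^sup>1\<close>, and it disappears after division
  by \<open>n powr (3/2)\<close>. The linear part \<open>\<Sum>i. \<rho>\<^sub>1 (X i) - \<theta>\<close> obeys the central limit theorem by Newman's method:
  the characteristic function of a sum over \<open>m\<close> adjacent blocks of length \<open>l\<close> differs from the product
  of the block characteristic functions by a sum of covariances of the dominating functions
  \<open>\<rho>\<^sub>1'\<close>, which is negligible as first \<open>m\<close> and then \<open>l\<close> tends to infinity.\<close>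

section \<open>Kernels of bounded Hardy-Krause variation\<close>

text \<open>Association bounds covariances only through nondecreasing dominating functions, and a
  nonconstant indicator is dominated by no multiple of the identity. A ramp of width \<delta> is
  dominated, with factor \<open>1 / \<delta>\<close>. If \<open>c\<close> is the covariance of the
  variables, the ramps have covariance at most \<open>c / \<delta>\<^sup>2\<close>, and the density
  bound \<open>K\<close> makes the replacement cost \<open>4 * K * \<delta>\<close>; balancing the
  two gives the exponent 1/3. No signed measure is attached to the kernel. Finite grids suffice: at
  fixed \<open>n\<close> the uniform error, although multiplied by the square of \<open>n\<close>,
  can be made arbitrarily small, while the bound on the coefficients does not depend on the mesh.
  Hypotheses that hold only on the interval carrying the variables are moved to the whole line by
  composing with a clamp \<kappa>. The clamp preserves monotonicity, makes every function involved
  bounded everywhere, and leaves the random variables unchanged.\<close>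

lemma rect_partitionsD:
  assumes "A \<in> rect_partitions I a b"
  shows "finite A" "(\<Union>(c, d)\<in>A. rect I c d) = rect I a b"
    and "\<And>c d. (c, d) \<in> A \<Longrightarrow> c \<in> rect I a b \<and> d \<in> rect I a b \<and> (\<forall>i\<in>I. c i < d i)"
    and "\<And>c d c' d'. (c, d) \<in> A \<Longrightarrow> (c', d') \<in> A \<Longrightarrow> (c, d) \<noteq> (c', d') \<Longrightarrow>
           rect_interior I c d \<inter> rect_interior I c' d' = {}"
proof -
  note D = assms[unfolded rect_partitions_def mem_Collect_eq]
  show "finite A" using D by (elim conjE)
  show "(\<Union>(c, d)\<in>A. rect I c d) = rect I a b" using D by (elim conjE)
  fix c d assume cd: "(c, d) \<in> A"
  show "c \<in> rect I a b \<and> d \<in> rect I a b \<and> (\<forall>i\<in>I. c i < d i)"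
    by (rule bspec[OF conjunct1[OF conjunct2[OF D]] cd, unfolded prod.case])
  fix c' d' assume "(c', d') \<in> A" "(c, d) \<noteq> (c', d')"
  then show "rect_interior I c d \<inter> rect_interior I c' d' = {}"
    using bspec[OF conjunct1[OF conjunct2[OF conjunct2[OF D]]] cd] by (auto simp only: prod.case)
qed

text \<open>Every cell of \<open>A\<close> lies in \<open>k\<close>-th coordinate below
  \<open>m\<close> and every cell of \<open>B\<close> above it. Since cells have positive width, no
  cell belongs to both and interiors cannot meet. The disjointness of \<open>A\<close> and
  \<open>B\<close> as sets is recorded because sums over the union have to split.\<close>

lemma rect_partitions_cut:
  assumes "k \<in> I" "a k \<le> m" "m \<le> b k"
    and A: "A \<in> rect_partitions I a (b(k := m))"
    and B: "B \<in> rect_partitions I (a(k := m)) b"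
  shows "A \<union> B \<in> rect_partitions I a b" "A \<inter> B = {}"
proof -
  have sub: "rect I a (b(k := m)) \<subseteq> rect I a b" "rect I (a(k := m)) b \<subseteq> rect I a b"
    using assms(1-3) by (auto simp: rect_def PiE_iff split: if_splits)
  have un: "rect I a (b(k := m)) \<union> rect I (a(k := m)) b = rect I a b"
  proof (intro equalityI subsetI)
    fix x assume x: "x \<in> rect I a b"
    have "x \<in> rect I a (b(k := m))" if "x k \<le> m"
      using x that by (auto simp: rect_def PiE_iff)
    moreover have "x \<in> rect I (a(k := m)) b" if "\<not> x k \<le> m"
      using x that by (auto simp: rect_def PiE_iff)
    ultimately show "x \<in> rect I a (b(k := m)) \<union> rect I (a(k := m)) b" by blast
  qed (use sub in auto)
  have cA: "d k \<le> m \<and> c k < d k" if "(c, d) \<in> A" for c d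
  proof -
    have "d \<in> rect I a (b(k := m))" "\<forall>i\<in>I. c i < d i"
      using rect_partitionsD(3)[OF A that] by blast+
    then show ?thesis using assms(1) by (auto simp: rect_def PiE_iff)
  qed
  have cB: "m \<le> c k \<and> c k < d k" if "(c, d) \<in> B" for c d
  proof -
    have "c \<in> rect I (a(k := m)) b" "\<forall>i\<in>I. c i < d i"
      using rect_partitionsD(3)[OF B that] by blast+
    then show ?thesis using assms(1) by (auto simp: rect_def PiE_iff)
  qed
  show disj: "A \<inter> B = {}"
  proof -
    have False if "(c, d) \<in> A" "(c, d) \<in> B" for c d
      using cA[OF that(1)] cB[OF that(2)] by simp
    then show ?thesis by auto
  qed
  have dis: "rect_interior I c d \<inter> rect_interior I c' d' = {}"
    if "(c, d) \<in> A" "(c', d') \<in> B" for c d c' d'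
  proof -
    have "d k \<le> c' k" using cA[OF that(1)] cB[OF that(2)] by simp
    have "False" if x: "x \<in> rect_interior I c d" "x \<in> rect_interior I c' d'" for x
    proof -
      have "x k < d k" "c' k < x k"
        using x assms(1) by (auto simp: rect_interior_def PiE_iff)
      then show False using \<open>d k \<le> c' k\<close> by simp
    qed
    then show ?thesis by blast
  qed
  show "A \<union> B \<in> rect_partitions I a b"
    unfolding rect_partitions_def
  proof (intro CollectI conjI)
    show "finite (A \<union> B)" using A B by (simp add: rect_partitions_def)
    show "\<forall>(c, d)\<in>A \<union> B. c \<in> rect I a b \<and> d \<in> rect I a b \<and> (\<forall>i\<in>I. c i < d i)"
      using rect_partitionsD(3)[OF A] rect_partitionsD(3)[OF B] sub by blast
    show "\<forall>(c, d)\<in>A \<union> B. \<forall>(c', d')\<in>A \<union> B. (c, d) \<noteq> (c', d') \<longrightarrow>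
            rect_interior I c d \<inter> rect_interior I c' d' = {}"
    proof -
      have "rect_interior I c d \<inter> rect_interior I c' d' = {}"
        if p: "(c, d) \<in> A \<union> B" "(c', d') \<in> A \<union> B" "(c, d) \<noteq> (c', d')" for c d c' d'
      proof -
        consider "(c, d) \<in> A" "(c', d') \<in> A" | "(c, d) \<in> B" "(c', d') \<in> B"
          | "(c, d) \<in> A" "(c', d') \<in> B" | "(c, d) \<in> B" "(c', d') \<in> A"
          using p by blast
        then show ?thesis
        proof cases
          case 1 then show ?thesis using rect_partitionsD(4)[OF A] p(3) by blast
        next
          case 2 then show ?thesis using rect_partitionsD(4)[OF B] p(3) by blast
        next
          case 3 then show ?thesis by (rule dis)
        next
          case 4 then show ?thesis using dis by blast
        qed
      qed
      then show ?thesis by blast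
    qed
    show "(\<Union>(c, d)\<in>A \<union> B. rect I c d) = rect I a b"
      using rect_partitionsD(2)[OF A] rect_partitionsD(2)[OF B] un by (simp add: UN_Un)
  qed
qed

text \<open>The corners are restricted to \<open>I\<close> because points of
  \<open>rect I a b\<close> are extensional, while \<open>a\<close> and \<open>b\<close> may be
  arbitrary outside \<open>I\<close>.\<close>

lemma trivial_rect_partition:
  assumes "\<And>i. i \<in> I \<Longrightarrow> a i < b i"
  shows "{(restrict a I, restrict b I)} \<in> rect_partitions I a b"
proof -
  have "rect I (restrict a I) (restrict b I) = rect I a b"
    by (auto simp: rect_def PiE_iff)
  then show ?thesis
    using assms by (auto simp: rect_partitions_def rect_def PiE_iff less_imp_le)
qed

lemma rect_increment_restrict:
  "rect_increment I f (restrict c I) (restrict d I) = rect_increment I f c d"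
  unfolding rect_increment_def
  by (intro sum.cong refl arg_cong2[where f=times] arg_cong[where f=f]) (auto simp: restrict_def)

lemma increment_le_vitali_variation:
  assumes "\<And>i. i \<in> I \<Longrightarrow> a i < b i"
  shows "ennreal \<bar>rect_increment I f a b\<bar> \<le> vitali_variation I a b f"
  unfolding vitali_variation_def
  by (rule SUP_upper2[OF trivial_rect_partition[OF assms]])
     (simp_all add: rect_increment_restrict)

text \<open>Partitions of the two halves merge into a partition of the whole, so each sum of two
  competitors is again a competitor. The strict inequalities make both families of partitions
  nonempty, which is needed to pull a sum out of a supremum in \<open>ennreal\<close>.\<close>

lemma vitali_variation_superadditive:
  assumes I: "\<And>i. i \<in> I \<Longrightarrow> a i < b i" and k: "k \<in> I" "a k < m" "m < b k"
  shows "vitali_variation I a (b(k := m)) f + vitali_variation I (a(k := m)) b f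
         \<le> vitali_variation I a b f"
proof -
  define s where "s A = (\<Sum>(c, d)\<in>A. ennreal \<bar>rect_increment I f c d\<bar>)" for A
  let ?P = "rect_partitions I a (b(k := m))" and ?Q = "rect_partitions I (a(k := m)) b"
  have ltb: "\<And>i. i \<in> I \<Longrightarrow> a i < (b(k := m)) i" and lta: "\<And>i. i \<in> I \<Longrightarrow> (a(k := m)) i < b i"
    using I k by auto
  have ne: "?P \<noteq> {}" "?Q \<noteq> {}"
    using trivial_rect_partition[of I a "b(k := m)" , OF ltb]
      trivial_rect_partition[of I "a(k := m)" b, OF lta] by blast+
  have le: "s A + s B \<le> vitali_variation I a b f" if "A \<in> ?P" "B \<in> ?Q" for A B
  proof -
    have "s A + s B = s (A \<union> B)"
      using rect_partitions_cut(2)[of k I a m b A B] that k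
      by (auto simp: s_def rect_partitions_def intro!: sum.union_disjoint[symmetric])
    also have "\<dots> \<le> vitali_variation I a b f"
      unfolding vitali_variation_def s_def
      using rect_partitions_cut(1)[of k I a m b A B] that k by (intro SUP_upper) auto
    finally show ?thesis .
  qed
  have "(SUP A\<in>?P. s A) + (SUP B\<in>?Q. s B) = (SUP A\<in>?P. SUP B\<in>?Q. s A + s B)"
    using ne by (simp add: ennreal_SUP_add_left[symmetric] ennreal_SUP_add_right[symmetric])
  also have "\<dots> \<le> vitali_variation I a b f"
    by (intro SUP_least le)
  finally show ?thesis by (simp add: vitali_variation_def s_def)
qed

lemma vitali_variation_cong:
  assumes "\<And>i. i \<in> I \<Longrightarrow> a i = a' i" "\<And>i. i \<in> I \<Longrightarrow> b i = b' i"
  shows "vitali_variation I a b f = vitali_variation I a' b' f"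
proof -
  have "rect I a b = rect I a' b'"
    using assms by (simp add: rect_def cong: PiE_cong)
  then show ?thesis by (simp add: vitali_variation_def rect_partitions_def)
qed

lemma sum_le_superadditive:
  fixes \<phi> :: "real \<Rightarrow> real \<Rightarrow> ennreal"
  assumes "\<And>x m y. x \<le> m \<Longrightarrow> m \<le> y \<Longrightarrow> \<phi> x m + \<phi> m y \<le> \<phi> x y" and "mono g"
  shows "(\<Sum>t<N. \<phi> (g t) (g (Suc t))) \<le> \<phi> (g 0) (g N)"
proof (induction N)
  case (Suc N)
  have "(\<Sum>t<Suc N. \<phi> (g t) (g (Suc t))) \<le> \<phi> (g 0) (g N) + \<phi> (g N) (g (Suc N))"
    using Suc by (simp add: add_right_mono)
  also have "\<dots> \<le> \<phi> (g 0) (g (Suc N))"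
    using assms(2) by (intro assms(1)) (auto simp: mono_def)
  finally show ?case .
qed simp

text \<open>This is \<open>rect_increment\<close> over the rectangle with sides
  \<open>[x, x']\<close> and \<open>[y, y']\<close>, written for a curried kernel;
  \<open>rect_increment_two\<close> makes the identification.\<close>

definition mixed_difference :: "(real \<Rightarrow> real \<Rightarrow> real) \<Rightarrow> real \<Rightarrow> real \<Rightarrow> real \<Rightarrow> real \<Rightarrow> real" where
  "mixed_difference \<rho> x x' y y' = \<rho> x' y' - \<rho> x y' - \<rho> x' y + \<rho> x y"

lemma rect_increment_two:
  "rect_increment {1, 2::nat} (\<lambda>v. \<rho> (v 1) (v 2)) c d = mixed_difference \<rho> (c 1) (d 1) (c 2) (d 2)"
proof -
  have P: "Pow {1, 2::nat} = {{}, {1}, {2}, {1, 2}}" by auto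
  have "{1::nat} \<noteq> {1, 2}" "{2::nat} \<noteq> {1, 2}" by auto
  then show ?thesis
    unfolding rect_increment_def P mixed_difference_def by simp
qed

lemma rect_increment_upper_face:
  "rect_increment {1::nat} (upper_face {1, 2} b (\<lambda>v. \<rho> (v 1) (v 2)) {1}) c d
   = \<rho> (d 1) (b 2) - \<rho> (c 1) (b 2)"
proof -
  have P: "Pow {1::nat} = {{}, {1}}" by auto
  show ?thesis unfolding rect_increment_def P upper_face_def by simp
qed

text \<open>The difference \<open>\<rho> x y - \<rho> x' y\<close> splits into a mixed difference over
  \<open>[x, x'] \<times> [y, b]\<close> and an increment of \<open>\<rho> (-) b\<close>. Both are bounded by superadditive
  variations that do not depend on \<open>y\<close>, so their distribution function \<open>v\<close> controls \<open>\<rho>\<close>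
  uniformly in the other variable.\<close>

lemma bounded_hk_variation_modulus:
  fixes \<rho> :: "real \<Rightarrow> real \<Rightarrow> real" and a b :: real
  assumes ab: "a < b"
    and hk: "bounded_hk_variation {1, 2::nat} (\<lambda>_. a) (\<lambda>_. b) (\<lambda>v. \<rho> (v 1) (v 2))"
  obtains v V where "mono_on {a..b} v"
    and "\<And>x x' y. x \<in> {a..b} \<Longrightarrow> x' \<in> {a..b} \<Longrightarrow> y \<in> {a..b} \<Longrightarrow> \<bar>\<rho> x y - \<rho> x' y\<bar> \<le> \<bar>v x - v x'\<bar>"
    and "\<And>g N. mono g \<Longrightarrow> range g \<subseteq> {a..b} \<Longrightarrow>
           (\<Sum>s<N. \<Sum>t<N. \<bar>mixed_difference \<rho> (g s) (g (Suc s)) (g t) (g (Suc t))\<bar>) \<le> V"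
proof -
  define f where "f = (\<lambda>v. \<rho> (v (1::nat)) (v 2))"
  define u where "u = upper_face {1, 2::nat} (\<lambda>_. b) f {1}"
  \<comment> \<open>The value 0 at other indices is arbitrary but fixed, so that updating one
    coordinate of a \<open>pt\<close> gives exactly a \<open>pt\<close> again.\<close>
  define pt where "pt x y = (\<lambda>i::nat. if i = 1 then x else if i = 2 then y else 0)" for x y :: real
  \<comment> \<open>The value 0 on degenerate rectangles extends superadditivity to cuts at an
    endpoint. Grids with repeated points are then covered.\<close>
  define W where "W x x' y y' =
      (if x < x' \<and> y < y' then vitali_variation {1, 2} (pt x y) (pt x' y') f else 0)" for x x' y y'
  define V1 where "V1 x x' = (if x < x' then vitali_variation {1::nat} (\<lambda>_. x) (\<lambda>_. x') u else 0)" for x x'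
  have pt_upd: "(pt x y)(1 := m) = pt m y" "(pt x y)(2 := m) = pt x m" for x y m
    by (auto simp: pt_def fun_eq_iff)
  have W1: "W x m y y' + W m x' y y' \<le> W x x' y y'" if "x \<le> m" "m \<le> x'" for x m x' y y'
  proof (cases "x < m \<and> m < x' \<and> y < y'")
    case True
    then have "vitali_variation {1, 2} (pt x y) ((pt x' y')(1 := m)) f
             + vitali_variation {1, 2} ((pt x y)(1 := m)) (pt x' y') f
             \<le> vitali_variation {1, 2} (pt x y) (pt x' y') f"
      by (intro vitali_variation_superadditive) (auto simp: pt_def)
    then show ?thesis using True by (simp add: W_def pt_upd[unfolded One_nat_def])
  next
    case False
    then show ?thesis using that by (auto simp: W_def)
  qed
  have W2: "W x x' y m + W x x' m y' \<le> W x x' y y'" if "y \<le> m" "m \<le> y'" for x m x' y y'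
  proof (cases "y < m \<and> m < y' \<and> x < x'")
    case True
    then have "vitali_variation {1, 2} (pt x y) ((pt x' y')(2 := m)) f
             + vitali_variation {1, 2} ((pt x y)(2 := m)) (pt x' y') f
             \<le> vitali_variation {1, 2} (pt x y) (pt x' y') f"
      by (intro vitali_variation_superadditive) (auto simp: pt_def)
    then show ?thesis using True by (simp add: W_def pt_upd)
  next
    case False
    then show ?thesis using that by (auto simp: W_def)
  qed
  have V1: "V1 x m + V1 m x' \<le> V1 x x'" if "x \<le> m" "m \<le> x'" for x m x'
  proof (cases "x < m \<and> m < x'")
    case True
    then have "vitali_variation {1::nat} (\<lambda>_. x) ((\<lambda>_. x')(1 := m)) u
             + vitali_variation {1} ((\<lambda>_. x)(1 := m)) (\<lambda>_. x') u
             \<le> vitali_variation {1} (\<lambda>_. x) (\<lambda>_. x') u"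
      by (intro vitali_variation_superadditive) auto
    moreover have "vitali_variation {1::nat} (\<lambda>_. x) ((\<lambda>_. x')(1 := m)) u
                 = vitali_variation {1} (\<lambda>_. x) (\<lambda>_. m) u"
      "vitali_variation {1::nat} ((\<lambda>_. x)(1 := m)) (\<lambda>_. x') u = vitali_variation {1} (\<lambda>_. m) (\<lambda>_. x') u"
      by (auto intro!: vitali_variation_cong)
    ultimately show ?thesis using True by (simp add: V1_def)
  next
    case False
    then show ?thesis using that by (auto simp: V1_def)
  qed
  have Wd: "ennreal \<bar>mixed_difference \<rho> x x' y y'\<bar> \<le> W x x' y y'" if "x \<le> x'" "y \<le> y'" for x x' y y'
  proof (cases "x < x' \<and> y < y'")
    case True
    then have "ennreal \<bar>rect_increment {1, 2} f (pt x y) (pt x' y')\<bar> \<le> W x x' y y'"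
      unfolding W_def by (auto intro!: increment_le_vitali_variation simp: pt_def)
    then show ?thesis unfolding f_def rect_increment_two by (simp add: pt_def)
  next
    case False
    then have "x = x' \<or> y = y'" using that by auto
    then show ?thesis by (auto simp: mixed_difference_def)
  qed
  have V1d: "ennreal \<bar>\<rho> x' b - \<rho> x b\<bar> \<le> V1 x x'" if "x \<le> x'" for x x'
  proof (cases "x < x'")
    case True
    then have "ennreal \<bar>rect_increment {1} u (\<lambda>_. x) (\<lambda>_. x')\<bar> \<le> V1 x x'"
      unfolding V1_def by (auto intro!: increment_le_vitali_variation)
    then show ?thesis unfolding u_def f_def rect_increment_upper_face by simp
  next
    case False
    then show ?thesis using that by simp
  qed
  have hk_fin: "hk_variation {1, 2::nat} (\<lambda>_. a) (\<lambda>_. b) f < \<infinity>"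
    using hk by (simp add: bounded_hk_variation_def f_def)
  have face_fin: "vitali_variation I (\<lambda>_. a) (\<lambda>_. b) (upper_face {1, 2} (\<lambda>_. b) f I) < \<infinity>"
    if "I \<in> Pow {1, 2::nat} - {{}}" for I
  proof -
    have "vitali_variation I (\<lambda>_. a) (\<lambda>_. b) (upper_face {1, 2} (\<lambda>_. b) f I)
          \<le> hk_variation {1, 2} (\<lambda>_. a) (\<lambda>_. b) f"
      unfolding hk_variation_def using that by (intro member_le_sum) auto
    then show ?thesis using hk_fin by (rule le_less_trans)
  qed
  have face_full: "upper_face {1, 2} (\<lambda>_. b) f {1, 2} = f"
    by (auto simp: upper_face_def f_def fun_eq_iff)
  have Wab: "W a b a b < \<infinity>"
  proof -
    have "vitali_variation {1, 2} (pt a a) (pt b b) f = vitali_variation {1, 2} (\<lambda>_. a) (\<lambda>_. b) f"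
      by (rule vitali_variation_cong) (auto simp: pt_def)
    then show ?thesis using face_fin[of "{1, 2}", unfolded face_full] ab by (simp add: W_def)
  qed
  have V1ab: "V1 a b < \<infinity>"
    using face_fin[of "{1}"] ab by (simp add: V1_def u_def)
  \<comment> \<open>The variation over the strip of points with first coordinate in
    \<open>[a, x]\<close>, plus that of the upper face over \<open>[a, x]\<close>: the distribution
    function announced above, still with values in \<open>ennreal\<close>.\<close>
  define T where "T x = W a x a b + V1 a x" for x
  have T_step: "T x + ennreal \<bar>\<rho> x y - \<rho> x' y\<bar> \<le> T x'"
    if "a \<le> x" "x \<le> x'" "x' \<le> b" "a \<le> y" "y \<le> b" for x x' y
  proof -
    have "\<bar>\<rho> x y - \<rho> x' y\<bar> \<le> \<bar>mixed_difference \<rho> x x' y b\<bar> + \<bar>\<rho> x' b - \<rho> x b\<bar>"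
      by (simp add: mixed_difference_def)
    then have "ennreal \<bar>\<rho> x y - \<rho> x' y\<bar> \<le> ennreal \<bar>mixed_difference \<rho> x x' y b\<bar> + ennreal \<bar>\<rho> x' b - \<rho> x b\<bar>"
      by (simp add: ennreal_leI flip: ennreal_plus)
    also have "\<dots> \<le> W x x' y b + V1 x x'"
      using that by (intro add_mono Wd V1d) auto
    \<comment> \<open>Enlarging the strip down to \<open>a\<close> removes the dependence on
      \<open>y\<close>; this is what makes the modulus uniform.\<close>
    also have "W x x' y b \<le> W x x' a b"
      using that by (intro order.trans[OF _ W2[of a y b]]) (auto intro: add_increasing)
    finally have "T x + ennreal \<bar>\<rho> x y - \<rho> x' y\<bar> \<le> T x + (W x x' a b + V1 x x')"
      by (simp add: add_left_mono add_right_mono)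
    also have "\<dots> = (W a x a b + W x x' a b) + (V1 a x + V1 x x')"
      by (simp add: T_def algebra_simps)
    also have "\<dots> \<le> T x'"
      unfolding T_def using that by (intro add_mono W1 V1) auto
    finally show ?thesis .
  qed
  have Tb: "T b < \<infinity>" using Wab V1ab by (simp add: T_def)
  have Tfin: "T x < \<infinity>" if "x \<in> {a..b}" for x
  proof -
    have "T x \<le> T b" using that ab
      by (intro order.trans[OF _ T_step[of x b a]]) (auto intro: add_increasing2)
    then show ?thesis using Tb by (rule le_less_trans)
  qed
  define v where "v x = enn2real (T x)" for x
  have Tv: "T x = ennreal (v x)" if "x \<in> {a..b}" for x
    using Tfin[OF that] by (simp add: v_def)
  have vnn: "v x \<ge> 0" for x by (simp add: v_def)
  have step: "v x + \<bar>\<rho> x y - \<rho> x' y\<bar> \<le> v x'"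
    if "a \<le> x" "x \<le> x'" "x' \<le> b" "a \<le> y" "y \<le> b" for x x' y
  proof -
    have "ennreal (v x + \<bar>\<rho> x y - \<rho> x' y\<bar>) \<le> ennreal (v x')"
      using T_step[OF that] that vnn by (subst ennreal_plus) (auto simp: Tv)
    then show ?thesis using vnn by (subst (asm) ennreal_le_iff) auto
  qed
  show thesis
  proof (rule that[of v "enn2real (W a b a b)"])
    show "mono_on {a..b} v"
    proof (rule mono_onI)
      fix r s assume "r \<in> {a..b}" "s \<in> {a..b}" "r \<le> s"
      then show "v r \<le> v s" using step[of r s a] by auto
    qed
    show "\<bar>\<rho> x y - \<rho> x' y\<bar> \<le> \<bar>v x - v x'\<bar>"
      if "x \<in> {a..b}" "x' \<in> {a..b}" "y \<in> {a..b}" for x x' y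
    proof (cases "x \<le> x'")
      case True
      then show ?thesis using step[of x x' y] that by auto
    next
      case False
      then show ?thesis using step[of x' x y] that by auto
    qed
    fix g :: "nat \<Rightarrow> real" and N
    assume g: "mono g" "range g \<subseteq> {a..b}"
    let ?D = "\<lambda>s t. mixed_difference \<rho> (g s) (g (Suc s)) (g t) (g (Suc t))"
    have gi: "a \<le> g i" "g i \<le> b" "g i \<le> g (Suc i)" for i
      using g(2) monoD[OF g(1), of i "Suc i"] by (auto simp: image_subset_iff)
    have "ennreal (\<Sum>s<N. \<Sum>t<N. \<bar>?D s t\<bar>) = (\<Sum>s<N. \<Sum>t<N. ennreal \<bar>?D s t\<bar>)"
      by (simp add: sum_nonneg)
    also have "\<dots> \<le> (\<Sum>s<N. \<Sum>t<N. W (g s) (g (Suc s)) (g t) (g (Suc t)))"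
      by (intro sum_mono Wd gi)
    also have "\<dots> \<le> (\<Sum>s<N. W (g s) (g (Suc s)) (g 0) (g N))"
      by (intro sum_mono sum_le_superadditive W2 g(1))
    also have "\<dots> \<le> W (g 0) (g N) (g 0) (g N)"
      by (intro sum_le_superadditive[of "\<lambda>x x'. W x x' (g 0) (g N)"] W1 g(1))
    \<comment> \<open>Monotonicity of \<open>W\<close> in the rectangle is superadditivity with a
      nonnegative piece dropped, applied to each of the four sides in turn.\<close>
    also have "\<dots> \<le> W a b a b"
    proof -
      have g0N: "g 0 \<le> g N" using monoD[OF g(1), of 0 N] by simp
      have "W (g 0) (g N) (g 0) (g N) \<le> W a (g 0) (g 0) (g N) + W (g 0) (g N) (g 0) (g N)"
        by (simp add: add_increasing)
      also have "\<dots> \<le> W a (g N) (g 0) (g N)" using gi g0N by (intro W1) auto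
      also have "\<dots> \<le> W a (g N) (g 0) (g N) + W (g N) b (g 0) (g N)"
        by (simp add: add_increasing2)
      also have "\<dots> \<le> W a b (g 0) (g N)" using gi by (intro W1) auto
      also have "\<dots> \<le> W a b a (g 0) + W a b (g 0) (g N)" by (simp add: add_increasing)
      also have "\<dots> \<le> W a b a (g N)" using gi g0N by (intro W2) auto
      also have "\<dots> \<le> W a b a (g N) + W a b (g N) b" by (simp add: add_increasing2)
      also have "\<dots> \<le> W a b a b" using gi by (intro W2) auto
      finally show ?thesis .
    qed
    finally show "(\<Sum>s<N. \<Sum>t<N. \<bar>?D s t\<bar>) \<le> enn2real (W a b a b)"
      using Wab by (cases "W a b a b") (simp_all add: ennreal_le_iff)
  qed
qed

section \<open>Discrete summation of increments and the step approximation of a kernel\<close>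

lemma sum_increments_below:
  fixes f :: "nat \<Rightarrow> real"
  assumes "k \<le> N"
  shows "(\<Sum>s<N. (f (Suc s) - f s) * of_bool (s < k)) = f k - f 0"
proof -
  have "(\<Sum>s<N. (f (Suc s) - f s) * of_bool (s < k)) = (\<Sum>s<k. (f (Suc s) - f s) * of_bool (s < k))"
    using assms by (intro sum.mono_neutral_right) auto
  also have "\<dots> = f k - f 0" by (simp add: sum_lessThan_telescope)
  finally show ?thesis .
qed

text \<open>Telescoping in \<open>t\<close> and then in \<open>s\<close> leaves only the corner and
  the two boundary lines. The conditions \<open>s < k\<close> and \<open>t < l\<close> appear as
  factors because they later become indicators of up-sets in \<open>x\<close> and
  \<open>y\<close>.\<close>

lemma sum_mixed_differences_below:
  fixes F :: "nat \<Rightarrow> nat \<Rightarrow> real"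
  assumes "k \<le> N" "l \<le> N"
  shows "F k l = - F 0 0 + F k 0 + F 0 l +
    (\<Sum>s<N. \<Sum>t<N. (F (Suc s) (Suc t) - F s (Suc t) - F (Suc s) t + F s t) * of_bool (s < k) * of_bool (t < l))"
proof -
  have "(\<Sum>t<N. (F (Suc s) (Suc t) - F s (Suc t) - F (Suc s) t + F s t) * of_bool (s < k) * of_bool (t < l))
       = ((F (Suc s) l - F (Suc s) 0) - (F s l - F s 0)) * of_bool (s < k)" for s
    using sum_increments_below[OF assms(2), of "\<lambda>t. (F (Suc s) t - F s t) * of_bool (s < k)"]
    by (simp add: algebra_simps sum.distrib sum_subtractf)
  then have "(\<Sum>s<N. \<Sum>t<N. (F (Suc s) (Suc t) - F s (Suc t) - F (Suc s) t + F s t) * of_bool (s < k) * of_bool (t < l))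
      = (\<Sum>s<N. ((F (Suc s) l - F (Suc s) 0) - (F s l - F s 0)) * of_bool (s < k))"
    by simp
  also have "\<dots> = (F k l - F k 0) - (F 0 l - F 0 0)"
    by (rule sum_increments_below[OF assms(1)])
  finally show ?thesis by simp
qed

text \<open>Points are grouped by the integer part of \<open>v x / \<epsilon>\<close>, and each group is replaced by one of
  its points. Since groups are order-convex, the resulting step kernel is a combination of products
  of indicators of up-sets with mixed differences of \<open>\<rho>\<close> as coefficients.\<close>

lemma kernel_step_approximation:
  fixes \<rho> :: "real \<Rightarrow> real \<Rightarrow> real"
  assumes v: "mono v" "\<And>x. v a \<le> v x" "\<And>x. v x \<le> v b"
    and sym: "\<And>x y. \<rho> x y = \<rho> y x"
    and mod: "\<And>x x' y. \<bar>\<rho> x y - \<rho> x' y\<bar> \<le> \<bar>v x - v x'\<bar>"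
    and grid: "\<And>g N. mono g \<Longrightarrow>
       (\<Sum>s<N. \<Sum>t<N. \<bar>mixed_difference \<rho> (g s) (g (Suc s)) (g t) (g (Suc t))\<bar>) \<le> V"
    and "\<epsilon> > 0"
  obtains N :: nat and u :: "nat \<Rightarrow> real \<Rightarrow> real" and \<alpha> \<beta> \<Delta>
  where "\<And>s. mono (u s)" "\<And>s x. u s x \<in> {0, 1}" "(\<Sum>s<N. \<Sum>t<N. \<bar>\<Delta> s t\<bar>) \<le> V"
    "\<And>x y. \<bar>\<rho> x y - (\<alpha> + (\<Sum>s<N. \<beta> s * u s x) + (\<Sum>t<N. \<beta> t * u t y)
              + (\<Sum>s<N. \<Sum>t<N. \<Delta> s t * u s x * u t y))\<bar> \<le> \<epsilon>"
proof -
  \<comment> \<open>Half of \<epsilon>, since both arguments of the kernel are moved to a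
    representative and each move costs \<delta>.\<close>
  define \<delta> where "\<delta> = \<epsilon> / 2"
  have \<delta>: "\<delta> > 0" using \<open>\<epsilon> > 0\<close> by (simp add: \<delta>_def)
  define q where "q x = nat \<lfloor>(v x - v a) / \<delta>\<rfloor>" for x
  define N where "N = q b"
  have q_mono: "q x \<le> q y" if "v x \<le> v y" for x y
    using that \<delta> by (auto simp: q_def intro!: nat_mono floor_mono divide_right_mono)
  have qN: "q x \<le> N" for x unfolding N_def by (rule q_mono[OF v(3)])
  have qa: "q a = 0" by (simp add: q_def)
  have q_close: "\<bar>v x - v y\<bar> \<le> \<delta>" if "q x = q y" for x y
  proof -
    have "\<lfloor>(v x - v a) / \<delta>\<rfloor> = \<lfloor>(v y - v a) / \<delta>\<rfloor>"
      using that v(2)[of x] v(2)[of y] \<delta> by (simp add: q_def nat_eq_iff)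
    then have "\<bar>(v x - v a) / \<delta> - (v y - v a) / \<delta>\<bar> \<le> 1" by linarith
    then have "\<bar>(v x - v y) / \<delta>\<bar> \<le> 1" by (simp add: diff_divide_distrib)
    then show ?thesis using \<delta> by (simp add: abs_divide)
  qed
  \<comment> \<open>Where \<open>v\<close> jumps, some levels are not attained by \<open>q\<close>.
    \<open>m k\<close> is the largest attained level up to \<open>k\<close>; it exists because level
    0 is attained at \<open>a\<close>.\<close>
  define m where "m k = Max {j. j \<le> k \<and> j \<in> range q}" for k
  have m_in: "m k \<le> k \<and> m k \<in> range q" for k
  proof -
    have "0 \<in> {j. j \<le> k \<and> j \<in> range q}" using qa by (metis (mono_tags) le0 mem_Collect_eq rangeI)
    then have "m k \<in> {j. j \<le> k \<and> j \<in> range q}"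
      unfolding m_def by (intro Max_in) auto
    then show ?thesis by simp
  qed
  have m_ge: "j \<le> m k" if "j \<le> k" "j \<in> range q" for j k
    unfolding m_def using that by (intro Max_ge) auto
  have m_mono: "m k \<le> m k'" if "k \<le> k'" for k k'
    using m_in[of k] that by (intro m_ge) auto
  have m_q: "m (q x) = q x" for x 
    by (rule antisym[OF conjunct1[OF m_in] m_ge]) auto
  \<comment> \<open>The choice depends on \<open>k\<close> only through \<open>m k\<close>, so
    indices with the same attained level share one representative. Monotonicity of \<open>g\<close>
    needs this.\<close>
  define g where "g k = (SOME x. q x = m k)" for k
  have qg: "q (g k) = m k" for k
  proof -
    obtain x where "q x = m k" using m_in[of k] by (metis rangeE)
    then show ?thesis unfolding g_def by (rule someI)
  qed
  have g_mono: "mono g"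
  proof (rule monoI)
    fix k k' :: nat assume kk: "k \<le> k'"
    show "g k \<le> g k'"
    proof (cases "m k = m k'")
      case True then show ?thesis by (simp add: g_def)
    next
      case False
      then have "q (g k) < q (g k')" using m_mono[OF kk] by (simp add: qg)
      then have "\<not> v (g k') \<le> v (g k)" using q_mono[of "g k'" "g k"] by auto
      then show ?thesis using v(1) by (metis linear monoD)
    qed
  qed
  have close: "\<bar>v x - v (g (q x))\<bar> \<le> \<delta>" for x
    by (rule q_close) (simp add: qg m_q)
  define u where "u s x = (of_bool (s < q x) :: real)" for s x
  define F where "F k l = \<rho> (g k) (g l)" for k l
  define \<Delta> where "\<Delta> s t = F (Suc s) (Suc t) - F s (Suc t) - F (Suc s) t + F s t" for s t
  define \<beta> where "\<beta> s = F (Suc s) 0 - F s 0" for s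
  have F1: "F (q x) 0 = F 0 0 + (\<Sum>s<N. \<beta> s * u s x)" for x
    unfolding \<beta>_def u_def using sum_increments_below[OF qN[of x], of "\<lambda>s. F s 0"] by simp
  \<comment> \<open>Symmetry of the kernel allows the same coefficients \<beta> for both
    variables.\<close>
  have F2: "F 0 (q x) = F (q x) 0" for x unfolding F_def by (rule sym)
  show thesis
  proof (rule that[of u \<Delta> N "F 0 0" \<beta>])
    show "mono (u s)" for s
    proof (rule monoI)
      fix x y :: real assume "x \<le> y"
      then have "q x \<le> q y" by (intro q_mono monoD[OF v(1)])
      then show "u s x \<le> u s y" by (simp add: u_def)
    qed
    show "u s x \<in> {0, 1}" for s x by (simp add: u_def)
    show "(\<Sum>s<N. \<Sum>t<N. \<bar>\<Delta> s t\<bar>) \<le> V"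
      using grid[OF g_mono, of N] by (simp add: \<Delta>_def F_def mixed_difference_def)
    fix x y
    have "F (q x) (q y) = F 0 0 + (\<Sum>s<N. \<beta> s * u s x) + (\<Sum>t<N. \<beta> t * u t y)
              + (\<Sum>s<N. \<Sum>t<N. \<Delta> s t * u s x * u t y)"
      using sum_mixed_differences_below[OF qN[of x] qN[of y], of F] F1[of x] F1[of y] F2[of y]
      by (simp add: \<Delta>_def u_def)
    moreover have "\<bar>\<rho> x y - F (q x) (q y)\<bar> \<le> \<epsilon>"
    proof -
      have "\<bar>\<rho> x y - \<rho> (g (q x)) y\<bar> \<le> \<delta>"
        using mod[of x y "g (q x)"] close[of x] by linarith
      moreover have "\<bar>\<rho> (g (q x)) y - \<rho> (g (q x)) (g (q y))\<bar> \<le> \<delta>"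
        using mod[of y "g (q x)" "g (q y)"] close[of y] sym[of "g (q x)"] by simp
      ultimately show ?thesis unfolding F_def using \<delta>_def by linarith
    qed
    ultimately show "\<bar>\<rho> x y - (F 0 0 + (\<Sum>s<N. \<beta> s * u s x) + (\<Sum>t<N. \<beta> t * u t y)
              + (\<Sum>s<N. \<Sum>t<N. \<Delta> s t * u s x * u t y))\<bar> \<le> \<epsilon>"
      by simp
  qed
qed

section \<open>Covariances in stationary associated sequences\<close>

text \<open>Boundedness is required at every point of the space, not almost everywhere. The class is
  closed under sums and products, so all integrability conditions in the covariance calculus reduce
  to it.\<close>

definition bounded_rv :: "'a measure \<Rightarrow> ('a \<Rightarrow> real) \<Rightarrow> bool" where
  "bounded_rv M Y \<longleftrightarrow> Y \<in> borel_measurable M \<and> (\<exists>B. \<forall>\<omega>\<in>space M. \<bar>Y \<omega>\<bar> \<le> B)"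

lemma bounded_rvI: "Y \<in> borel_measurable M \<Longrightarrow> (\<And>\<omega>. \<omega> \<in> space M \<Longrightarrow> \<bar>Y \<omega>\<bar> \<le> B) \<Longrightarrow> bounded_rv M Y"
  by (auto simp: bounded_rv_def)

lemma bounded_rv_measurable: "bounded_rv M Y \<Longrightarrow> Y \<in> borel_measurable M"
  by (simp add: bounded_rv_def)

lemma bounded_rv_const [intro]: "bounded_rv M (\<lambda>_. c)"
  by (rule bounded_rvI[of _ _ "\<bar>c\<bar>"]) auto

lemma bounded_rv_add [intro]:
  assumes "bounded_rv M Y" "bounded_rv M Z" shows "bounded_rv M (\<lambda>\<omega>. Y \<omega> + Z \<omega>)"
proof -
  obtain B C where "\<forall>\<omega>\<in>space M. \<bar>Y \<omega>\<bar> \<le> B" "\<forall>\<omega>\<in>space M. \<bar>Z \<omega>\<bar> \<le> C"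
    using assms by (auto simp: bounded_rv_def)
  then have "\<bar>Y \<omega> + Z \<omega>\<bar> \<le> B + C" if "\<omega> \<in> space M" for \<omega>
    using that by (intro order.trans[OF abs_triangle_ineq] add_mono) auto
  then show ?thesis using assms by (auto intro!: bounded_rvI[of _ _ "B + C"] simp: bounded_rv_def)
qed

lemma bounded_rv_mult [intro]:
  assumes "bounded_rv M Y" "bounded_rv M Z" shows "bounded_rv M (\<lambda>\<omega>. Y \<omega> * Z \<omega>)"
proof -
  obtain B C where BC: "\<forall>\<omega>\<in>space M. \<bar>Y \<omega>\<bar> \<le> B" "\<forall>\<omega>\<in>space M. \<bar>Z \<omega>\<bar> \<le> C"
    using assms by (auto simp: bounded_rv_def)
  have "\<bar>Y \<omega> * Z \<omega>\<bar> \<le> B * C" if "\<omega> \<in> space M" for \<omega>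
    using that BC unfolding abs_mult by (intro mult_mono) (auto intro: order.trans[OF abs_ge_zero])
  then show ?thesis using assms by (auto intro!: bounded_rvI[of _ _ "B * C"] simp: bounded_rv_def)
qed

lemma bounded_rv_diff [intro]:
  assumes "bounded_rv M Y" "bounded_rv M Z" shows "bounded_rv M (\<lambda>\<omega>. Y \<omega> - Z \<omega>)"
  using bounded_rv_add[OF assms(1) bounded_rv_mult[OF bounded_rv_const[of M "-1"] assms(2)]] by simp

lemma bounded_rv_sum [intro]:
  assumes "\<And>i. i \<in> I \<Longrightarrow> bounded_rv M (Y i)" shows "bounded_rv M (\<lambda>\<omega>. \<Sum>i\<in>I. Y i \<omega>)"
  using assms by (induction I rule: infinite_finite_induct) auto

lemma (in prob_space) bounded_rv_integrable:
  assumes "bounded_rv M Y" shows "integrable M Y"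
proof -
  obtain B where "\<forall>\<omega>\<in>space M. \<bar>Y \<omega>\<bar> \<le> B" using assms by (auto simp: bounded_rv_def)
  then show ?thesis
    using assms by (intro integrable_const_bound[of _ B] AE_I2) (auto simp: bounded_rv_def)
qed

section \<open>Bilinearity of the covariance for bounded random variables\<close>

lemma (in prob_space) cov_eq:
  assumes "bounded_rv M Y" "bounded_rv M Z"
  shows "cov M Y Z = expectation (\<lambda>\<omega>. Y \<omega> * Z \<omega>) - expectation Y * expectation Z"
proof -
  have [simp]: "integrable M Y" "integrable M Z" "integrable M (\<lambda>\<omega>. Y \<omega> * Z \<omega>)"
    using assms by (auto intro!: bounded_rv_integrable)
  show ?thesis unfolding cov_def by (simp add: algebra_simps prob_space)
qed

lemma (in prob_space) cov_add_left:
  assumes "bounded_rv M Y" "bounded_rv M Y'" "bounded_rv M Z"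
  shows "cov M (\<lambda>\<omega>. Y \<omega> + Y' \<omega>) Z = cov M Y Z + cov M Y' Z"
proof -
  have [simp]: "integrable M Y" "integrable M Y'" "integrable M (\<lambda>\<omega>. Y \<omega> * Z \<omega>)"
    "integrable M (\<lambda>\<omega>. Y' \<omega> * Z \<omega>)"
    using assms by (auto intro!: bounded_rv_integrable)
  show ?thesis using assms by (simp add: cov_eq bounded_rv_add algebra_simps)
qed

lemma (in prob_space) cov_scale_left:
  assumes "bounded_rv M Y" "bounded_rv M Z"
  shows "cov M (\<lambda>\<omega>. c * Y \<omega>) Z = c * cov M Y Z"
  using assms by (simp add: cov_eq bounded_rv_mult[OF bounded_rv_const] algebra_simps)

lemma cov_commute: "cov M Y Z = cov M Z Y"
  by (simp add: cov_def mult.commute)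

lemma cov_cong:
  assumes "\<And>\<omega>. \<omega> \<in> space M \<Longrightarrow> Y \<omega> = Y' \<omega>" "\<And>\<omega>. \<omega> \<in> space M \<Longrightarrow> Z \<omega> = Z' \<omega>"
  shows "cov M Y Z = cov M Y' Z'"
proof -
  have [simp]: "(LINT \<omega>|M. Y \<omega>) = (LINT \<omega>|M. Y' \<omega>)" "(LINT \<omega>|M. Z \<omega>) = (LINT \<omega>|M. Z' \<omega>)"
    using assms by (auto intro!: Bochner_Integration.integral_cong)
  show ?thesis unfolding cov_def using assms by (auto intro!: Bochner_Integration.integral_cong)
qed

lemma (in prob_space) cov_add_right:
  assumes "bounded_rv M Y" "bounded_rv M Y'" "bounded_rv M Z"
  shows "cov M Z (\<lambda>\<omega>. Y \<omega> + Y' \<omega>) = cov M Z Y + cov M Z Y'"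
  using cov_add_left[OF assms] by (simp add: cov_commute)

lemma (in prob_space) cov_scale_right:
  assumes "bounded_rv M Y" "bounded_rv M Z"
  shows "cov M Z (\<lambda>\<omega>. c * Y \<omega>) = c * cov M Z Y"
  using cov_scale_left[OF assms] by (simp add: cov_commute)

lemma (in prob_space) cov_diff:
  assumes "bounded_rv M Y" "bounded_rv M Y'" "bounded_rv M Z"
  shows "cov M (\<lambda>\<omega>. Y \<omega> - Y' \<omega>) Z = cov M Y Z - cov M Y' Z"
    "cov M Z (\<lambda>\<omega>. Y \<omega> - Y' \<omega>) = cov M Z Y - cov M Z Y'"
proof -
  have "bounded_rv M (\<lambda>\<omega>. (-1) * Y' \<omega>)" using assms by (intro bounded_rv_mult) auto
  from cov_add_left[OF assms(1) this assms(3)] cov_scale_left[OF assms(2,3), of "-1"]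
  show "cov M (\<lambda>\<omega>. Y \<omega> - Y' \<omega>) Z = cov M Y Z - cov M Y' Z" by simp
  then show "cov M Z (\<lambda>\<omega>. Y \<omega> - Y' \<omega>) = cov M Z Y - cov M Z Y'" by (simp add: cov_commute)
qed

lemma (in prob_space) cov_sum_left:
  assumes "\<And>i. i \<in> I \<Longrightarrow> bounded_rv M (Y i)" "bounded_rv M Z"
  shows "cov M (\<lambda>\<omega>. \<Sum>i\<in>I. Y i \<omega>) Z = (\<Sum>i\<in>I. cov M (Y i) Z)"
proof (cases "finite I")
  case True
  then show ?thesis using assms(1)
  proof induction
    case empty
    show ?case by (simp add: cov_def)
  next
    case (insert i I)
    then have "cov M (\<lambda>\<omega>. \<Sum>i\<in>insert i I. Y i \<omega>) Z = cov M (\<lambda>\<omega>. Y i \<omega> + (\<Sum>i\<in>I. Y i \<omega>)) Z"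
      by simp
    also have "\<dots> = cov M (Y i) Z + cov M (\<lambda>\<omega>. \<Sum>i\<in>I. Y i \<omega>) Z"
      using insert by (intro cov_add_left bounded_rv_sum assms(2)) auto
    finally show ?case using insert by simp
  qed
qed (simp add: cov_def)

lemma (in prob_space) cov_sum_right:
  assumes "\<And>i. i \<in> I \<Longrightarrow> bounded_rv M (Y i)" "bounded_rv M Z"
  shows "cov M Z (\<lambda>\<omega>. \<Sum>i\<in>I. Y i \<omega>) = (\<Sum>i\<in>I. cov M Z (Y i))"
  using cov_sum_left[OF assms] by (simp add: cov_commute)

text \<open>The working form of domination: increments of \<open>f\<close> are at most those of
  \<open>f'\<close> in absolute value. In this form a Lipschitz function is visibly dominated by a
  multiple of the identity.\<close>

lemma ll_onI:
  assumes "\<And>x y. x \<in> D \<Longrightarrow> y \<in> D \<Longrightarrow> x \<le> y \<Longrightarrow> \<bar>f x - f y\<bar> \<le> f' y - f' x"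
  shows "ll_on D f f'"
  unfolding ll_on_def
proof (intro conjI mono_onI)
  fix x y assume "x \<in> D" "y \<in> D" "x \<le> y"
  from assms[OF this] show "f' x + f x \<le> f' y + f y" "f' x - f x \<le> f' y - f y"
    by linarith+
qed

lemma ll_onD:
  assumes "ll_on D f f'" "x \<in> D" "y \<in> D" "x \<le> y"
  shows "\<bar>f x - f y\<bar> \<le> f' y - f' x"
proof -
  have "mono_on D (\<lambda>x. f' x + f x)" "mono_on D (\<lambda>x. f' x - f x)"
    using assms(1) by (auto simp: ll_on_def)
  from this[THEN mono_onD, OF assms(2-4)] show ?thesis by linarith
qed

text \<open>Only measurability, stationarity and association are fixed here. The density bound
  enters later as a hypothesis on small intervals, and boundedness of the variables through a clamp
  \<kappa>.\<close>

locale associated_sequence = prob_space M for M :: "'a measure" +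
  fixes X :: "nat \<Rightarrow> 'a \<Rightarrow> real"
  assumes rv: "\<And>n. n \<ge> 1 \<Longrightarrow> X n \<in> borel_measurable M"
    and stationary: "strictly_stationary M X"
    and associated: "associated M {1..} X"
begin

lemma bounded_rv_comp:
  assumes "f \<in> borel_measurable borel" "\<And>x. \<bar>f x\<bar> \<le> B" "i \<ge> 1"
  shows "bounded_rv M (\<lambda>\<omega>. f (X i \<omega>))"
  using measurable_compose[OF rv[OF assms(3)] assms(1)] assms(2) by (rule bounded_rvI)

text \<open>The codomain is a general Banach space because the lemma is also applied to complex
  exponentials of block sums.\<close>

lemma integral_shift:
  fixes \<Phi> :: "(nat \<Rightarrow> real) \<Rightarrow> 'b :: {banach, second_countable_topology}"
  assumes J: "J \<subseteq> {1..}" "finite J" and \<Phi>: "\<Phi> \<in> borel_measurable (PiM J (\<lambda>_. borel))"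
  shows "(LINT \<omega>|M. \<Phi> (\<lambda>j\<in>J. X (j + k) \<omega>)) = (LINT \<omega>|M. \<Phi> (\<lambda>j\<in>J. X j \<omega>))"
proof -
  have m: "(\<lambda>\<omega>. \<lambda>j\<in>J. X (j + k) \<omega>) \<in> measurable M (PiM J (\<lambda>_. borel))" for k
    using J by (intro measurable_restrict rv) auto
  have "(LINT \<omega>|M. \<Phi> (\<lambda>j\<in>J. X (j + k) \<omega>))
      = integral\<^sup>L (distr M (PiM J (\<lambda>_. borel)) (\<lambda>\<omega>. \<lambda>j\<in>J. X (j + k) \<omega>)) \<Phi>"
    by (rule integral_distr[symmetric, OF m \<Phi>])
  also have "\<dots> = integral\<^sup>L (distr M (PiM J (\<lambda>_. borel)) (\<lambda>\<omega>. \<lambda>j\<in>J. X j \<omega>)) \<Phi>"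
    using stationary J by (simp add: strictly_stationary_def)
  also have "\<dots> = (LINT \<omega>|M. \<Phi> (\<lambda>j\<in>J. X j \<omega>))"
    using m[of 0] by (intro integral_distr \<Phi>) simp
  finally show ?thesis .
qed

lemma integral_shift_one:
  fixes f :: "real \<Rightarrow> real"
  assumes "f \<in> borel_measurable borel" "i \<ge> 1"
  shows "expectation (\<lambda>\<omega>. f (X i \<omega>)) = expectation (\<lambda>\<omega>. f (X 1 \<omega>))"
  using integral_shift[of "{1}" "\<lambda>z. f (z 1)" "i - 1"] assms by simp

lemma cov_shift:
  assumes f: "f \<in> borel_measurable borel" "\<And>x. \<bar>f x\<bar> \<le> B" and i: "i \<ge> 1"
  shows "cov M (\<lambda>\<omega>. f (X i \<omega>)) (\<lambda>\<omega>. f (X (i + d) \<omega>)) = cov M (\<lambda>\<omega>. f (X 1 \<omega>)) (\<lambda>\<omega>. f (X (1 + d) \<omega>))"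
proof -
  have [measurable]: "f \<in> borel_measurable borel" by fact
  have "expectation (\<lambda>\<omega>. f (X i \<omega>) * f (X (i + d) \<omega>)) = expectation (\<lambda>\<omega>. f (X 1 \<omega>) * f (X (1 + d) \<omega>))"
    using integral_shift[of "{1, 1 + d}" "\<lambda>z. f (z 1) * f (z (1 + d))" "i - 1"] i
    by (simp add: add.commute)
  then show ?thesis
    using i by (simp add: cov_eq bounded_rv_comp[OF f] integral_shift_one[OF f(1), of i]
        integral_shift_one[OF f(1), of "i + d"] integral_shift_one[OF f(1), of "Suc d"])
qed

text \<open>Association applies to the nondecreasing functions \<open>F' + F\<close>,
  \<open>F' - F\<close>, \<open>G' + G\<close> and \<open>G' - G\<close>. Adding the two covariances
  with equal signs bounds the covariance of \<open>F\<close> and \<open>G\<close> from below, adding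
  the two with opposite signs bounds it from above.\<close>

lemma abs_cov_le:
  fixes F F' G G' :: "(nat \<Rightarrow> real) \<Rightarrow> real"
  assumes J: "J \<subseteq> {1..}" "finite J" "J \<noteq> {}"
    and ll: "ll_on (PiE J (\<lambda>_. UNIV)) F F'" "ll_on (PiE J (\<lambda>_. UNIV)) G G'"
    and b: "bounded_rv M (\<lambda>\<omega>. F (\<lambda>j\<in>J. X j \<omega>))" "bounded_rv M (\<lambda>\<omega>. F' (\<lambda>j\<in>J. X j \<omega>))"
      "bounded_rv M (\<lambda>\<omega>. G (\<lambda>j\<in>J. X j \<omega>))" "bounded_rv M (\<lambda>\<omega>. G' (\<lambda>j\<in>J. X j \<omega>))"
  shows "\<bar>cov M (\<lambda>\<omega>. F (\<lambda>j\<in>J. X j \<omega>)) (\<lambda>\<omega>. G (\<lambda>j\<in>J. X j \<omega>))\<bar>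
         \<le> cov M (\<lambda>\<omega>. F' (\<lambda>j\<in>J. X j \<omega>)) (\<lambda>\<omega>. G' (\<lambda>j\<in>J. X j \<omega>))"
proof -
  have nonneg: "cov M (\<lambda>\<omega>. h (\<lambda>j\<in>J. X j \<omega>)) (\<lambda>\<omega>. g (\<lambda>j\<in>J. X j \<omega>)) \<ge> 0"
    if "mono_on (PiE J (\<lambda>_. UNIV)) h" "mono_on (PiE J (\<lambda>_. UNIV)) g"
      "bounded_rv M (\<lambda>\<omega>. h (\<lambda>j\<in>J. X j \<omega>))" "bounded_rv M (\<lambda>\<omega>. g (\<lambda>j\<in>J. X j \<omega>))"
    for h g :: "(nat \<Rightarrow> real) \<Rightarrow> real"
  proof -
    have "associated_finite M J X" using associated J by (simp add: associated_def)
    moreover have "cov_exists M (\<lambda>\<omega>. h (\<lambda>j\<in>J. X j \<omega>)) (\<lambda>\<omega>. g (\<lambda>j\<in>J. X j \<omega>))"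
      using that(3,4) by (auto simp: cov_exists_def intro: bounded_rv_integrable)
    ultimately show ?thesis using that(1,2) by (simp add: associated_finite_def)
  qed
  note ex = cov_add_left cov_add_right cov_diff bounded_rv_add bounded_rv_diff b
  have "cov M (\<lambda>\<omega>. F' (\<lambda>j\<in>J. X j \<omega>) + F (\<lambda>j\<in>J. X j \<omega>)) (\<lambda>\<omega>. G' (\<lambda>j\<in>J. X j \<omega>) + G (\<lambda>j\<in>J. X j \<omega>)) \<ge> 0"
    using ll b by (intro nonneg[of "\<lambda>z. F' z + F z" "\<lambda>z. G' z + G z"]) (auto simp: ll_on_def)
  moreover have "cov M (\<lambda>\<omega>. F' (\<lambda>j\<in>J. X j \<omega>) - F (\<lambda>j\<in>J. X j \<omega>)) (\<lambda>\<omega>. G' (\<lambda>j\<in>J. X j \<omega>) - G (\<lambda>j\<in>J. X j \<omega>)) \<ge> 0"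
    using ll b by (intro nonneg[of "\<lambda>z. F' z - F z" "\<lambda>z. G' z - G z"]) (auto simp: ll_on_def)
  moreover have "cov M (\<lambda>\<omega>. F' (\<lambda>j\<in>J. X j \<omega>) + F (\<lambda>j\<in>J. X j \<omega>)) (\<lambda>\<omega>. G' (\<lambda>j\<in>J. X j \<omega>) - G (\<lambda>j\<in>J. X j \<omega>)) \<ge> 0"
    using ll b by (intro nonneg[of "\<lambda>z. F' z + F z" "\<lambda>z. G' z - G z"]) (auto simp: ll_on_def)
  moreover have "cov M (\<lambda>\<omega>. F' (\<lambda>j\<in>J. X j \<omega>) - F (\<lambda>j\<in>J. X j \<omega>)) (\<lambda>\<omega>. G' (\<lambda>j\<in>J. X j \<omega>) + G (\<lambda>j\<in>J. X j \<omega>)) \<ge> 0"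
    using ll b by (intro nonneg[of "\<lambda>z. F' z - F z" "\<lambda>z. G' z + G z"]) (auto simp: ll_on_def)
  ultimately show ?thesis by (simp add: ex)
qed

text \<open>The zero function is dominated by every nondecreasing function, so this is
  \<open>abs_cov_le\<close> with \<open>F\<close> and \<open>G\<close> equal to 0.\<close>

lemma cov_comp_nonneg:
  assumes "mono f" "\<And>x. \<bar>f x\<bar> \<le> B" "i \<ge> 1" "j \<ge> 1"
  shows "cov M (\<lambda>\<omega>. f (X i \<omega>)) (\<lambda>\<omega>. f (X j \<omega>)) \<ge> 0"
proof -
  note f = borel_measurable_mono[OF assms(1)] assms(2)
  have "\<bar>cov M (\<lambda>\<omega>. (\<lambda>_. 0) (\<lambda>j\<in>{i, j}. X j \<omega>)) (\<lambda>\<omega>. (\<lambda>_. 0) (\<lambda>j\<in>{i, j}. X j \<omega>))\<bar>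
        \<le> cov M (\<lambda>\<omega>. (\<lambda>z. f (z i)) (\<lambda>j\<in>{i, j}. X j \<omega>)) (\<lambda>\<omega>. (\<lambda>z. f (z j)) (\<lambda>j\<in>{i, j}. X j \<omega>))"
    using assms by (intro abs_cov_le)
      (auto simp: ll_on_def intro!: mono_onI monoD[OF assms(1)] bounded_rv_comp[OF f] dest: le_funD)
  then show ?thesis by simp
qed

text \<open>Adding the summand with index \<open>k + 1\<close> contributes one variance and twice
  its covariances with the \<open>k\<close> earlier summands. In this form the variance divided by
  \<open>n\<close> is a Cesaro mean of partial sums of the covariance series.\<close>

lemma cov_sum_sum:
  assumes f: "f \<in> borel_measurable borel" "\<And>x. \<bar>f x\<bar> \<le> B"
  shows "cov M (\<lambda>\<omega>. \<Sum>i=1..n. f (X i \<omega>)) (\<lambda>\<omega>. \<Sum>i=1..n. f (X i \<omega>))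
    = (\<Sum>k<n. cov M (\<lambda>\<omega>. f (X 1 \<omega>)) (\<lambda>\<omega>. f (X 1 \<omega>))
           + 2 * (\<Sum>d=1..k. cov M (\<lambda>\<omega>. f (X 1 \<omega>)) (\<lambda>\<omega>. f (X (1 + d) \<omega>))))"
proof (induction n)
  case 0
  show ?case by (simp add: cov_def)
next
  case (Suc n)
  let ?S = "\<lambda>\<omega>. \<Sum>i=1..n. f (X i \<omega>)" and ?Y = "\<lambda>i \<omega>. f (X i \<omega>)"
  let ?c = "\<lambda>d. cov M (?Y 1) (?Y (1 + d))"
  have b: "bounded_rv M (?Y i)" if "i \<ge> 1" for i using bounded_rv_comp[OF f that] .
  have bS: "bounded_rv M ?S" using b by auto
  have "cov M ?S (?Y (Suc n)) = (\<Sum>i=1..n. cov M (?Y i) (?Y (Suc n)))"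
    using b by (intro cov_sum_left) auto
  also have "\<dots> = (\<Sum>i=1..n. ?c (Suc n - i))"
    using cov_shift[OF f] by (intro sum.cong refl) (metis atLeastAtMost_iff le_Suc_eq le_add_diff_inverse)
  also have "\<dots> = (\<Sum>d=1..n. ?c d)"
    by (rule sum.reindex_bij_witness[of _ "\<lambda>d. Suc n - d" "\<lambda>d. Suc n - d"]) auto
  finally have cross: "cov M ?S (?Y (Suc n)) = (\<Sum>d=1..n. ?c d)" .
  have diag: "cov M (?Y (Suc n)) (?Y (Suc n)) = cov M (?Y 1) (?Y 1)"
    using cov_shift[OF f, of "Suc n" 0] by simp
  have "cov M (\<lambda>\<omega>. \<Sum>i=1..Suc n. f (X i \<omega>)) (\<lambda>\<omega>. \<Sum>i=1..Suc n. f (X i \<omega>))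
      = cov M (\<lambda>\<omega>. ?S \<omega> + ?Y (Suc n) \<omega>) (\<lambda>\<omega>. ?S \<omega> + ?Y (Suc n) \<omega>)" by simp
  also have "\<dots> = cov M ?S ?S + 2 * cov M ?S (?Y (Suc n)) + cov M (?Y (Suc n)) (?Y (Suc n))"
    using bS b[of "Suc n"] cov_commute[of M "?Y (Suc n)" ?S]
    by (simp add: cov_add_left cov_add_right bounded_rv_add)
  finally show ?case using Suc cross diag by simp
qed

end

text \<open>A nonconstant \<open>u\<close> jumps once, at the infimum \<open>t\<close> of the set
  where it is 1. The ramp climbs with slope \<open>1 / \<delta>\<close> just below \<open>t\<close>.
  The interval in the conclusion is closed, so the value of \<open>u\<close> at \<open>t\<close>
  itself does not matter.\<close>

lemma mono_zero_one_ramp_approximation: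
  fixes u :: "real \<Rightarrow> real"
  assumes u: "mono u" "\<And>x. u x \<in> {0, 1}" and \<delta>: "\<delta> > 0"
  obtains f t where "mono f" "\<And>x. 0 \<le> f x \<and> f x \<le> 1" "\<And>x y. \<bar>f x - f y\<bar> \<le> \<bar>x - y\<bar> / \<delta>"
    "\<And>x. \<bar>u x - f x\<bar> \<le> indicator {t - \<delta>..t} x"
proof (cases "(\<exists>x. u x = 0) \<and> (\<exists>x. u x = 1)")
  case False
  \<comment> \<open>Without a jump there is no meaningful infimum, but then \<open>u\<close> is
    constant and serves as its own approximation; 0 is an arbitrary choice of
    \<open>t\<close>.\<close>
  then have c: "u x = u 0" for x using u(2) by (metis empty_iff insert_iff)
  have "mono (\<lambda>_. u 0)" by (simp add: mono_def)
  then show thesis using that[of "\<lambda>_. u 0" 0] u(2)[of 0] \<delta> c by auto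
next
  case True
  define t where "t = Inf {x. u x = 1}"
  obtain x0 where x0: "u x0 = 0" using True by blast
  have lower: "x0 \<le> x" if "u x = 1" for x
    using monoD[OF u(1), of x x0] that x0 by (cases "x \<le> x0") auto
  have bdd: "bdd_below {x. u x = 1}" using lower by (intro bdd_belowI[of _ x0]) auto
  have u0: "u x = 0" if "x < t" for x
    using u(2)[of x] cInf_lower[OF _ bdd, of x] that by (auto simp: t_def)
  have u1: "u x = 1" if x: "t < x" for x
  proof -
    obtain y where "u y = 1" "y < x"
      using cInf_lessD[of "{x. u x = 1}" x] True x by (auto simp: t_def)
    then show ?thesis using monoD[OF u(1), of y x] u(2)[of x] by auto
  qed
  define f where "f x = max 0 (min 1 ((x - t) / \<delta> + 1))" for x
  have lin: "(x - t) / \<delta> \<le> (y - t) / \<delta>" if "x \<le> y" for x y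
    using that \<delta> by (simp add: divide_right_mono)
  show thesis
  proof (rule that[of f t])
    show "mono f" using lin by (intro monoI) (fastforce simp: f_def)
    show "0 \<le> f x \<and> f x \<le> 1" for x by (simp add: f_def)
    show "\<bar>f x - f y\<bar> \<le> \<bar>x - y\<bar> / \<delta>" for x y
    proof -
      have "\<bar>f x - f y\<bar> \<le> \<bar>(x - t) / \<delta> - (y - t) / \<delta>\<bar>" unfolding f_def by linarith
      also have "\<dots> = \<bar>x - y\<bar> / \<delta>" using \<delta> by (simp add: diff_divide_distrib[symmetric] abs_divide)
      finally show ?thesis .
    qed
    fix x
    consider "x < t - \<delta>" | "t < x" | "t - \<delta> \<le> x" "x \<le> t" by linarith
    then show "\<bar>u x - f x\<bar> \<le> indicator {t - \<delta>..t} x"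
    proof cases
      case 1
      then have "(x - t) / \<delta> \<le> -1" using \<delta> by (simp add: field_simps)
      then show ?thesis using u0[of x] 1 \<delta> by (simp add: f_def)
    next
      case 2
      then have "(x - t) / \<delta> \<ge> 0" using \<delta> by simp
      then show ?thesis using u1[of x] 2 by (simp add: f_def)
    next
      case 3
      then show ?thesis using u(2)[of x] by (auto simp: f_def)
    qed
  qed
qed

section \<open>Covariance inequalities for Lipschitz functions and for indicators\<close>

context associated_sequence
begin

text \<open>On the range of the variables \<kappa> is the identity, so \<open>f\<close> may be
  replaced by its composition with \<kappa>, which is dominated by \<open>L\<close> times \<kappa>.
  Using \<kappa> in place of the identity keeps the dominating function bounded on the whole
  line.\<close>

lemma cov_Lipschitz_le:
  assumes f: "mono f" "\<And>x. \<bar>f x\<bar> \<le> B" "\<And>x y. \<bar>f x - f y\<bar> \<le> L * \<bar>x - y\<bar>"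
    and \<kappa>: "mono \<kappa>" "\<And>x. \<bar>\<kappa> x\<bar> \<le> C" "\<And>i \<omega>. i \<ge> 1 \<Longrightarrow> \<omega> \<in> space M \<Longrightarrow> \<kappa> (X i \<omega>) = X i \<omega>"
    and ij: "i \<ge> 1" "j \<ge> 1"
  shows "cov M (\<lambda>\<omega>. f (X i \<omega>)) (\<lambda>\<omega>. f (X j \<omega>)) \<le> L\<^sup>2 * cov M (\<lambda>\<omega>. \<kappa> (X i \<omega>)) (\<lambda>\<omega>. \<kappa> (X j \<omega>))"
proof -
  have km: "\<kappa> \<in> borel_measurable borel" using \<kappa>(1) by (rule borel_measurable_mono)
  have fk: "(\<lambda>x. f (\<kappa> x)) \<in> borel_measurable borel"
    using f \<kappa> by (intro borel_measurable_mono) (auto simp: mono_def)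
  have "L * \<bar>1 - 0\<bar> \<ge> 0" using order.trans[OF abs_ge_zero f(3)[of 1 0]] by simp
  then have L: "L \<ge> 0" by simp
  have LC: "\<bar>L * \<kappa> x\<bar> \<le> L * C" for x using \<kappa>(2)[of x] L by (simp add: abs_mult mult_left_mono)
  have bk: "bounded_rv M (\<lambda>\<omega>. \<kappa> (X k \<omega>))" if "k \<ge> 1" for k using bounded_rv_comp[OF km \<kappa>(2) that] .
  have ll: "ll_on (PiE {i, j} (\<lambda>_. UNIV)) (\<lambda>z. f (\<kappa> (z k))) (\<lambda>z. L * \<kappa> (z k))" for k
  proof -
    have "\<bar>f (\<kappa> x) - f (\<kappa> y)\<bar> \<le> L * \<kappa> y - L * \<kappa> x" if "x \<le> y" for x y
      using f(3)[of "\<kappa> x" "\<kappa> y"] monoD[OF \<kappa>(1) that] by (simp add: right_diff_distrib)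
    then show ?thesis by (auto intro!: ll_onI dest: le_funD[of _ _ k])
  qed
  have "cov M (\<lambda>\<omega>. f (X i \<omega>)) (\<lambda>\<omega>. f (X j \<omega>)) = cov M (\<lambda>\<omega>. f (\<kappa> (X i \<omega>))) (\<lambda>\<omega>. f (\<kappa> (X j \<omega>)))"
    using \<kappa>(3) ij by (intro cov_cong) auto
  also have "\<dots> \<le> \<bar>cov M (\<lambda>\<omega>. (\<lambda>z. f (\<kappa> (z i))) (\<lambda>j\<in>{i, j}. X j \<omega>)) (\<lambda>\<omega>. (\<lambda>z. f (\<kappa> (z j))) (\<lambda>j\<in>{i, j}. X j \<omega>))\<bar>"
    by simp
  also have "\<dots> \<le> cov M (\<lambda>\<omega>. (\<lambda>z. L * \<kappa> (z i)) (\<lambda>j\<in>{i, j}. X j \<omega>)) (\<lambda>\<omega>. (\<lambda>z. L * \<kappa> (z j)) (\<lambda>j\<in>{i, j}. X j \<omega>))"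
    using ij bounded_rv_comp[OF fk f(2)] bounded_rv_comp[OF borel_measurable_times[OF borel_measurable_const km] LC]
    by (intro abs_cov_le ll) auto
  also have "\<dots> = L\<^sup>2 * cov M (\<lambda>\<omega>. \<kappa> (X i \<omega>)) (\<lambda>\<omega>. \<kappa> (X j \<omega>))"
    using bk[OF ij(1)] bk[OF ij(2)] bounded_rv_mult[OF bounded_rv_const bk[OF ij(2)], of L]
    by (simp add: cov_scale_left cov_scale_right power2_eq_square)
  finally show ?thesis .
qed

text \<open>One argument is exchanged at a time, and only the arguments that stay fixed,
  \<open>Z\<close> and then \<open>Y'\<close>, have to be bounded by 1. Each exchange costs \<eta>
  for the mean of the product and \<eta> for the product of the means.\<close>

lemma abs_cov_diff_le:
  assumes "bounded_rv M Y" "bounded_rv M Y'" "bounded_rv M Z" "bounded_rv M Z'"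
    and le1: "\<And>\<omega>. \<bar>Y' \<omega>\<bar> \<le> 1" "\<And>\<omega>. \<bar>Z \<omega>\<bar> \<le> 1"
    and d: "expectation (\<lambda>\<omega>. \<bar>Y \<omega> - Y' \<omega>\<bar>) \<le> \<eta>" "expectation (\<lambda>\<omega>. \<bar>Z \<omega> - Z' \<omega>\<bar>) \<le> \<eta>"
  shows "\<bar>cov M Y Z - cov M Y' Z'\<bar> \<le> 4 * \<eta>"
proof -
  have main: "\<bar>cov M D W\<bar> \<le> 2 * \<eta>"
    if D: "bounded_rv M D" "bounded_rv M W" "\<And>\<omega>. \<bar>W \<omega>\<bar> \<le> 1" "expectation (\<lambda>\<omega>. \<bar>D \<omega>\<bar>) \<le> \<eta>" for D W
  proof -
    have aD: "integrable M (\<lambda>\<omega>. \<bar>D \<omega>\<bar>)" using bounded_rv_integrable[OF D(1)] by simp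
    have iDW: "integrable M (\<lambda>\<omega>. D \<omega> * W \<omega>)" using bounded_rv_integrable D by auto
    have "\<bar>expectation (\<lambda>\<omega>. D \<omega> * W \<omega>)\<bar> \<le> expectation (\<lambda>\<omega>. \<bar>D \<omega>\<bar>)"
    proof -
      have "\<bar>expectation (\<lambda>\<omega>. D \<omega> * W \<omega>)\<bar> \<le> expectation (\<lambda>\<omega>. \<bar>D \<omega> * W \<omega>\<bar>)" by simp
      also have "\<dots> \<le> expectation (\<lambda>\<omega>. \<bar>D \<omega>\<bar>)"
      proof (rule integral_mono[OF integrable_abs[OF iDW] aD])
        show "\<bar>D \<omega> * W \<omega>\<bar> \<le> \<bar>D \<omega>\<bar>" for \<omega> using D(3)[of \<omega>] by (simp add: abs_mult mult_left_le)
      qed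
      finally show ?thesis .
    qed
    moreover have "\<bar>expectation D * expectation W\<bar> \<le> expectation (\<lambda>\<omega>. \<bar>D \<omega>\<bar>)"
    proof -
      have "\<bar>expectation W\<bar> \<le> expectation (\<lambda>_. 1)"
        using bounded_rv_integrable[OF D(2)] D(3)
        by (intro order.trans[OF integral_abs_bound] integral_mono) auto
      then have "\<bar>expectation W\<bar> \<le> 1" by (simp add: prob_space)
      then show ?thesis
        unfolding abs_mult using integral_abs_bound[of M D]
        by (meson abs_ge_zero mult_left_le order.trans)
    qed
    ultimately show ?thesis using D by (simp add: cov_eq)
  qed
  have "cov M Y Z - cov M Y' Z' = cov M (\<lambda>\<omega>. Y \<omega> - Y' \<omega>) Z + cov M (\<lambda>\<omega>. Z \<omega> - Z' \<omega>) Y'"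
    using assms by (simp add: cov_diff cov_commute[of M _ Y'])
  moreover have "\<bar>cov M (\<lambda>\<omega>. Y \<omega> - Y' \<omega>) Z\<bar> \<le> 2 * \<eta>" "\<bar>cov M (\<lambda>\<omega>. Z \<omega> - Z' \<omega>) Y'\<bar> \<le> 2 * \<eta>"
    using assms by (auto intro!: main)
  ultimately show ?thesis by linarith
qed

text \<open>Replacing the indicator by a ramp of width \<delta> bounds its covariance by
  \<open>c / \<delta>\<^sup>2 + 4 * K * \<delta>\<close>, where \<open>c\<close> is the covariance
  of the clamped variables. The width \<open>c powr (1/3)\<close> makes both terms multiples of
  \<open>c powr (1/3)\<close>.\<close>

lemma cov_indicator_le:
  assumes u: "mono u" "\<And>x. u x \<in> {0, 1}"
    and dens: "\<And>i t \<delta>. i \<ge> 1 \<Longrightarrow> \<delta> > 0 \<Longrightarrow> expectation (\<lambda>\<omega>. indicator {t - \<delta>..t} (X i \<omega>)) \<le> K * \<delta>"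
    and \<kappa>: "mono \<kappa>" "\<And>x. \<bar>\<kappa> x\<bar> \<le> C" "\<And>i \<omega>. i \<ge> 1 \<Longrightarrow> \<omega> \<in> space M \<Longrightarrow> \<kappa> (X i \<omega>) = X i \<omega>"
    and ij: "i \<ge> 1" "j \<ge> 1"
  shows "cov M (\<lambda>\<omega>. u (X i \<omega>)) (\<lambda>\<omega>. u (X j \<omega>))
    \<le> (1 + 4 * K) * cov M (\<lambda>\<omega>. \<kappa> (X i \<omega>)) (\<lambda>\<omega>. \<kappa> (X j \<omega>)) powr (1/3)"
proof -
  let ?c = "cov M (\<lambda>\<omega>. \<kappa> (X i \<omega>)) (\<lambda>\<omega>. \<kappa> (X j \<omega>))"
  have c0: "?c \<ge> 0" by (rule cov_comp_nonneg[OF \<kappa>(1,2) ij])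
  have um: "u \<in> borel_measurable borel" using u(1) by (rule borel_measurable_mono)
  have ub: "\<bar>u x\<bar> \<le> 1" for x using u(2)[of x] by auto
  have bound: "cov M (\<lambda>\<omega>. u (X i \<omega>)) (\<lambda>\<omega>. u (X j \<omega>)) \<le> ?c / \<delta>\<^sup>2 + 4 * (K * \<delta>)" if \<delta>: "\<delta> > 0" for \<delta>
  proof -
    obtain f t where f: "mono f" "\<And>x. 0 \<le> f x \<and> f x \<le> 1" "\<And>x y. \<bar>f x - f y\<bar> \<le> \<bar>x - y\<bar> / \<delta>"
      "\<And>x. \<bar>u x - f x\<bar> \<le> indicator {t - \<delta>..t} x"
      using mono_zero_one_ramp_approximation[OF u \<delta>] by metis
    have fm: "f \<in> borel_measurable borel" using f(1) by (rule borel_measurable_mono)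
    have fb: "\<bar>f x\<bar> \<le> 1" for x using f(2)[of x] by auto
    have bu: "bounded_rv M (\<lambda>\<omega>. u (X k \<omega>))" and bf: "bounded_rv M (\<lambda>\<omega>. f (X k \<omega>))" if "k \<ge> 1" for k
      using bounded_rv_comp[OF um ub that] bounded_rv_comp[OF fm fb that] .
    have close: "expectation (\<lambda>\<omega>. \<bar>u (X k \<omega>) - f (X k \<omega>)\<bar>) \<le> K * \<delta>" if "k \<ge> 1" for k
    proof -
      have "bounded_rv M (\<lambda>\<omega>. indicator {t - \<delta>..t} (X k \<omega>))"
        by (rule bounded_rv_comp[of "indicator {t - \<delta>..t}" 1, OF _ _ that])
          (auto simp: indicator_def)
      then have "expectation (\<lambda>\<omega>. \<bar>u (X k \<omega>) - f (X k \<omega>)\<bar>) \<le> expectation (\<lambda>\<omega>. indicator {t - \<delta>..t} (X k \<omega>))"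
        using bounded_rv_diff[OF bu[OF that] bf[OF that]] f(4)
        by (intro integral_mono) (auto intro!: bounded_rv_integrable integrable_abs)
      also have "\<dots> \<le> K * \<delta>" by (rule dens[OF that \<delta>])
      finally show ?thesis .
    qed
    have "\<bar>cov M (\<lambda>\<omega>. u (X i \<omega>)) (\<lambda>\<omega>. u (X j \<omega>)) - cov M (\<lambda>\<omega>. f (X i \<omega>)) (\<lambda>\<omega>. f (X j \<omega>))\<bar> \<le> 4 * (K * \<delta>)"
      using ij by (intro abs_cov_diff_le bu bf close fb ub) auto
    moreover have "cov M (\<lambda>\<omega>. f (X i \<omega>)) (\<lambda>\<omega>. f (X j \<omega>)) \<le> (1 / \<delta>)\<^sup>2 * ?c"
      using f(3) by (intro cov_Lipschitz_le[OF f(1) fb _ \<kappa> ij]) auto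
    ultimately show ?thesis by (simp add: power_divide)
  qed
  show ?thesis
  proof (cases "?c = 0")
    case True
    have "cov M (\<lambda>\<omega>. u (X i \<omega>)) (\<lambda>\<omega>. u (X j \<omega>)) \<le> 0"
    proof (rule field_le_epsilon)
      fix e :: real assume e: "e > 0"
      \<comment> \<open>For vanishing covariance the balancing width would be 0, so the width tends
        to 0 instead. The denominator uses the absolute value of \<open>K\<close> because no sign of
        \<open>K\<close> is assumed in this lemma.\<close>
      define \<delta> where "\<delta> = e / (4 * (\<bar>K\<bar> + 1))"
      have "K / (\<bar>K\<bar> + 1) \<le> 1" by (subst divide_le_eq_1_pos) (auto simp: add_nonneg_pos)
      then have "e * (K / (\<bar>K\<bar> + 1)) \<le> e" using e by (intro mult_left_le) auto
      moreover have "4 * (K * (e / (4 * (\<bar>K\<bar> + 1)))) = e * (K / (\<bar>K\<bar> + 1))"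
        by (simp add: divide_simps)
      ultimately have "4 * (K * \<delta>) \<le> e" by (simp only: \<delta>_def)
      moreover have "\<delta> > 0" using e by (simp add: \<delta>_def add_nonneg_pos)
      ultimately show "cov M (\<lambda>\<omega>. u (X i \<omega>)) (\<lambda>\<omega>. u (X j \<omega>)) \<le> 0 + e"
        using bound[of \<delta>] True by simp
    qed
    then show ?thesis using True by simp
  next
    case False
    then have c: "?c > 0" using c0 by simp
    have "?c / (?c powr (1/3))\<^sup>2 = ?c powr (1/3)"
    proof -
      have "(?c powr (1/3)) ^ 3 = ?c"
        using c by (simp add: powr_realpow[symmetric] powr_powr)
      then have "(?c powr (1/3)) * (?c powr (1/3))\<^sup>2 = ?c" by (simp add: power3_eq_cube power2_eq_square)
      then show ?thesis using c by (simp add: field_simps)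
    qed
    then show ?thesis using bound[of "?c powr (1/3)"] c by (simp add: algebra_simps)
  qed
qed

end

section \<open>The degenerate part of the double sum\<close>

lemma sum_rotate:
  "(\<Sum>i\<in>A. \<Sum>j\<in>B. \<Sum>k\<in>C. f i j k) = (\<Sum>k\<in>C. \<Sum>i\<in>A. \<Sum>j\<in>B. f i j k)"
proof -
  have "(\<Sum>i\<in>A. \<Sum>j\<in>B. \<Sum>k\<in>C. f i j k) = (\<Sum>i\<in>A. \<Sum>k\<in>C. \<Sum>j\<in>B. f i j k)"
    by (intro sum.cong refl sum.swap)
  also have "\<dots> = (\<Sum>k\<in>C. \<Sum>i\<in>A. \<Sum>j\<in>B. f i j k)" by (rule sum.swap)
  finally show ?thesis .
qed

text \<open>The essential point is that \<open>V\<close> is chosen before \<epsilon>. The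
  coefficients \<alpha> and \<beta> are unrestricted, since constants and functions of one variable
  cancel in the degenerate part.\<close>

definition uniformly_step_approximable :: "(real \<Rightarrow> real \<Rightarrow> real) \<Rightarrow> real \<Rightarrow> bool" where
  "uniformly_step_approximable \<rho> V \<longleftrightarrow> (\<forall>\<epsilon>>0. \<exists>(N::nat) (u :: nat \<Rightarrow> real \<Rightarrow> real) \<alpha> \<beta> \<Delta>.
     (\<forall>s. mono (u s)) \<and> (\<forall>s x. u s x \<in> {0, 1}) \<and> (\<Sum>s<N. \<Sum>t<N. \<bar>\<Delta> s t\<bar>) \<le> V \<and>
     (\<forall>x y. \<bar>\<rho> x y - (\<alpha> + (\<Sum>s<N. \<beta> s * u s x) + (\<Sum>t<N. \<beta> t * u t y)
              + (\<Sum>s<N. \<Sum>t<N. \<Delta> s t * u s x * u t y))\<bar> \<le> \<epsilon>))"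

text \<open>Joint measurability of the kernel comes for free: step kernels built from nondecreasing
  functions are Borel, and the kernel is their uniform limit.\<close>

lemma uniformly_step_approximable_measurable:
  assumes "uniformly_step_approximable \<rho> V"
  shows "(\<lambda>z. \<rho> (fst z) (snd z)) \<in> borel_measurable (borel \<Otimes>\<^sub>M borel)"
proof -
  have "\<exists>P. P \<in> borel_measurable (borel \<Otimes>\<^sub>M borel) \<and>
          (\<forall>z. \<bar>\<rho> (fst z) (snd z) - P z\<bar> \<le> \<epsilon>)" if \<epsilon>: "\<epsilon> > 0" for \<epsilon> :: real
  proof -
    obtain N :: nat and u :: "nat \<Rightarrow> real \<Rightarrow> real" and \<alpha> \<beta> \<Delta> where u: "\<And>s. mono (u s)"
      and a: "\<And>x y. \<bar>\<rho> x y - (\<alpha> + (\<Sum>s<N. \<beta> s * u s x) + (\<Sum>t<N. \<beta> t * u t y)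
                + (\<Sum>s<N. \<Sum>t<N. \<Delta> s t * u s x * u t y))\<bar> \<le> \<epsilon>"
      using assms[unfolded uniformly_step_approximable_def, rule_format, OF \<epsilon>] by blast
    have [measurable]: "u s \<in> borel_measurable borel" for s using u by (rule borel_measurable_mono)
    show ?thesis
      by (rule exI[of _ "\<lambda>z. \<alpha> + (\<Sum>s<N. \<beta> s * u s (fst z)) + (\<Sum>t<N. \<beta> t * u t (snd z))
                + (\<Sum>s<N. \<Sum>t<N. \<Delta> s t * u s (fst z) * u t (snd z))"])
         (use a in auto)
  qed
  then have "\<exists>P. P \<in> borel_measurable (borel \<Otimes>\<^sub>M borel) \<and>
          (\<forall>z. \<bar>\<rho> (fst z) (snd z) - P z\<bar> \<le> inverse (real (Suc n)))" for n by simp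
  then obtain P where P: "\<And>n. P n \<in> borel_measurable (borel \<Otimes>\<^sub>M borel)"
     "\<And>n z. \<bar>\<rho> (fst z) (snd z) - P n z\<bar> \<le> inverse (real (Suc n))" by metis
  have "(\<lambda>n. P n z) \<longlonglongrightarrow> \<rho> (fst z) (snd z)" for z
  proof (rule LIM_zero_cancel, rule Lim_null_comparison)
    show "\<forall>\<^sub>F n in sequentially. norm (P n z - \<rho> (fst z) (snd z)) \<le> inverse (real (Suc n))"
      using P(2) by (auto simp: abs_minus_commute)
  qed (rule LIMSEQ_inverse_real_of_nat)
  then show ?thesis using P(1) by (rule borel_measurable_LIMSEQ_real)
qed

context associated_sequence
begin

lemma cov_indicator_sum_le:
  assumes u: "mono u" "\<And>x. u x \<in> {0, 1}"
    and dens: "\<And>i t \<delta>. i \<ge> 1 \<Longrightarrow> \<delta> > 0 \<Longrightarrow> expectation (\<lambda>\<omega>. indicator {t - \<delta>..t} (X i \<omega>)) \<le> K * \<delta>"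
    and K: "K \<ge> 0"
    and \<kappa>: "mono \<kappa>" "\<And>x. \<bar>\<kappa> x\<bar> \<le> C" "\<And>i \<omega>. i \<ge> 1 \<Longrightarrow> \<omega> \<in> space M \<Longrightarrow> \<kappa> (X i \<omega>) = X i \<omega>"
    and sm: "summable (\<lambda>d. cov M (\<lambda>\<omega>. \<kappa> (X 1 \<omega>)) (\<lambda>\<omega>. \<kappa> (X (1 + d) \<omega>)) powr (1/3))"
  shows "cov M (\<lambda>\<omega>. \<Sum>i=1..n. u (X i \<omega>)) (\<lambda>\<omega>. \<Sum>i=1..n. u (X i \<omega>))
    \<le> 2 * (1 + 4 * K) * (\<Sum>d. cov M (\<lambda>\<omega>. \<kappa> (X 1 \<omega>)) (\<lambda>\<omega>. \<kappa> (X (1 + d) \<omega>)) powr (1/3)) * real n"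
proof -
  let ?w = "\<lambda>d. cov M (\<lambda>\<omega>. \<kappa> (X 1 \<omega>)) (\<lambda>\<omega>. \<kappa> (X (1 + d) \<omega>)) powr (1/3)"
  let ?c = "\<lambda>d. cov M (\<lambda>\<omega>. u (X 1 \<omega>)) (\<lambda>\<omega>. u (X (1 + d) \<omega>))"
  have um: "u \<in> borel_measurable borel" using u(1) by (rule borel_measurable_mono)
  have ub: "\<bar>u x\<bar> \<le> 1" for x using u(2)[of x] by auto
  have c: "?c d \<le> (1 + 4 * K) * ?w d" for d
    by (rule cov_indicator_le[OF u dens \<kappa>]) auto
  have "?c 0 + 2 * (\<Sum>d=1..k. ?c d) \<le> 2 * (1 + 4 * K) * (\<Sum>d. ?w d)" for k
  proof -
    \<comment> \<open>The factor 2 put on the diagonal term is slack; it lets lag 0 join the other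
      lags in one series.\<close>
    have "?c 0 + 2 * (\<Sum>d=1..k. ?c d) \<le> 2 * ((1 + 4 * K) * ?w 0) + 2 * (\<Sum>d=1..k. (1 + 4 * K) * ?w d)"
    proof (intro add_mono mult_left_mono sum_mono c)
      have "(1 + 4 * K) * ?w 0 \<ge> 0" using K by simp
      then show "?c 0 \<le> 2 * ((1 + 4 * K) * ?w 0)" using c[of 0] by linarith
    qed auto
    also have "\<dots> = 2 * (1 + 4 * K) * (\<Sum>d\<le>k. ?w d)"
      by (simp add: atMost_atLeast0 sum.atLeast_Suc_atMost[of 0 k] sum_distrib_left algebra_simps)
    also have "\<dots> \<le> 2 * (1 + 4 * K) * (\<Sum>d. ?w d)"
      using K by (intro mult_left_mono sum_le_suminf sm) auto
    finally show ?thesis .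
  qed
  then have "(\<Sum>k<n. ?c 0 + 2 * (\<Sum>d=1..k. ?c d)) \<le> (\<Sum>k<n. 2 * (1 + 4 * K) * (\<Sum>d. ?w d))"
    by (rule sum_mono)
  then show ?thesis
    using cov_sum_sum[OF um ub, of n] by (simp add: mult.commute)
qed

lemma marginal_measurable:
  assumes ap: "uniformly_step_approximable \<rho> V"
    and r: "\<And>x. r x = expectation (\<lambda>\<omega>. \<rho> x (X 1 \<omega>))"
  shows "r \<in> borel_measurable borel"
proof -
  have [measurable]: "X (Suc 0) \<in> borel_measurable M" by (rule rv) simp
  have "(\<lambda>z. \<rho> (fst z) (X 1 (snd z))) \<in> borel_measurable (borel \<Otimes>\<^sub>M M)"
    using measurable_compose[OF _ uniformly_step_approximable_measurable[OF ap],
        of "\<lambda>z. (fst z, X 1 (snd z))" "borel \<Otimes>\<^sub>M M"] by simp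
  then show ?thesis
    unfolding r by (intro borel_measurable_lebesgue_integral) (simp add: case_prod_beta')
qed

lemma bounded_rv_kernel:
  assumes ap: "uniformly_step_approximable \<rho> V" and B: "\<And>x y. \<bar>\<rho> x y\<bar> \<le> B"
  shows "i \<ge> 1 \<Longrightarrow> j \<ge> 1 \<Longrightarrow> bounded_rv M (\<lambda>\<omega>. \<rho> (X i \<omega>) (X j \<omega>))"
    "i \<ge> 1 \<Longrightarrow> bounded_rv M (\<lambda>\<omega>. \<rho> x (X i \<omega>))"
proof -
  note m = measurable_compose[OF _ uniformly_step_approximable_measurable[OF ap]]
  show "bounded_rv M (\<lambda>\<omega>. \<rho> (X i \<omega>) (X j \<omega>))" if "i \<ge> 1" "j \<ge> 1"
    using m[of "\<lambda>\<omega>. (X i \<omega>, X j \<omega>)" M] rv[OF that(1)] rv[OF that(2)] B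
    by (auto intro!: bounded_rvI[of _ _ B])
  show "bounded_rv M (\<lambda>\<omega>. \<rho> x (X i \<omega>))" if "i \<ge> 1"
    using m[of "\<lambda>\<omega>. (x, X i \<omega>)" M] rv[OF that] B by (auto intro!: bounded_rvI[of _ _ B])
qed

lemma abs_marginal_le:
  assumes ap: "uniformly_step_approximable \<rho> V" and B: "\<And>x y. \<bar>\<rho> x y\<bar> \<le> B"
    and r: "\<And>x. r x = expectation (\<lambda>\<omega>. \<rho> x (X 1 \<omega>))"
  shows "\<bar>r x\<bar> \<le> B"
proof -
  have "\<bar>r x\<bar> \<le> expectation (\<lambda>\<omega>. B)"
    unfolding r using bounded_rv_integrable[OF bounded_rv_kernel(2)[OF ap B]] B
    by (intro order.trans[OF integral_abs_bound] integral_mono) auto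
  then show ?thesis by (simp add: prob_space)
qed

text \<open>For a step kernel the degenerate part of the double sum is \<open>\<Sum>s t. \<Delta> s t * Z s * Z t\<close> with
  centred partial sums \<open>Z s\<close> of indicators. By \<open>\<bar>Z s * Z t\<bar> \<le> ((Z s)\<^sup>2 + (Z t)\<^sup>2) / 2\<close> only
  second moments are needed, and these grow linearly.\<close>

lemma degenerate_double_sum_le:
  assumes ap: "uniformly_step_approximable \<rho> V"
    and B: "\<And>x y. \<bar>\<rho> x y\<bar> \<le> B" and sym: "\<And>x y. \<rho> x y = \<rho> y x"
    and var: "\<And>u :: real \<Rightarrow> real. mono u \<Longrightarrow> (\<And>x. u x \<in> {0, 1}) \<Longrightarrow>
        cov M (\<lambda>\<omega>. \<Sum>i=1..n. u (X i \<omega>)) (\<lambda>\<omega>. \<Sum>i=1..n. u (X i \<omega>)) \<le> W"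
    and r: "\<And>x. r x = expectation (\<lambda>\<omega>. \<rho> x (X 1 \<omega>))"
    and \<theta>: "\<theta> = expectation (\<lambda>\<omega>. r (X 1 \<omega>))" and W: "W \<ge> 0"
  shows "expectation (\<lambda>\<omega>. \<bar>\<Sum>i=1..n. \<Sum>j=1..n. \<rho> (X i \<omega>) (X j \<omega>) - r (X i \<omega>) - r (X j \<omega>) + \<theta>\<bar>) \<le> V * W"
proof -
  note \<rho>b = bounded_rv_kernel(1)[OF ap B] and \<rho>1 = bounded_rv_kernel(2)[OF ap B order_refl]
  have rm: "r \<in> borel_measurable borel" by (rule marginal_measurable[OF ap r])
  have rB: "\<bar>r x\<bar> \<le> B" for x by (rule abs_marginal_le[OF ap B r])
  have rb: "bounded_rv M (\<lambda>\<omega>. r (X i \<omega>))" if "i \<ge> 1" for i by (rule bounded_rv_comp[OF rm rB that])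
  let ?h = "\<lambda>x y. \<rho> x y - r x - r y + \<theta>"
  let ?T = "\<lambda>\<omega>. \<Sum>i=1..n. \<Sum>j=1..n. ?h (X i \<omega>) (X j \<omega>)"
  have Tb: "bounded_rv M ?T"
    by (intro bounded_rv_sum bounded_rv_add bounded_rv_diff \<rho>b rb) auto
  \<comment> \<open>Only the first term depends on \<epsilon>, and \<open>n\<close> is fixed, so
    \<epsilon> may tend to 0 at the end.\<close>
  have approx: "expectation (\<lambda>\<omega>. \<bar>?T \<omega>\<bar>) \<le> (real n)\<^sup>2 * (4 * \<epsilon>) + V * W" if \<epsilon>: "\<epsilon> > 0" for \<epsilon>
  proof -
    obtain N :: nat and u :: "nat \<Rightarrow> real \<Rightarrow> real" and \<alpha> \<beta> \<Delta>
      where u: "\<And>s. mono (u s)" "\<And>s x. u s x \<in> {0, 1}" and \<Delta>: "(\<Sum>s<N. \<Sum>t<N. \<bar>\<Delta> s t\<bar>) \<le> V"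
      and a: "\<And>x y. \<bar>\<rho> x y - (\<alpha> + (\<Sum>s<N. \<beta> s * u s x) + (\<Sum>t<N. \<beta> t * u t y)
                + (\<Sum>s<N. \<Sum>t<N. \<Delta> s t * u s x * u t y))\<bar> \<le> \<epsilon>"
      using ap[unfolded uniformly_step_approximable_def, rule_format, OF \<epsilon>] by blast
    define P where "P x y = \<alpha> + (\<Sum>s<N. \<beta> s * u s x) + (\<Sum>t<N. \<beta> t * u t y)
                + (\<Sum>s<N. \<Sum>t<N. \<Delta> s t * u s x * u t y)" for x y
    have um: "u s \<in> borel_measurable borel" for s using u(1) by (rule borel_measurable_mono)
    have ub: "\<bar>u s x\<bar> \<le> 1" for s x using u(2)[of s x] by auto
    have bu: "bounded_rv M (\<lambda>\<omega>. u s (X i \<omega>))" if "i \<ge> 1" for s i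
      by (rule bounded_rv_comp[OF um ub that])
    have iu [simp]: "integrable M (\<lambda>\<omega>. u s (X 1 \<omega>))" for s by (rule bounded_rv_integrable[OF bu]) simp
    define p where "p s = expectation (\<lambda>\<omega>. u s (X 1 \<omega>))" for s
    \<comment> \<open>\<open>Q\<close>, \<open>Q'\<close> and \<open>q\<close> are the marginals and
      the mean of \<open>P\<close> for an independent pair, obtained by replacing each indicator by
      its expectation. The coefficients \<Delta> are not assumed symmetric, so the two marginals are
      kept apart.\<close>
    define Q where "Q x = \<alpha> + (\<Sum>s<N. \<beta> s * u s x) + (\<Sum>t<N. \<beta> t * p t)
                + (\<Sum>s<N. \<Sum>t<N. \<Delta> s t * u s x * p t)" for x
    define Q' where "Q' y = \<alpha> + (\<Sum>s<N. \<beta> s * p s) + (\<Sum>t<N. \<beta> t * u t y)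
                + (\<Sum>s<N. \<Sum>t<N. \<Delta> s t * p s * u t y)" for y
    define q where "q = \<alpha> + (\<Sum>s<N. \<beta> s * p s) + (\<Sum>t<N. \<beta> t * p t)
                + (\<Sum>s<N. \<Sum>t<N. \<Delta> s t * p s * p t)"
    have EP: "integrable M (\<lambda>\<omega>. P x (X 1 \<omega>))" "expectation (\<lambda>\<omega>. P x (X 1 \<omega>)) = Q x" for x
      unfolding P_def Q_def p_def using iu by (simp_all add: prob_space)
    have EP': "integrable M (\<lambda>\<omega>. P (X 1 \<omega>) y)" "expectation (\<lambda>\<omega>. P (X 1 \<omega>) y) = Q' y" for y
      unfolding P_def Q'_def p_def using iu by (simp_all add: prob_space)
    have EQ: "integrable M (\<lambda>\<omega>. Q (X 1 \<omega>))" "expectation (\<lambda>\<omega>. Q (X 1 \<omega>)) = q"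
      unfolding Q_def q_def using iu by (simp_all add: prob_space p_def)
    have close: "\<bar>expectation Y - expectation Z\<bar> \<le> \<epsilon>"
      if "integrable M Y" "integrable M Z" "\<And>\<omega>. \<bar>Y \<omega> - Z \<omega>\<bar> \<le> \<epsilon>" for Y Z
    proof -
      have "\<bar>expectation (\<lambda>\<omega>. Y \<omega> - Z \<omega>)\<bar> \<le> expectation (\<lambda>\<omega>. \<epsilon>)"
        using that by (intro order.trans[OF integral_abs_bound] integral_mono) auto
      then show ?thesis using that by (simp add: prob_space)
    qed
    have ir: "integrable M (\<lambda>\<omega>. \<rho> x (X 1 \<omega>))" for x by (rule bounded_rv_integrable[OF \<rho>1])
    have aP: "\<bar>\<rho> x y - P x y\<bar> \<le> \<epsilon>" for x y unfolding P_def by (rule a)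
    have aQ: "\<bar>r x - Q x\<bar> \<le> \<epsilon>" for x
      unfolding r EP(2)[symmetric] by (rule close[OF ir EP(1) aP])
    have aQ': "\<bar>r y - Q' y\<bar> \<le> \<epsilon>" for y
    proof -
      have "r y = expectation (\<lambda>\<omega>. \<rho> (X 1 \<omega>) y)" unfolding r by (simp add: sym[of y])
      moreover have "integrable M (\<lambda>\<omega>. \<rho> (X 1 \<omega>) y)" using ir[of y] by (simp add: sym[of y])
      ultimately show ?thesis
        unfolding EP'(2)[symmetric] using close[OF _ EP'(1) aP] by simp
    qed
    have aq: "\<bar>\<theta> - q\<bar> \<le> \<epsilon>"
      unfolding \<theta> EQ(2)[symmetric] by (rule close[OF bounded_rv_integrable[OF rb] EQ(1) aQ]) simp
    \<comment> \<open>Projecting out the marginals removes \<alpha> and \<beta> and centres every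
      indicator; only products of centred indicators remain.\<close>
    have hP: "P x y - Q x - Q' y + q = (\<Sum>s<N. \<Sum>t<N. \<Delta> s t * ((u s x - p s) * (u t y - p t)))" for x y
      unfolding P_def Q_def Q'_def q_def
      by (simp add: algebra_simps sum.distrib sum_subtractf)
    define Z where "Z s \<omega> = (\<Sum>i=1..n. u s (X i \<omega>) - p s)" for s \<omega>
    have Zb: "bounded_rv M (Z s)" for s
      unfolding Z_def by (intro bounded_rv_sum bounded_rv_diff bu) auto
    have EZ: "expectation (\<lambda>\<omega>. (Z s \<omega>)\<^sup>2) \<le> W" for s
    proof -
      have "expectation (\<lambda>\<omega>. u s (X i \<omega>)) = p s" if "i \<ge> 1" for i
        unfolding p_def by (rule integral_shift_one[OF um that])
      then have "expectation (\<lambda>\<omega>. \<Sum>i=1..n. u s (X i \<omega>)) = (\<Sum>i=1..n. p s)"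
        by (subst Bochner_Integration.integral_sum) (auto intro!: bounded_rv_integrable[OF bu])
      then have "Z s \<omega> = (\<Sum>i=1..n. u s (X i \<omega>)) - expectation (\<lambda>\<omega>. \<Sum>i=1..n. u s (X i \<omega>))" for \<omega>
        by (simp add: Z_def sum_subtractf)
      then have "expectation (\<lambda>\<omega>. (Z s \<omega>)\<^sup>2) = cov M (\<lambda>\<omega>. \<Sum>i=1..n. u s (X i \<omega>)) (\<lambda>\<omega>. \<Sum>i=1..n. u s (X i \<omega>))"
        by (simp add: cov_def power2_eq_square)
      then show ?thesis using var[OF u] by simp
    qed
    have iZ: "integrable M (\<lambda>\<omega>. (Z s \<omega>)\<^sup>2)" for s
      unfolding power2_eq_square by (intro bounded_rv_integrable bounded_rv_mult Zb)
    let ?R = "\<lambda>\<omega>. (real n)\<^sup>2 * (4 * \<epsilon>) + (\<Sum>s<N. \<Sum>t<N. \<bar>\<Delta> s t\<bar> * (((Z s \<omega>)\<^sup>2 + (Z t \<omega>)\<^sup>2) / 2))"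
    have T_le: "\<bar>?T \<omega>\<bar> \<le> ?R \<omega>" for \<omega>
    proof -
      \<comment> \<open>One \<epsilon> each for the kernel, its two marginals and its mean.\<close>
      have h: "\<bar>?h x y - (\<Sum>s<N. \<Sum>t<N. \<Delta> s t * ((u s x - p s) * (u t y - p t)))\<bar> \<le> 4 * \<epsilon>" for x y
        unfolding hP[symmetric] using aP[of x y] aQ[of x] aQ'[of y] aq by linarith
      have "(\<Sum>i=1..n. \<Sum>j=1..n. \<Sum>s<N. \<Sum>t<N. \<Delta> s t * ((u s (X i \<omega>) - p s) * (u t (X j \<omega>) - p t)))
          = (\<Sum>s<N. \<Sum>t<N. \<Delta> s t * (Z s \<omega> * Z t \<omega>))"
      proof -
        have "(\<Sum>i=1..n. \<Sum>j=1..n. \<Sum>s<N. \<Sum>t<N. \<Delta> s t * ((u s (X i \<omega>) - p s) * (u t (X j \<omega>) - p t)))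
            = (\<Sum>s<N. \<Sum>i=1..n. \<Sum>j=1..n. \<Sum>t<N. \<Delta> s t * ((u s (X i \<omega>) - p s) * (u t (X j \<omega>) - p t)))"
          by (rule sum_rotate)
        also have "\<dots> = (\<Sum>s<N. \<Sum>t<N. \<Sum>i=1..n. \<Sum>j=1..n. \<Delta> s t * ((u s (X i \<omega>) - p s) * (u t (X j \<omega>) - p t)))"
          by (intro sum.cong refl sum_rotate)
        also have "\<dots> = (\<Sum>s<N. \<Sum>t<N. \<Delta> s t * (Z s \<omega> * Z t \<omega>))"
        proof -
          have "Z s \<omega> * Z t \<omega> = (\<Sum>i=1..n. \<Sum>j=1..n. (u s (X i \<omega>) - p s) * (u t (X j \<omega>) - p t))" for s t
            unfolding Z_def by (rule sum_product)
          then show ?thesis by (simp only: sum_distrib_left)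
        qed
        finally show ?thesis .
      qed
      then have "\<bar>?T \<omega> - (\<Sum>s<N. \<Sum>t<N. \<Delta> s t * (Z s \<omega> * Z t \<omega>))\<bar>
          = \<bar>\<Sum>i=1..n. \<Sum>j=1..n. ?h (X i \<omega>) (X j \<omega>)
              - (\<Sum>s<N. \<Sum>t<N. \<Delta> s t * ((u s (X i \<omega>) - p s) * (u t (X j \<omega>) - p t)))\<bar>"
        by (simp only: sum_subtractf)
      also have "\<dots> \<le> (\<Sum>i=1..n. \<Sum>j=1..n. 4 * \<epsilon>)"
        by (intro order.trans[OF sum_abs] sum_mono h)
      also have "\<dots> = (real n)\<^sup>2 * (4 * \<epsilon>)" by (simp add: power2_eq_square)
      finally have 1: "\<bar>?T \<omega> - (\<Sum>s<N. \<Sum>t<N. \<Delta> s t * (Z s \<omega> * Z t \<omega>))\<bar> \<le> (real n)\<^sup>2 * (4 * \<epsilon>)" .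
      have "\<bar>\<Delta> s t * (Z s \<omega> * Z t \<omega>)\<bar> \<le> \<bar>\<Delta> s t\<bar> * (((Z s \<omega>)\<^sup>2 + (Z t \<omega>)\<^sup>2) / 2)" for s t
      proof -
        have "2 * (\<bar>Z s \<omega>\<bar> * \<bar>Z t \<omega>\<bar>) \<le> (Z s \<omega>)\<^sup>2 + (Z t \<omega>)\<^sup>2"
          using sum_squares_bound[of "\<bar>Z s \<omega>\<bar>" "\<bar>Z t \<omega>\<bar>"] by simp
        then show ?thesis unfolding abs_mult by (intro mult_left_mono) auto
      qed
      then have "\<bar>\<Sum>s<N. \<Sum>t<N. \<Delta> s t * (Z s \<omega> * Z t \<omega>)\<bar>
          \<le> (\<Sum>s<N. \<Sum>t<N. \<bar>\<Delta> s t\<bar> * (((Z s \<omega>)\<^sup>2 + (Z t \<omega>)\<^sup>2) / 2))"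
        by (intro order.trans[OF sum_abs] sum_mono)
      then show ?thesis using 1 by linarith
    qed
    have "expectation (\<lambda>\<omega>. \<bar>?T \<omega>\<bar>) \<le> expectation ?R"
      using bounded_rv_integrable[OF Tb] iZ T_le by (intro integral_mono) auto
    also have "\<dots> = (real n)\<^sup>2 * (4 * \<epsilon>) + (\<Sum>s<N. \<Sum>t<N. \<bar>\<Delta> s t\<bar> *
         ((expectation (\<lambda>\<omega>. (Z s \<omega>)\<^sup>2) + expectation (\<lambda>\<omega>. (Z t \<omega>)\<^sup>2)) / 2))"
      using iZ by (simp add: prob_space)
    also have "\<dots> \<le> (real n)\<^sup>2 * (4 * \<epsilon>) + (\<Sum>s<N. \<Sum>t<N. \<bar>\<Delta> s t\<bar> * W)"
    proof (intro add_left_mono sum_mono mult_left_mono)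
      show "(expectation (\<lambda>\<omega>. (Z s \<omega>)\<^sup>2) + expectation (\<lambda>\<omega>. (Z t \<omega>)\<^sup>2)) / 2 \<le> W" for s t
        using EZ[of s] EZ[of t] by simp
    qed simp
    also have "(\<Sum>s<N. \<Sum>t<N. \<bar>\<Delta> s t\<bar> * W) \<le> V * W"
      using mult_right_mono[OF \<Delta> W] by (simp add: sum_distrib_right)
    finally show ?thesis by simp
  qed
  show ?thesis
  proof (rule field_le_epsilon)
    fix e :: real assume e: "e > 0"
    \<comment> \<open>The added 1 keeps the quotient meaningful for \<open>n = 0\<close>.\<close>
    let ?\<epsilon> = "e / (4 * (real n)\<^sup>2 + 1)"
    have pos: "4 * (real n)\<^sup>2 + 1 > 0" by (simp add: add_nonneg_pos)
    have "(real n)\<^sup>2 * (4 * ?\<epsilon>) \<le> e"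
      using e pos by (simp add: field_simps)
    then show "expectation (\<lambda>\<omega>. \<bar>?T \<omega>\<bar>) \<le> V * W + e"
      using approx[of ?\<epsilon>] e pos by simp
  qed
qed

end

section \<open>The central limit theorem for dominated functions\<close>

lemma cmod_iexp_diff_le: "cmod (iexp x - iexp y) \<le> \<bar>x - y\<bar>"
proof -
  have "iexp x - iexp y = iexp y * (iexp (x - y) - 1)"
    by (simp add: algebra_simps exp_add[symmetric])
  then have "cmod (iexp x - iexp y) = cmod (iexp (x - y) - 1)" by (simp add: norm_mult)
  also have "\<dots> \<le> \<bar>x - y\<bar>" using iexp_approx1[of "x - y" 0] by simp
  finally show ?thesis .
qed

lemma iexp_cos_sin: "iexp x = complex_of_real (cos x) + \<i> * complex_of_real (sin x)"
  by (simp add: exp_Euler cos_of_real sin_of_real)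

lemma abs_cos_diff_le: "\<bar>cos x - cos y\<bar> \<le> \<bar>x - y\<bar>" for x y :: real
proof -
  have "\<bar>cos x - cos y\<bar> = \<bar>Re (iexp x - iexp y)\<bar>" by (simp add: iexp_cos_sin)
  then show ?thesis using order.trans[OF abs_Re_le_cmod cmod_iexp_diff_le] by simp
qed

lemma abs_sin_diff_le: "\<bar>sin x - sin y\<bar> \<le> \<bar>x - y\<bar>" for x y :: real
proof -
  have "\<bar>sin x - sin y\<bar> = \<bar>Im (iexp x - iexp y)\<bar>" by (simp add: iexp_cos_sin)
  then show ?thesis using order.trans[OF abs_Im_le_cmod cmod_iexp_diff_le] by simp
qed

text \<open>Used twice with the block length as index: for the block variance per observation and
  for the interaction between blocks.\<close>

lemma cesaro_mean_tendsto:
  fixes a :: "nat \<Rightarrow> real"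
  assumes "a \<longlonglongrightarrow> L"
  shows "(\<lambda>n. (\<Sum>k<n. a k) / real n) \<longlonglongrightarrow> L"
proof (rule LIMSEQ_I)
  fix e :: real assume e: "e > 0"
  obtain N where N: "\<And>k. k \<ge> N \<Longrightarrow> \<bar>a k - L\<bar> < e / 2"
    using LIMSEQ_D[OF assms, of "e / 2"] e by auto
  define A where "A = (\<Sum>k<N. \<bar>a k - L\<bar>)"
  obtain n0 where n0: "real n0 > 2 * A / e" using reals_Archimedean2 by blast
  show "\<exists>no. \<forall>n\<ge>no. norm ((\<Sum>k<n. a k) / real n - L) < e"
  proof (intro exI allI impI)
    fix n assume n: "n \<ge> Suc (max n0 N)"
    have "(\<Sum>k<n. a k) - real n * L = (\<Sum>k<n. a k - L)" by (simp add: sum_subtractf)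
    then have "\<bar>(\<Sum>k<n. a k) - real n * L\<bar> \<le> (\<Sum>k<n. \<bar>a k - L\<bar>)" by (simp add: sum_abs)
    also have "\<dots> = A + (\<Sum>k=N..<n. \<bar>a k - L\<bar>)"
      unfolding A_def using n
      by (subst sum.union_disjoint[symmetric]) (auto intro!: sum.cong)
    also have "(\<Sum>k=N..<n. \<bar>a k - L\<bar>) \<le> (\<Sum>k=N..<n. e / 2)"
      using N by (intro sum_mono) (auto intro: less_imp_le)
    also have "\<dots> \<le> real n * (e / 2)" using e n by (simp add: mult_right_mono)
    finally have "\<bar>(\<Sum>k<n. a k) - real n * L\<bar> \<le> A + real n * (e / 2)" by simp
    moreover have "A < real n * (e / 2)"
    proof -
      have "2 * A / e < real n" using n0 n by linarith
      then show ?thesis using e by (simp add: field_simps)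
    qed
    ultimately have "\<bar>(\<Sum>k<n. a k) - real n * L\<bar> < real n * e" by (simp add: field_simps)
    moreover have "(\<Sum>k<n. a k) / real n - L = ((\<Sum>k<n. a k) - real n * L) / real n"
      using n by (simp add: field_simps)
    ultimately show "norm ((\<Sum>k<n. a k) / real n - L) < e"
      using n by (simp add: abs_divide field_simps)
  qed
qed

text \<open>\<open>f\<close> is half the difference of the nondecreasing functions
  \<open>f' + f\<close> and \<open>f' - f\<close>, hence Borel. Adding their monotonicity
  inequalities shows that \<open>f'\<close> is nondecreasing.\<close>

lemma ll_on_UNIV_measurable:
  fixes f f' :: "real \<Rightarrow> real"
  assumes "ll_on UNIV f f'"
  shows "f \<in> borel_measurable borel" "f' \<in> borel_measurable borel" "mono f'"
proof -
  have m: "mono (\<lambda>x. f' x + f x)" "mono (\<lambda>x. f' x - f x)" using assms by (auto simp: ll_on_def)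
  note m' = m[THEN borel_measurable_mono]
  have "(\<lambda>x. ((f' x + f x) - (f' x - f x)) / 2) \<in> borel_measurable borel"
    by (rule borel_measurable_divide[OF borel_measurable_diff[OF m'] borel_measurable_const])
  then show "f \<in> borel_measurable borel" by simp
  show "mono f'"
  proof (rule monoI)
    fix x y :: real assume "x \<le> y"
    then show "f' x \<le> f' y" using monoD[OF m(1), of x y] monoD[OF m(2), of x y] by linarith
  qed
  then show "f' \<in> borel_measurable borel" by (rule borel_measurable_mono)
qed

lemma (in prob_space) integrable_iexp_comp:
  assumes "Y \<in> borel_measurable M" shows "integrable M (\<lambda>\<omega>. iexp (Y \<omega>))"
  using assms by (intro integrable_const_bound[of _ 1]) auto

lemma (in prob_space) expectation_iexp:
  assumes "Y \<in> borel_measurable M"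
  shows "(LINT \<omega>|M. iexp (Y \<omega>)) = complex_of_real (expectation (\<lambda>\<omega>. cos (Y \<omega>)))
      + \<i> * complex_of_real (expectation (\<lambda>\<omega>. sin (Y \<omega>)))"
proof -
  have "integrable M (\<lambda>\<omega>. cos (Y \<omega>))" "integrable M (\<lambda>\<omega>. sin (Y \<omega>))"
    using assms by (auto intro!: integrable_const_bound[of _ 1])
  then show ?thesis by (simp add: iexp_cos_sin)
qed

lemma (in prob_space) cmod_expectation_iexp_le:
  assumes "Y \<in> borel_measurable M" shows "cmod (LINT \<omega>|M. iexp (Y \<omega>)) \<le> 1"
proof -
  have "cmod (LINT \<omega>|M. iexp (Y \<omega>)) \<le> (LINT \<omega>|M. cmod (iexp (Y \<omega>)))" by (rule integral_norm_bound)
  then show ?thesis by (simp add: prob_space)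
qed

lemma (in prob_space) cmod_expectation_iexp_diff_le:
  assumes "Y \<in> borel_measurable M" "Z \<in> borel_measurable M" "integrable M (\<lambda>\<omega>. Y \<omega> - Z \<omega>)"
  shows "cmod ((LINT \<omega>|M. iexp (Y \<omega>)) - (LINT \<omega>|M. iexp (Z \<omega>))) \<le> expectation (\<lambda>\<omega>. \<bar>Y \<omega> - Z \<omega>\<bar>)"
proof -
  note i = integrable_iexp_comp[OF assms(1)] integrable_iexp_comp[OF assms(2)]
  have "(LINT \<omega>|M. iexp (Y \<omega>)) - (LINT \<omega>|M. iexp (Z \<omega>)) = (LINT \<omega>|M. iexp (Y \<omega>) - iexp (Z \<omega>))"
    by (rule Bochner_Integration.integral_diff[OF i, symmetric])
  then have "cmod ((LINT \<omega>|M. iexp (Y \<omega>)) - (LINT \<omega>|M. iexp (Z \<omega>))) \<le> (LINT \<omega>|M. cmod (iexp (Y \<omega>) - iexp (Z \<omega>)))"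
    by (simp only: integral_norm_bound)
  also have "\<dots> \<le> expectation (\<lambda>\<omega>. \<bar>Y \<omega> - Z \<omega>\<bar>)"
    by (rule integral_mono[OF integrable_norm[OF Bochner_Integration.integrable_diff[OF i]]
          integrable_abs[OF assms(3)] cmod_iexp_diff_le])
  finally show ?thesis .
qed

context associated_sequence
begin

text \<open>Sine and cosine are 1-Lipschitz, so applied to \<open>t\<close> times a block sum of
  \<open>f\<close> they are dominated by the absolute value of \<open>t\<close> times the block sum
  of \<open>f'\<close>. The addition theorems express the difference through four covariances,
  whence the factor 4.\<close>

lemma cmod_iexp_blocks_le:
  assumes ll: "ll_on UNIV f f'" and b: "\<And>x. \<bar>f x\<bar> \<le> B" "\<And>x. \<bar>f' x\<bar> \<le> B'"
    and A: "A \<subseteq> {1..}" "finite A" and A': "A' \<subseteq> {1..}" "finite A'"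
  shows "cmod ((LINT \<omega>|M. iexp (t * ((\<Sum>i\<in>A. f (X i \<omega>)) + (\<Sum>i\<in>A'. f (X i \<omega>)))))
      - (LINT \<omega>|M. iexp (t * (\<Sum>i\<in>A. f (X i \<omega>)))) * (LINT \<omega>|M. iexp (t * (\<Sum>i\<in>A'. f (X i \<omega>)))))
    \<le> 4 * t\<^sup>2 * cov M (\<lambda>\<omega>. \<Sum>i\<in>A. f' (X i \<omega>)) (\<lambda>\<omega>. \<Sum>i\<in>A'. f' (X i \<omega>))"
proof -
  \<comment> \<open>Index 1 is inserted because association speaks of nonempty index sets, while
    both blocks may be empty.\<close>
  define J where "J = insert 1 (A \<union> A')"
  have J: "J \<subseteq> {1..}" "finite J" "J \<noteq> {}" using A A' by (auto simp: J_def)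
  note m = ll_on_UNIV_measurable[OF ll]
  let ?S = "\<lambda>A \<omega>. \<Sum>i\<in>A. f (X i \<omega>)" and ?S' = "\<lambda>A \<omega>. \<Sum>i\<in>A. f' (X i \<omega>)"
  have bS: "bounded_rv M (?S D)" and bS': "bounded_rv M (?S' D)" if "D \<subseteq> {1..}" for D
    using that bounded_rv_comp[OF m(1) b(1)] bounded_rv_comp[OF m(2) b(2)]
    by (auto intro!: bounded_rv_sum)
  let ?C = "cov M (?S' A) (?S' A')"
  have restr: "(\<Sum>i\<in>D. g ((\<lambda>j\<in>J. X j \<omega>) i)) = (\<Sum>i\<in>D. g (X i \<omega>))" if "D \<subseteq> J" for D \<omega> and g :: "real \<Rightarrow> real"
    using that by (intro sum.cong) auto
  have AJ: "A \<subseteq> J" "A' \<subseteq> J" by (auto simp: J_def)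
  have bg: "bounded_rv M (\<lambda>\<omega>. g (t * ?S D \<omega>))"
    if "D \<subseteq> {1..}" "g \<in> borel_measurable borel" "\<And>x. \<bar>g x\<bar> \<le> 1" for g :: "real \<Rightarrow> real" and D
    using bounded_rv_measurable[OF bS[OF that(1)]] that(2,3)
    by (intro bounded_rvI[of _ _ 1]) (auto intro: measurable_compose)
  have key: "\<bar>cov M (\<lambda>\<omega>. g (t * ?S A \<omega>)) (\<lambda>\<omega>. h (t * ?S A' \<omega>))\<bar> \<le> t\<^sup>2 * ?C"
    if g: "\<And>x y. \<bar>g x - g y\<bar> \<le> \<bar>x - y\<bar>" "g \<in> borel_measurable borel" "\<And>x. \<bar>g x\<bar> \<le> 1"
      and h: "\<And>x y. \<bar>h x - h y\<bar> \<le> \<bar>x - y\<bar>" "h \<in> borel_measurable borel" "\<And>x. \<bar>h x\<bar> \<le> 1"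
    for g h :: "real \<Rightarrow> real"
  proof -
    have lls: "ll_on (PiE J (\<lambda>_. UNIV)) (\<lambda>z. g (t * (\<Sum>i\<in>D. f (z i)))) (\<lambda>z. \<bar>t\<bar> * (\<Sum>i\<in>D. f' (z i)))"
      if g: "\<And>x y. \<bar>g x - g y\<bar> \<le> \<bar>x - y\<bar>" for g :: "real \<Rightarrow> real" and D :: "nat set"
    proof -
      have "\<bar>g (t * (\<Sum>i\<in>D. f (z i))) - g (t * (\<Sum>i\<in>D. f (z' i)))\<bar>
          \<le> \<bar>t\<bar> * (\<Sum>i\<in>D. f' (z' i)) - \<bar>t\<bar> * (\<Sum>i\<in>D. f' (z i))" if z: "z \<le> z'" for z z'
      proof -
        have "\<bar>g (t * (\<Sum>i\<in>D. f (z i))) - g (t * (\<Sum>i\<in>D. f (z' i)))\<bar>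
            \<le> \<bar>t\<bar> * \<bar>\<Sum>i\<in>D. f (z i) - f (z' i)\<bar>"
          using g[of "t * (\<Sum>i\<in>D. f (z i))" "t * (\<Sum>i\<in>D. f (z' i))"]
          by (simp add: sum_subtractf abs_mult[symmetric] right_diff_distrib)
        also have "\<dots> \<le> \<bar>t\<bar> * (\<Sum>i\<in>D. f' (z' i) - f' (z i))"
          using z by (intro mult_left_mono order.trans[OF sum_abs] sum_mono ll_onD[OF ll UNIV_I UNIV_I]) (auto dest: le_funD)
        finally show ?thesis by (simp add: sum_subtractf right_diff_distrib)
      qed
      then show ?thesis by (intro ll_onI)
    qed
    have "\<bar>cov M (\<lambda>\<omega>. (\<lambda>z. g (t * (\<Sum>i\<in>A. f (z i)))) (\<lambda>j\<in>J. X j \<omega>)) (\<lambda>\<omega>. (\<lambda>z. h (t * (\<Sum>i\<in>A'. f (z i)))) (\<lambda>j\<in>J. X j \<omega>))\<bar>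
      \<le> cov M (\<lambda>\<omega>. (\<lambda>z. \<bar>t\<bar> * (\<Sum>i\<in>A. f' (z i))) (\<lambda>j\<in>J. X j \<omega>)) (\<lambda>\<omega>. (\<lambda>z. \<bar>t\<bar> * (\<Sum>i\<in>A'. f' (z i))) (\<lambda>j\<in>J. X j \<omega>))"
      by (intro abs_cov_le[OF J lls[OF g(1)] lls[OF h(1)]], unfold restr[OF AJ(1)] restr[OF AJ(2)])
        (intro bg A A' g h bounded_rv_mult bS' bounded_rv_const)+
    then have "\<bar>cov M (\<lambda>\<omega>. g (t * ?S A \<omega>)) (\<lambda>\<omega>. h (t * ?S A' \<omega>))\<bar>
      \<le> cov M (\<lambda>\<omega>. \<bar>t\<bar> * ?S' A \<omega>) (\<lambda>\<omega>. \<bar>t\<bar> * ?S' A' \<omega>)"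
      unfolding restr[OF AJ(1)] restr[OF AJ(2)] .
    also have "\<dots> = t\<^sup>2 * ?C"
      using bS'[OF A(1)] bS'[OF A'(1)] bounded_rv_mult[OF bounded_rv_const bS'[OF A'(1)], of "\<bar>t\<bar>"]
      by (simp add: cov_scale_left cov_scale_right power2_eq_square)
    finally show ?thesis .
  qed
  have msin: "(sin :: real \<Rightarrow> real) \<in> borel_measurable borel" and mcos: "(cos :: real \<Rightarrow> real) \<in> borel_measurable borel"
    by measurable
  define a where "a = (\<lambda>\<omega>. t * ?S A \<omega>)"
  define b where "b = (\<lambda>\<omega>. t * ?S A' \<omega>)"
  have K: "\<bar>cov M (\<lambda>\<omega>. cos (a \<omega>)) (\<lambda>\<omega>. cos (b \<omega>))\<bar> \<le> t\<^sup>2 * ?C"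
    "\<bar>cov M (\<lambda>\<omega>. cos (a \<omega>)) (\<lambda>\<omega>. sin (b \<omega>))\<bar> \<le> t\<^sup>2 * ?C"
    "\<bar>cov M (\<lambda>\<omega>. sin (a \<omega>)) (\<lambda>\<omega>. cos (b \<omega>))\<bar> \<le> t\<^sup>2 * ?C"
    "\<bar>cov M (\<lambda>\<omega>. sin (a \<omega>)) (\<lambda>\<omega>. sin (b \<omega>))\<bar> \<le> t\<^sup>2 * ?C"
    unfolding a_def b_def
    by (intro key abs_cos_diff_le mcos abs_cos_le_one abs_sin_diff_le msin abs_sin_le_one)+
  have ab: "bounded_rv M (\<lambda>\<omega>. cos (a \<omega>))" "bounded_rv M (\<lambda>\<omega>. sin (a \<omega>))"
    "bounded_rv M (\<lambda>\<omega>. cos (b \<omega>))" "bounded_rv M (\<lambda>\<omega>. sin (b \<omega>))"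
    unfolding a_def b_def
    by (intro bg A A' mcos msin abs_cos_le_one abs_sin_le_one)+
  have abm: "a \<in> borel_measurable M" "b \<in> borel_measurable M"
    unfolding a_def b_def using bounded_rv_measurable[OF bS[OF A(1)]] bounded_rv_measurable[OF bS[OF A'(1)]] by auto
  have i: "integrable M (\<lambda>\<omega>. cos (a \<omega>) * cos (b \<omega>))" "integrable M (\<lambda>\<omega>. sin (a \<omega>) * sin (b \<omega>))"
    "integrable M (\<lambda>\<omega>. sin (a \<omega>) * cos (b \<omega>))" "integrable M (\<lambda>\<omega>. cos (a \<omega>) * sin (b \<omega>))"
    by (intro bounded_rv_integrable bounded_rv_mult ab)+
  have eq: "(LINT \<omega>|M. iexp (a \<omega> + b \<omega>)) - (LINT \<omega>|M. iexp (a \<omega>)) * (LINT \<omega>|M. iexp (b \<omega>))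
    = complex_of_real (cov M (\<lambda>\<omega>. cos (a \<omega>)) (\<lambda>\<omega>. cos (b \<omega>)) - cov M (\<lambda>\<omega>. sin (a \<omega>)) (\<lambda>\<omega>. sin (b \<omega>)))
      + \<i> * complex_of_real (cov M (\<lambda>\<omega>. sin (a \<omega>)) (\<lambda>\<omega>. cos (b \<omega>)) + cov M (\<lambda>\<omega>. cos (a \<omega>)) (\<lambda>\<omega>. sin (b \<omega>)))"
  proof -
    have "(LINT \<omega>|M. iexp (a \<omega> + b \<omega>)) = complex_of_real (expectation (\<lambda>\<omega>. cos (a \<omega> + b \<omega>)))
      + \<i> * complex_of_real (expectation (\<lambda>\<omega>. sin (a \<omega> + b \<omega>)))"
      using abm by (intro expectation_iexp) auto
    then show ?thesis
      unfolding expectation_iexp[OF abm(1)] expectation_iexp[OF abm(2)]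
      using i ab by (simp add: cos_add sin_add cov_eq complex_eq_iff)
  qed
  have "cmod (complex_of_real p + \<i> * complex_of_real q) \<le> \<bar>p\<bar> + \<bar>q\<bar>" for p q
    using cmod_le[of "complex_of_real p + \<i> * complex_of_real q"] by simp
  then have "cmod ((LINT \<omega>|M. iexp (a \<omega> + b \<omega>)) - (LINT \<omega>|M. iexp (a \<omega>)) * (LINT \<omega>|M. iexp (b \<omega>)))
     \<le> \<bar>cov M (\<lambda>\<omega>. cos (a \<omega>)) (\<lambda>\<omega>. cos (b \<omega>)) - cov M (\<lambda>\<omega>. sin (a \<omega>)) (\<lambda>\<omega>. sin (b \<omega>))\<bar>
     + \<bar>cov M (\<lambda>\<omega>. sin (a \<omega>)) (\<lambda>\<omega>. cos (b \<omega>)) + cov M (\<lambda>\<omega>. cos (a \<omega>)) (\<lambda>\<omega>. sin (b \<omega>))\<bar>"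
    unfolding eq .
  also have "\<dots> \<le> (\<bar>cov M (\<lambda>\<omega>. cos (a \<omega>)) (\<lambda>\<omega>. cos (b \<omega>))\<bar> + \<bar>cov M (\<lambda>\<omega>. sin (a \<omega>)) (\<lambda>\<omega>. sin (b \<omega>))\<bar>)
     + (\<bar>cov M (\<lambda>\<omega>. sin (a \<omega>)) (\<lambda>\<omega>. cos (b \<omega>))\<bar> + \<bar>cov M (\<lambda>\<omega>. cos (a \<omega>)) (\<lambda>\<omega>. sin (b \<omega>))\<bar>)"
    by (intro add_mono abs_triangle_ineq abs_triangle_ineq4)
  also have "\<dots> \<le> (t\<^sup>2 * ?C + t\<^sup>2 * ?C) + (t\<^sup>2 * ?C + t\<^sup>2 * ?C)"
    by (intro add_mono K)
  also have "\<dots> = 4 * t\<^sup>2 * ?C" by simp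
  finally show ?thesis unfolding a_def b_def by (simp only: distrib_left)
qed

text \<open>The \<open>p\<close>-th variable of the new block, counted from 0, has lag at least
  \<open>Suc p\<close> to all earlier ones, so its covariance with the past is at most a tail of the
  series. The bound does not depend on \<open>n\<close>, and its summands tend to 0 as
  \<open>p\<close> grows.\<close>

lemma cov_partial_sum_block_le:
  assumes f: "mono f" "\<And>x. \<bar>f x\<bar> \<le> B"
    and sm: "summable (\<lambda>d. cov M (\<lambda>\<omega>. f (X 1 \<omega>)) (\<lambda>\<omega>. f (X (1 + d) \<omega>)))"
  shows "cov M (\<lambda>\<omega>. \<Sum>i\<in>{1..n}. f (X i \<omega>)) (\<lambda>\<omega>. \<Sum>i\<in>{Suc n..n + l}. f (X i \<omega>))
    \<le> (\<Sum>p<l. \<Sum>d. cov M (\<lambda>\<omega>. f (X 1 \<omega>)) (\<lambda>\<omega>. f (X (1 + (d + Suc p)) \<omega>)))"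
proof -
  let ?c = "\<lambda>d. cov M (\<lambda>\<omega>. f (X 1 \<omega>)) (\<lambda>\<omega>. f (X (1 + d) \<omega>))"
  have fm: "f \<in> borel_measurable borel" using f(1) by (rule borel_measurable_mono)
  have b: "bounded_rv M (\<lambda>\<omega>. f (X i \<omega>))" if "i \<ge> 1" for i by (rule bounded_rv_comp[OF fm f(2) that])
  have c0: "?c d \<ge> 0" for d by (rule cov_comp_nonneg[OF f]) auto
  have one: "cov M (\<lambda>\<omega>. \<Sum>i\<in>{1..n}. f (X i \<omega>)) (\<lambda>\<omega>. f (X (n + Suc p) \<omega>)) \<le> (\<Sum>d. ?c (d + Suc p))" for p
  proof -
    have "cov M (\<lambda>\<omega>. \<Sum>i\<in>{1..n}. f (X i \<omega>)) (\<lambda>\<omega>. f (X (n + Suc p) \<omega>))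
        = (\<Sum>i\<in>{1..n}. cov M (\<lambda>\<omega>. f (X i \<omega>)) (\<lambda>\<omega>. f (X (n + Suc p) \<omega>)))"
      using b by (intro cov_sum_left) auto
    also have "\<dots> = (\<Sum>i\<in>{1..n}. ?c ((n - i) + Suc p))"
    proof (rule sum.cong[OF refl])
      fix i assume "i \<in> {1..n}"
      then have "n + Suc p = i + ((n - i) + Suc p)" "i \<ge> 1" by auto
      then show "cov M (\<lambda>\<omega>. f (X i \<omega>)) (\<lambda>\<omega>. f (X (n + Suc p) \<omega>)) = ?c ((n - i) + Suc p)"
        using cov_shift[OF fm f(2), of i "(n - i) + Suc p"] by metis
    qed
    also have "\<dots> = (\<Sum>d<n. ?c (d + Suc p))"
      by (rule sum.reindex_bij_witness[of _ "\<lambda>d. n - d" "\<lambda>i. n - i"]) auto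
    also have "\<dots> \<le> (\<Sum>d. ?c (d + Suc p))"
      by (intro sum_le_suminf summable_ignore_initial_segment[OF sm, of "Suc p"] c0) auto
    finally show ?thesis .
  qed
  have "cov M (\<lambda>\<omega>. \<Sum>i\<in>{1..n}. f (X i \<omega>)) (\<lambda>\<omega>. \<Sum>i\<in>{Suc n..n + l}. f (X i \<omega>))
      = (\<Sum>j\<in>{Suc n..n + l}. cov M (\<lambda>\<omega>. \<Sum>i\<in>{1..n}. f (X i \<omega>)) (\<lambda>\<omega>. f (X j \<omega>)))"
    by (intro cov_sum_right bounded_rv_sum b) auto
  also have "\<dots> = (\<Sum>p<l. cov M (\<lambda>\<omega>. \<Sum>i\<in>{1..n}. f (X i \<omega>)) (\<lambda>\<omega>. f (X (n + Suc p) \<omega>)))"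
    by (rule sum.reindex_bij_witness[of _ "\<lambda>p. n + Suc p" "\<lambda>j. j - Suc n"]) auto
  also have "\<dots> \<le> (\<Sum>p<l. \<Sum>d. ?c (d + Suc p))" by (intro sum_mono one)
  finally show ?thesis .
qed

text \<open>Blocks are split off one at a time. By stationarity each has the same characteristic
  function, whose modulus is at most 1, so the accumulated error is not amplified and every new
  block adds the same amount.\<close>

lemma cmod_iexp_block_power_le:
  assumes ll: "ll_on UNIV f f'" and b: "\<And>x. \<bar>f x\<bar> \<le> B" "\<And>x. \<bar>f' x\<bar> \<le> B'"
    and sm: "summable (\<lambda>d. cov M (\<lambda>\<omega>. f' (X 1 \<omega>)) (\<lambda>\<omega>. f' (X (1 + d) \<omega>)))"
  shows "cmod ((LINT \<omega>|M. iexp (t * (\<Sum>i\<in>{1..m * l}. f (X i \<omega>))))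
       - (LINT \<omega>|M. iexp (t * (\<Sum>i\<in>{1..l}. f (X i \<omega>)))) ^ m)
    \<le> real m * (4 * t\<^sup>2 * (\<Sum>p<l. \<Sum>d. cov M (\<lambda>\<omega>. f' (X 1 \<omega>)) (\<lambda>\<omega>. f' (X (1 + (d + Suc p)) \<omega>))))"
proof (induction m)
  case 0
  show ?case by (simp add: prob_space)
next
  case (Suc m)
  let ?R = "4 * t\<^sup>2 * (\<Sum>p<l. \<Sum>d. cov M (\<lambda>\<omega>. f' (X 1 \<omega>)) (\<lambda>\<omega>. f' (X (1 + (d + Suc p)) \<omega>)))"
  let ?\<psi> = "LINT \<omega>|M. iexp (t * (\<Sum>i\<in>{1..l}. f (X i \<omega>)))"
  let ?\<phi> = "\<lambda>m. LINT \<omega>|M. iexp (t * (\<Sum>i\<in>{1..m * l}. f (X i \<omega>)))"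
  note fm = ll_on_UNIV_measurable[OF ll]
  have [measurable]: "f \<in> borel_measurable borel" by (rule fm)
  let ?blk = "{Suc (m * l)..m * l + l}"
  have "(LINT \<omega>|M. iexp (t * (\<Sum>i\<in>?blk. f (X i \<omega>)))) = ?\<psi>"
  proof -
    have "(\<Sum>i\<in>?blk. f (X i \<omega>)) = (\<Sum>i\<in>{1..l}. f (X (i + m * l) \<omega>))" for \<omega>
      by (rule sum.reindex_bij_witness[of _ "\<lambda>i. i + m * l" "\<lambda>i. i - m * l"]) auto
    moreover have "(LINT \<omega>|M. iexp (t * (\<Sum>i\<in>{1..l}. f (X (i + m * l) \<omega>)))) = ?\<psi>"
      using integral_shift[of "{1..l}" "\<lambda>z. iexp (t * (\<Sum>i\<in>{1..l}. f (z i)))" "m * l"] by simp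
    ultimately show ?thesis by simp
  qed
  moreover have "(\<Sum>i\<in>{1..Suc m * l}. f (X i \<omega>)) = (\<Sum>i\<in>{1..m * l}. f (X i \<omega>)) + (\<Sum>i\<in>?blk. f (X i \<omega>))" for \<omega>
    by (subst sum.union_disjoint[symmetric]) (auto intro!: sum.cong)
  ultimately have "cmod (?\<phi> (Suc m) - ?\<phi> m * ?\<psi>)
      \<le> 4 * t\<^sup>2 * cov M (\<lambda>\<omega>. \<Sum>i\<in>{1..m * l}. f' (X i \<omega>)) (\<lambda>\<omega>. \<Sum>i\<in>?blk. f' (X i \<omega>))"
    using cmod_iexp_blocks_le[OF ll b, of "{1..m * l}" ?blk t] by simp
  also have "\<dots> \<le> ?R"
    using cov_partial_sum_block_le[OF fm(3) b(2) sm, of "m * l" l] by (intro mult_left_mono) auto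
  finally have 1: "cmod (?\<phi> (Suc m) - ?\<phi> m * ?\<psi>) \<le> ?R" .
  have "cmod ?\<psi> \<le> 1"
    using bounded_rv_measurable[OF bounded_rv_comp[OF fm(1) b(1)]] by (intro cmod_expectation_iexp_le) simp
  then have 2: "cmod ((?\<phi> m - ?\<psi> ^ m) * ?\<psi>) \<le> real m * ?R"
    unfolding norm_mult using Suc by (intro order.trans[OF mult_left_le]) auto
  have "x - z ^ Suc m = (x - y * z) + (y - z ^ m) * z" for x y z :: complex
    by (simp add: algebra_simps)
  then have "cmod (?\<phi> (Suc m) - ?\<psi> ^ Suc m) \<le> ?R + real m * ?R"
    using norm_triangle_mono[OF 1 2] by (simp only:)
  then show ?case by (simp add: algebra_simps)
qed

end

section \<open>Counting blocks and approximating the characteristic function of one block\<close>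

lemma tendsto_divide_sqrt_0: "(\<lambda>n. K / sqrt (real n)) \<longlonglongrightarrow> 0"
  by (rule real_tendsto_divide_at_top[OF tendsto_const
        filterlim_compose[OF sqrt_at_top filterlim_real_sequentially]])

lemma div_ratio_bounds:
  assumes "l \<ge> 1" "n \<ge> 1"
  shows "real (n div l) / real n \<le> 1 / real l" "1 / real l - real (n div l) / real n \<le> 1 / real n"
proof -
  have n: "real n = real l * real (n div l) + real (n mod l)"
    using mult_div_mod_eq[of l n] by (metis of_nat_add of_nat_mult)
  have pos: "real l > 0" "real n > 0" using assms by auto
  have r: "real (n mod l) \<le> real l" using assms by (simp add: less_imp_le)
  show "real (n div l) / real n \<le> 1 / real l"
    using n pos by (simp add: field_simps)
  have "1 / real l - real (n div l) / real n = real (n mod l) / (real l * real n)"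
    using n pos by (simp add: field_simps)
  also have "\<dots> \<le> real l / (real l * real n)" by (intro divide_right_mono r) simp
  finally show "1 / real l - real (n div l) / real n \<le> 1 / real n" using pos by simp
qed

lemma tendsto_div_ratio:
  assumes "l \<ge> 1"
  shows "(\<lambda>n. real (n div l) / real n) \<longlonglongrightarrow> 1 / real l"
proof (rule LIM_zero_cancel, rule Lim_null_comparison)
  show "\<forall>\<^sub>F n in sequentially. norm (real (n div l) / real n - 1 / real l) \<le> 1 / real n"
    using eventually_ge_at_top[of "1::nat"]
    by eventually_elim (use div_ratio_bounds[OF assms] in \<open>auto simp: abs_le_iff\<close>)
  show "(\<lambda>n. 1 / real n) \<longlonglongrightarrow> 0" by (rule lim_1_over_n)
qed

text \<open>The upper estimate uses that \<open>exp y\<close> is at least \<open>1 + y\<close> and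
  that \<open>(1 - y + y\<^sup>2) * (1 + y)\<close> equals \<open>1 + y ^ 3\<close>, which is at
  least 1.\<close>

lemma exp_minus_approx:
  fixes y :: real assumes "y \<ge> 0" shows "\<bar>exp (- y) - (1 - y)\<bar> \<le> y\<^sup>2"
proof -
  have "exp (- y) = 1 / exp y" by (simp add: exp_minus divide_inverse)
  also have "\<dots> \<le> 1 / (1 + y)" using assms by (intro divide_left_mono) (auto simp: add_pos_nonneg)
  also have "\<dots> \<le> 1 - y + y\<^sup>2"
  proof -
    have "(1 - y + y\<^sup>2) * (1 + y) = 1 + y ^ 3" by (simp add: algebra_simps power2_eq_square power3_eq_cube)
    then have "1 \<le> (1 - y + y\<^sup>2) * (1 + y)" using assms by simp
    then show ?thesis using assms by (simp add: divide_le_eq)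
  qed
  finally have "exp (- y) - (1 - y) \<le> y\<^sup>2" by simp
  moreover have "1 - y \<le> exp (- y)" using exp_ge_add_one_self[of "- y"] by simp
  ultimately show ?thesis by simp
qed

text \<open>The comparison is with an exponential and not with the quadratic Taylor polynomial,
  because the \<open>m\<close>-th power of the exponential is again an explicit exponential of
  modulus at most 1.\<close>

lemma (in prob_space) iexp_second_order:
  assumes Y: "Y \<in> borel_measurable M" "\<And>\<omega>. \<omega> \<in> space M \<Longrightarrow> \<bar>Y \<omega>\<bar> \<le> D" and EY: "expectation Y = 0"
  defines "s \<equiv> expectation (\<lambda>\<omega>. (Y \<omega>)\<^sup>2)"
  shows "cmod ((LINT \<omega>|M. iexp (u * Y \<omega>)) - complex_of_real (exp (- (u\<^sup>2 * s / 2))))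
     \<le> \<bar>u\<bar> ^ 3 * D ^ 3 / 6 + (u\<^sup>2 * s / 2)\<^sup>2"
proof -
  have bY: "bounded_rv M Y" using Y by (rule bounded_rvI)
  have i: "integrable M Y" "integrable M (\<lambda>\<omega>. (Y \<omega>)\<^sup>2)"
    unfolding power2_eq_square by (intro bounded_rv_integrable bounded_rv_mult bY)+
  define Q where "Q \<omega> = 1 + \<i> * complex_of_real (u * Y \<omega>) - complex_of_real (u\<^sup>2 / 2 * (Y \<omega>)\<^sup>2)" for \<omega>
  have ia: "integrable M (\<lambda>\<omega>. complex_of_real (u * Y \<omega>))"
    and ib: "integrable M (\<lambda>\<omega>. complex_of_real (u\<^sup>2 / 2 * (Y \<omega>)\<^sup>2))"
    using i by (intro integrable_of_real integrable_mult_right; simp)+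
  have ic: "integrable M (\<lambda>\<omega>. 1 + \<i> * complex_of_real (u * Y \<omega>))"
    using ia by (intro Bochner_Integration.integrable_add integrable_mult_right) auto
  have iQ: "integrable M Q"
    unfolding Q_def by (rule Bochner_Integration.integrable_diff[OF ic ib])
  have EQ: "(LINT \<omega>|M. Q \<omega>) = complex_of_real (1 - u\<^sup>2 * s / 2)"
  proof -
    have a: "(LINT \<omega>|M. complex_of_real (u * Y \<omega>)) = 0"
      using EY by (simp only: integral_complex_of_real) simp
    have b: "(LINT \<omega>|M. complex_of_real (u\<^sup>2 / 2 * (Y \<omega>)\<^sup>2)) = complex_of_real (u\<^sup>2 / 2 * s)"
      unfolding s_def by (simp only: integral_complex_of_real integral_mult_right_zero)
    have "(LINT \<omega>|M. 1 + \<i> * complex_of_real (u * Y \<omega>)) = (LINT \<omega>|M. 1) + (LINT \<omega>|M. \<i> * complex_of_real (u * Y \<omega>))"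
      using ia by (intro Bochner_Integration.integral_add integrable_mult_right) auto
    then have c: "(LINT \<omega>|M. 1 + \<i> * complex_of_real (u * Y \<omega>)) = 1"
      unfolding integral_mult_right_zero a by (simp add: prob_space)
    have "(LINT \<omega>|M. Q \<omega>) = 1 - complex_of_real (u\<^sup>2 / 2 * s)"
      unfolding Q_def Bochner_Integration.integral_diff[OF ic ib] b c ..
    then show ?thesis by simp
  qed
  have i1: "integrable M (\<lambda>\<omega>. iexp (u * Y \<omega>))" using Y by (intro integrable_iexp_comp) auto
  have pt: "cmod (iexp (u * Y \<omega>) - Q \<omega>) \<le> \<bar>u\<bar> ^ 3 * D ^ 3 / 6" if "\<omega> \<in> space M" for \<omega>
  proof -
    have "(\<Sum>k\<le>2. (\<i> * complex_of_real (u * Y \<omega>)) ^ k / fact k) = Q \<omega>"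
      by (simp add: Q_def numeral_2_eq_2 power_mult_distrib)
    then have "cmod (iexp (u * Y \<omega>) - Q \<omega>) \<le> \<bar>u * Y \<omega>\<bar> ^ 3 / 6"
      using iexp_approx1[of "u * Y \<omega>" 2] by (simp add: fact_numeral numeral_3_eq_3)
    also have "\<dots> \<le> \<bar>u\<bar> ^ 3 * D ^ 3 / 6"
      unfolding abs_mult power_mult_distrib using Y(2)[OF that]
      by (intro divide_right_mono mult_left_mono power_mono) auto
    finally show ?thesis .
  qed
  have "cmod ((LINT \<omega>|M. iexp (u * Y \<omega>)) - complex_of_real (1 - u\<^sup>2 * s / 2))
     = cmod (LINT \<omega>|M. iexp (u * Y \<omega>) - Q \<omega>)"
    using i1 iQ by (simp only: Bochner_Integration.integral_diff EQ)
  also have "\<dots> \<le> (LINT \<omega>|M. cmod (iexp (u * Y \<omega>) - Q \<omega>))" by (rule integral_norm_bound)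
  also have "\<dots> \<le> (LINT \<omega>|M. \<bar>u\<bar> ^ 3 * D ^ 3 / 6)"
    by (rule integral_mono[OF integrable_norm[OF Bochner_Integration.integrable_diff[OF i1 iQ]] integrable_const pt])
  also have "\<dots> = \<bar>u\<bar> ^ 3 * D ^ 3 / 6" by (simp add: prob_space)
  finally have 1: "cmod ((LINT \<omega>|M. iexp (u * Y \<omega>)) - complex_of_real (1 - u\<^sup>2 * s / 2)) \<le> \<bar>u\<bar> ^ 3 * D ^ 3 / 6" .
  have "s \<ge> 0" unfolding s_def by simp
  then have "\<bar>exp (- (u\<^sup>2 * s / 2)) - (1 - u\<^sup>2 * s / 2)\<bar> \<le> (u\<^sup>2 * s / 2)\<^sup>2"
    by (intro exp_minus_approx) simp
  then have 2: "cmod (complex_of_real (1 - u\<^sup>2 * s / 2) - complex_of_real (exp (- (u\<^sup>2 * s / 2)))) \<le> (u\<^sup>2 * s / 2)\<^sup>2"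
    by (simp only: of_real_diff[symmetric] norm_of_real abs_minus_commute)
  show ?thesis
    using norm_triangle_mono[OF 1 2] by simp
qed

section \<open>The limit of the characteristic functions of normalized partial sums\<close>

context associated_sequence
begin

lemma abs_cov_comp_le:
  assumes ll: "ll_on UNIV f f'" and b: "\<And>x. \<bar>f x\<bar> \<le> B" "\<And>x. \<bar>f' x\<bar> \<le> B'" and ij: "i \<ge> 1" "j \<ge> 1"
  shows "\<bar>cov M (\<lambda>\<omega>. f (X i \<omega>)) (\<lambda>\<omega>. f (X j \<omega>))\<bar> \<le> cov M (\<lambda>\<omega>. f' (X i \<omega>)) (\<lambda>\<omega>. f' (X j \<omega>))"
proof -
  note m = ll_on_UNIV_measurable[OF ll]
  have "ll_on (PiE {i, j} (\<lambda>_. UNIV)) (\<lambda>z. f (z k)) (\<lambda>z. f' (z k))" for k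
    by (intro ll_onI ll_onD[OF ll]) (auto dest: le_funD)
  then have "\<bar>cov M (\<lambda>\<omega>. (\<lambda>z. f (z i)) (\<lambda>j\<in>{i, j}. X j \<omega>)) (\<lambda>\<omega>. (\<lambda>z. f (z j)) (\<lambda>j\<in>{i, j}. X j \<omega>))\<bar>
     \<le> cov M (\<lambda>\<omega>. (\<lambda>z. f' (z i)) (\<lambda>j\<in>{i, j}. X j \<omega>)) (\<lambda>\<omega>. (\<lambda>z. f' (z j)) (\<lambda>j\<in>{i, j}. X j \<omega>))"
    using ij bounded_rv_comp[OF m(1) b(1)] bounded_rv_comp[OF m(2) b(2)] by (intro abs_cov_le) auto
  then show ?thesis by simp
qed

text \<open>Three replacements: the incomplete last block is dropped, the blocks are decoupled, and
  each block is replaced by a Gaussian factor. The first and third errors vanish as \<open>n\<close>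
  grows with \<open>l\<close> fixed; decoupling leaves a term that is small only for large
  \<open>l\<close>. \<open>K\<close> may depend on \<open>t\<close> and \<open>l\<close> but not on
  \<open>n\<close>.\<close>

lemma cmod_char_partial_sum_le:
  assumes ll: "ll_on UNIV f f'" and b: "\<And>x. \<bar>f x\<bar> \<le> B" "\<And>x. \<bar>f' x\<bar> \<le> B'"
    and zero: "expectation (\<lambda>\<omega>. f (X 1 \<omega>)) = 0"
    and sm: "summable (\<lambda>d. cov M (\<lambda>\<omega>. f' (X 1 \<omega>)) (\<lambda>\<omega>. f' (X (1 + d) \<omega>)))"
    and l: "l \<ge> 1"
  defines "s \<equiv> cov M (\<lambda>\<omega>. \<Sum>i=1..l. f (X i \<omega>)) (\<lambda>\<omega>. \<Sum>i=1..l. f (X i \<omega>))"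
    and "R \<equiv> (\<Sum>p<l. \<Sum>d. cov M (\<lambda>\<omega>. f' (X 1 \<omega>)) (\<lambda>\<omega>. f' (X (1 + (d + Suc p)) \<omega>)))"
  obtains K where "\<And>n. n \<ge> 1 \<Longrightarrow> cmod ((LINT \<omega>|M. iexp (t / sqrt (real n) * (\<Sum>i=1..n. f (X i \<omega>))))
      - complex_of_real (exp (- (real (n div l) / real n * (t\<^sup>2 * s / 2)))))
    \<le> K / sqrt (real n) + 4 * t\<^sup>2 * (R / real l)"
proof -
  note fm = ll_on_UNIV_measurable[OF ll]
  have bf: "bounded_rv M (\<lambda>\<omega>. f (X i \<omega>))" if "i \<ge> 1" for i by (rule bounded_rv_comp[OF fm(1) b(1) that])
  have bS: "bounded_rv M (\<lambda>\<omega>. \<Sum>i=1..n. f (X i \<omega>))" for n using bf by auto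
  note mS = bounded_rv_measurable[OF bS]
  have Ef: "expectation (\<lambda>\<omega>. f (X i \<omega>)) = 0" if "i \<ge> 1" for i
    using integral_shift_one[OF fm(1) that] zero by simp
  have ES: "expectation (\<lambda>\<omega>. \<Sum>i=1..l. f (X i \<omega>)) = 0"
    using Ef by (subst Bochner_Integration.integral_sum) (auto intro!: bounded_rv_integrable[OF bf])
  have s: "s = expectation (\<lambda>\<omega>. (\<Sum>i=1..l. f (X i \<omega>))\<^sup>2)"
    unfolding s_def cov_eq[OF bS bS] ES by (simp add: power2_eq_square)
  then have s0: "s \<ge> 0" by simp
  have B0: "B \<ge> 0" using b(1)[of 0] by linarith
  define D where "D = real l * B"
  have SD: "\<bar>\<Sum>i=1..l. f (X i \<omega>)\<bar> \<le> D" for \<omega>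
    unfolding D_def using sum_norm_bound[of "{1..l}" "\<lambda>i. f (X i \<omega>)" B] b(1) by simp
  have R0: "R \<ge> 0"
    unfolding R_def
  proof (intro sum_nonneg suminf_nonneg)
    show "summable (\<lambda>d. cov M (\<lambda>\<omega>. f' (X 1 \<omega>)) (\<lambda>\<omega>. f' (X (1 + (d + Suc p)) \<omega>)))" for p
      using summable_ignore_initial_segment[OF sm, of "Suc p"] by simp
  qed (auto intro: cov_comp_nonneg[OF fm(3) b(2)])
  \<comment> \<open>The summands come from the dropped block, from the third-order Taylor remainder,
    and from comparing \<open>1 - y\<close> with \<open>exp (- y)\<close>.\<close>
  define K where "K = \<bar>t\<bar> * D + \<bar>t\<bar> ^ 3 * D ^ 3 / 6 + (t\<^sup>2 * s / 2)\<^sup>2"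
  show thesis
  proof (rule that[of K])
    fix n :: nat assume n: "n \<ge> 1"
    define r where "r = sqrt (real n)"
    have r: "r \<ge> 1" "r\<^sup>2 = real n" using n by (auto simp: r_def)
    define u where "u = t / r"
    define m where "m = n div l"
    let ?\<phi> = "\<lambda>k. LINT \<omega>|M. iexp (u * (\<Sum>i=1..k. f (X i \<omega>)))"
    let ?e = "complex_of_real (exp (- (u\<^sup>2 * s / 2)))"
    have mn: "m * l \<le> n" "n - m * l \<le> l" "m \<le> n"
      unfolding m_def using l mod_less_divisor[of l n]
      by (auto simp: minus_div_mult_eq_mod less_imp_le)
    have "cmod (?\<phi> n - ?\<phi> (m * l)) \<le> expectation (\<lambda>\<omega>. \<bar>u * (\<Sum>i=1..n. f (X i \<omega>)) - u * (\<Sum>i=1..m * l. f (X i \<omega>))\<bar>)"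
      by (intro cmod_expectation_iexp_diff_le bounded_rv_integrable bounded_rv_diff bounded_rv_mult[OF bounded_rv_const] bS
          bounded_rv_measurable)
    also have "\<dots> \<le> expectation (\<lambda>\<omega>. \<bar>u\<bar> * D)"
    proof (rule integral_mono)
      show "integrable M (\<lambda>\<omega>. \<bar>u * (\<Sum>i=1..n. f (X i \<omega>)) - u * (\<Sum>i=1..m * l. f (X i \<omega>))\<bar>)"
        by (intro integrable_abs bounded_rv_integrable bounded_rv_diff bounded_rv_mult[OF bounded_rv_const] bS)
      fix \<omega>
      have "(\<Sum>i=1..n. f (X i \<omega>)) = (\<Sum>i=1..m * l. f (X i \<omega>)) + (\<Sum>i=Suc (m * l)..n. f (X i \<omega>))"
        using mn by (subst sum.union_disjoint[symmetric]) (auto intro!: sum.cong)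
      then have "u * (\<Sum>i=1..n. f (X i \<omega>)) - u * (\<Sum>i=1..m * l. f (X i \<omega>)) = u * (\<Sum>i=Suc (m * l)..n. f (X i \<omega>))"
        by (simp add: algebra_simps)
      moreover have "\<bar>\<Sum>i=Suc (m * l)..n. f (X i \<omega>)\<bar> \<le> D"
      proof -
        have "\<bar>\<Sum>i=Suc (m * l)..n. f (X i \<omega>)\<bar> \<le> real (n - m * l) * B"
          using sum_norm_bound[of "{Suc (m * l)..n}" "\<lambda>i. f (X i \<omega>)" B] b(1) by simp
        also have "\<dots> \<le> D" unfolding D_def using mn(2) B0 by (intro mult_right_mono) (simp_all only: of_nat_le_iff)
        finally show ?thesis .
      qed
      ultimately show "\<bar>u * (\<Sum>i=1..n. f (X i \<omega>)) - u * (\<Sum>i=1..m * l. f (X i \<omega>))\<bar> \<le> \<bar>u\<bar> * D"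
        by (simp add: abs_mult mult_left_mono)
    qed simp
    also have "\<dots> = (\<bar>t\<bar> * D) / r" using r by (simp add: prob_space u_def abs_divide)
    finally have 1: "cmod (?\<phi> n - ?\<phi> (m * l)) \<le> (\<bar>t\<bar> * D) / r" .
    have "cmod (?\<phi> (m * l) - ?\<phi> l ^ m) \<le> real m * (4 * u\<^sup>2 * R)"
      unfolding R_def by (rule cmod_iexp_block_power_le[OF ll b sm])
    also have "\<dots> = real m / real n * (4 * t\<^sup>2 * R)"
      using r by (simp add: u_def power_divide)
    also have "\<dots> \<le> 1 / real l * (4 * t\<^sup>2 * R)"
      unfolding m_def using R0 by (intro mult_right_mono div_ratio_bounds l n) auto
    finally have 2: "cmod (?\<phi> (m * l) - ?\<phi> l ^ m) \<le> 4 * t\<^sup>2 * (R / real l)" by simp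
    have e1: "cmod ?e \<le> 1" using s0 by (simp only: norm_of_real) simp
    \<comment> \<open>For numbers in the closed unit disc, \<open>m\<close>-th powers differ by at
      most \<open>m\<close> times the difference of the bases.\<close>
    have "cmod (?\<phi> l ^ m - ?e ^ m) \<le> real m * cmod (?\<phi> l - ?e)"
      using bS[of l] by (intro norm_power_diff e1 cmod_expectation_iexp_le bounded_rv_measurable bounded_rv_mult[OF bounded_rv_const])
    also have "\<dots> \<le> real n * (\<bar>u\<bar> ^ 3 * D ^ 3 / 6 + (u\<^sup>2 * s / 2)\<^sup>2)"
      unfolding s using mn(3) SD by (intro mult_mono iexp_second_order[OF mS _ ES]) auto
    also have "\<dots> = (\<bar>t\<bar> ^ 3 * D ^ 3 / 6) / r + (t\<^sup>2 * s / 2)\<^sup>2 / r\<^sup>2"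
      using r(1) unfolding r(2)[symmetric] u_def
      by (simp add: field_simps power_divide power2_eq_square power3_eq_cube abs_divide)
    \<comment> \<open>The last term has the better order \<open>1 / n\<close>; it is weakened to
      order \<open>1 / r\<close> so that one constant \<open>K\<close> collects everything.\<close>
    also have "\<dots> \<le> (\<bar>t\<bar> ^ 3 * D ^ 3 / 6) / r + (t\<^sup>2 * s / 2)\<^sup>2 / r"
      using r(1) by (intro add_left_mono divide_left_mono) (auto simp: power2_eq_square)
    finally have 3: "cmod (?\<phi> l ^ m - ?e ^ m) \<le> (\<bar>t\<bar> ^ 3 * D ^ 3 / 6) / r + (t\<^sup>2 * s / 2)\<^sup>2 / r" .
    have e_pow: "?e ^ m = complex_of_real (exp (- (real (n div l) / real n * (t\<^sup>2 * s / 2))))"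
    proof -
      have "?e ^ m = complex_of_real (exp (real m * (- (u\<^sup>2 * s / 2))))"
        by (simp only: of_real_power[symmetric] exp_of_nat_mult)
      also have "real m * (- (u\<^sup>2 * s / 2)) = - (real (n div l) / real n * (t\<^sup>2 * s / 2))"
        using r by (simp add: u_def m_def power_divide)
      finally show ?thesis .
    qed
    have "cmod (?\<phi> n - ?e ^ m) \<le> ((\<bar>t\<bar> * D) / r + 4 * t\<^sup>2 * (R / real l))
       + ((\<bar>t\<bar> ^ 3 * D ^ 3 / 6) / r + (t\<^sup>2 * s / 2)\<^sup>2 / r)"
      using norm_triangle_mono[OF norm_triangle_mono[OF 1 2] 3] by simp
    also have "\<dots> = K / r + 4 * t\<^sup>2 * (R / real l)"
      by (simp add: K_def add_divide_distrib)
    finally show "cmod ((LINT \<omega>|M. iexp (t / sqrt (real n) * (\<Sum>i=1..n. f (X i \<omega>))))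
      - complex_of_real (exp (- (real (n div l) / real n * (t\<^sup>2 * s / 2)))))
    \<le> K / sqrt (real n) + 4 * t\<^sup>2 * (R / real l)"
      unfolding e_pow unfolding u_def r_def .
  qed
qed

text \<open>The block length is fixed before \<open>n\<close> tends to infinity: no diagonal choice
  of block lengths is needed, since the error left over at fixed \<open>l\<close> is itself small
  for large \<open>l\<close>.\<close>

lemma char_partial_sum_tendsto:
  assumes ll: "ll_on UNIV f f'" and b: "\<And>x. \<bar>f x\<bar> \<le> B" "\<And>x. \<bar>f' x\<bar> \<le> B'"
    and zero: "expectation (\<lambda>\<omega>. f (X 1 \<omega>)) = 0"
    and sm: "summable (\<lambda>d. cov M (\<lambda>\<omega>. f' (X 1 \<omega>)) (\<lambda>\<omega>. f' (X (1 + d) \<omega>)))"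
  defines "c \<equiv> \<lambda>d. cov M (\<lambda>\<omega>. f (X 1 \<omega>)) (\<lambda>\<omega>. f (X (1 + d) \<omega>))"
  defines "\<sigma>2 \<equiv> c 0 + 2 * (\<Sum>d. c (Suc d))"
  shows "(\<lambda>n. LINT \<omega>|M. iexp (t / sqrt (real n) * (\<Sum>i=1..n. f (X i \<omega>))))
           \<longlonglongrightarrow> complex_of_real (exp (- (t\<^sup>2 * \<sigma>2 / 2)))"
proof -
  note fm = ll_on_UNIV_measurable[OF ll]
  define c' where "c' d = cov M (\<lambda>\<omega>. f' (X 1 \<omega>)) (\<lambda>\<omega>. f' (X (1 + d) \<omega>))" for d
  have sm': "summable c'" using sm by (simp add: c'_def[abs_def])
  have "\<bar>c d\<bar> \<le> c' d" for d
    unfolding c_def c'_def by (rule abs_cov_comp_le[OF ll b]) auto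
  then have smc: "summable c" by (intro summable_comparison_test[OF _ sm']) auto
  define s where "s l = cov M (\<lambda>\<omega>. \<Sum>i=1..l. f (X i \<omega>)) (\<lambda>\<omega>. \<Sum>i=1..l. f (X i \<omega>))" for l :: nat
  define R where "R l = (\<Sum>p<l. \<Sum>d. c' (d + Suc p))" for l :: nat
  have s_lim: "(\<lambda>l. s l / real l) \<longlonglongrightarrow> \<sigma>2"
  proof -
    have "(\<lambda>k. c 0 + 2 * (\<Sum>d=1..k. c d)) \<longlonglongrightarrow> \<sigma>2"
    proof -
      have "(\<lambda>k. \<Sum>d<k. c (Suc d)) \<longlonglongrightarrow> (\<Sum>d. c (Suc d))"
        using smc by (intro summable_LIMSEQ) (simp only: summable_Suc_iff)
      moreover have "(\<Sum>d=1..k. c d) = (\<Sum>d<k. c (Suc d))" for k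
        by (simp add: sum.atLeast1_atMost_eq)
      ultimately show ?thesis unfolding \<sigma>2_def by (intro tendsto_intros) simp
    qed
    from cesaro_mean_tendsto[OF this] show ?thesis
      unfolding s_def using cov_sum_sum[OF fm(1) b(1)] by (simp add: c_def)
  qed
  \<comment> \<open>The summands are tails of a convergent series, so their averages tend to 0
    although no rate for the tails is known.\<close>
  have R_lim: "(\<lambda>l. R l / real l) \<longlonglongrightarrow> 0"
  proof -
    have "(\<lambda>p. \<Sum>d. c' (d + p)) = (\<lambda>p. suminf c' - (\<Sum>d<p. c' d))"
      by (auto simp: suminf_minus_initial_segment[OF sm'])
    moreover have "(\<lambda>p. suminf c' - (\<Sum>d<p. c' d)) \<longlonglongrightarrow> suminf c' - suminf c'"
      by (intro tendsto_intros summable_LIMSEQ sm')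
    ultimately have "(\<lambda>p. \<Sum>d. c' (d + p)) \<longlonglongrightarrow> 0" by simp
    then have "(\<lambda>p. \<Sum>d. c' (d + Suc p)) \<longlonglongrightarrow> 0" by (rule LIMSEQ_Suc)
    from cesaro_mean_tendsto[OF this] show ?thesis unfolding R_def .
  qed
  define G where "G x = exp (- (t\<^sup>2 * x / 2))" for x :: real
  have G_lim: "(\<lambda>l. G (s l / real l)) \<longlonglongrightarrow> G \<sigma>2"
    unfolding G_def by (intro tendsto_intros s_lim) simp
  show ?thesis
  proof (rule LIMSEQ_I)
    fix e :: real assume e: "e > 0"
    have "(\<lambda>l. 4 * t\<^sup>2 * (R l / real l)) \<longlonglongrightarrow> 4 * t\<^sup>2 * 0" by (intro tendsto_intros R_lim)
    then have "\<forall>\<^sub>F l in sequentially. 4 * t\<^sup>2 * (R l / real l) < e / 4"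
      by (rule order_tendstoD) (use e in simp)
    moreover have "\<forall>\<^sub>F l in sequentially. \<bar>G (s l / real l) - G \<sigma>2\<bar> < e / 4"
      using tendstoD[OF G_lim, of "e / 4"] e by (simp add: dist_real_def)
    \<comment> \<open>Two quarters of \<open>e\<close> are spent here through the choice of
      \<open>l\<close>; the other two cover \<open>K / sqrt (real n)\<close> and the rounding of
      \<open>n\<close> to a multiple of \<open>l\<close>.\<close>
    ultimately have "\<forall>\<^sub>F l in sequentially. l \<ge> 1 \<and> 4 * t\<^sup>2 * (R l / real l) < e / 4 \<and> \<bar>G (s l / real l) - G \<sigma>2\<bar> < e / 4"
      using eventually_ge_at_top[of "1::nat"] by eventually_elim auto
    then obtain l :: nat where l: "l \<ge> 1" "4 * t\<^sup>2 * (R l / real l) < e / 4" "\<bar>G (s l / real l) - G \<sigma>2\<bar> < e / 4"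
      by (auto dest: eventually_happens)
    let ?a = "\<lambda>n. exp (- (real (n div l) / real n * (t\<^sup>2 * s l / 2)))"
    let ?\<phi> = "\<lambda>n. LINT \<omega>|M. iexp (t / sqrt (real n) * (\<Sum>i=1..n. f (X i \<omega>)))"
    obtain K where K: "\<And>n. n \<ge> 1 \<Longrightarrow> cmod (?\<phi> n - complex_of_real (?a n)) \<le> K / sqrt (real n) + 4 * t\<^sup>2 * (R l / real l)"
      unfolding s_def R_def c'_def using cmod_char_partial_sum_le[OF ll b zero sm l(1), of t] by blast
    have "?a \<longlonglongrightarrow> exp (- (1 / real l * (t\<^sup>2 * s l / 2)))"
      by (intro tendsto_intros tendsto_div_ratio l)
    moreover have "exp (- (1 / real l * (t\<^sup>2 * s l / 2))) = G (s l / real l)" by (simp add: G_def)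
    ultimately have "\<forall>\<^sub>F n in sequentially. \<bar>?a n - G (s l / real l)\<bar> < e / 4"
      using e by (auto dest!: tendstoD[of _ _ _ "e / 4"] simp: dist_real_def)
    moreover have "\<forall>\<^sub>F n in sequentially. K / sqrt (real n) < e / 4"
      by (rule order_tendstoD[OF tendsto_divide_sqrt_0]) (use e in simp)
    ultimately have "\<forall>\<^sub>F n in sequentially. cmod (?\<phi> n - complex_of_real (exp (- (t\<^sup>2 * \<sigma>2 / 2)))) < e"
      using eventually_ge_at_top[of "1::nat"]
    proof eventually_elim
      case (elim n)
      have "cmod (complex_of_real (?a n) - complex_of_real (G \<sigma>2)) = \<bar>?a n - G \<sigma>2\<bar>"
        by (simp only: of_real_diff[symmetric] norm_of_real)
      moreover have "\<bar>?a n - G \<sigma>2\<bar> < e / 2" using elim(1) l(3) by linarith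
      moreover have "cmod (?\<phi> n - complex_of_real (G \<sigma>2))
        \<le> cmod (?\<phi> n - complex_of_real (?a n)) + cmod (complex_of_real (?a n) - complex_of_real (G \<sigma>2))"
        by (rule norm_diff_triangle_le[OF order_refl order_refl])
      ultimately have "cmod (?\<phi> n - complex_of_real (G \<sigma>2)) < e"
        using K[OF elim(3)] elim(2) l(2) by linarith
      then show ?case by (simp only: G_def)
    qed
    then show "\<exists>no. \<forall>n\<ge>no. norm (?\<phi> n - complex_of_real (exp (- (t\<^sup>2 * \<sigma>2 / 2)))) < e"
      by (simp only: eventually_sequentially)
  qed
qed

end

section \<open>U-statistics\<close>

lemma sum_upper_triangle:
  fixes g :: "nat \<Rightarrow> nat \<Rightarrow> real"
  assumes sym: "\<And>i j. g i j = g j i"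
  shows "2 * (\<Sum>(i, j) | 1 \<le> i \<and> i < j \<and> j \<le> n. g i j) = (\<Sum>i=1..n. \<Sum>j=1..n. g i j) - (\<Sum>i=1..n. g i i)"
proof (induction n)
  case 0
  have empty: "{(i, j). 1 \<le> i \<and> i < j \<and> j \<le> (0::nat)} = {}" by auto
  show ?case unfolding empty by simp
next
  case (Suc n)
  let ?T = "\<lambda>n. {(i, j). 1 \<le> i \<and> i < j \<and> j \<le> (n::nat)}"
  have "?T (Suc n) = ?T n \<union> (\<lambda>i. (i, Suc n)) ` {1..n}" by auto
  moreover have "finite (?T n)" by (rule finite_subset[of _ "{..n} \<times> {..n}"]) auto
  ultimately have "(\<Sum>(i, j)\<in>?T (Suc n). g i j) = (\<Sum>(i, j)\<in>?T n. g i j) + (\<Sum>(i, j)\<in>(\<lambda>i. (i, Suc n)) ` {1..n}. g i j)"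
    by (simp only:) (rule sum.union_disjoint, auto)
  also have "(\<Sum>(i, j)\<in>(\<lambda>i. (i, Suc n)) ` {1..n}. g i j) = (\<Sum>i=1..n. g i (Suc n))"
    by (subst sum.reindex) (auto simp: inj_on_def)
  finally have "(\<Sum>(i, j)\<in>?T (Suc n). g i j) = (\<Sum>(i, j)\<in>?T n. g i j) + (\<Sum>i=1..n. g i (Suc n))" .
  moreover have "(\<Sum>j=1..n. g (Suc n) j) = (\<Sum>i=1..n. g i (Suc n))" by (intro sum.cong refl sym)
  ultimately show ?case
    using Suc by (simp add: sum.distrib)
qed

section \<open>Integrals against the law of the first variable and the remainder after linear
  projection\<close>

context associated_sequence
begin

text \<open>Nothing is known about \<open>h\<close> off \<open>S\<close>, not even measurability.
  \<open>g\<close> is a Borel function agreeing with it on \<open>S\<close>, where the whole law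
  lives; in the application it is the clamped version.\<close>

lemma set_lebesgue_integral_distr_first:
  fixes g h :: "real \<Rightarrow> real"
  assumes g: "g \<in> borel_measurable borel" and S: "S \<in> sets borel"
    and eq: "\<And>x. x \<in> S \<Longrightarrow> h x = g x" and in_S: "\<And>\<omega>. \<omega> \<in> space M \<Longrightarrow> X 1 \<omega> \<in> S"
  shows "(LINT x:S|distr M borel (X 1). h x) = expectation (\<lambda>\<omega>. g (X 1 \<omega>))"
proof -
  have "(LINT x:S|distr M borel (X 1). h x) = (LINT x|distr M borel (X 1). indicator S x * g x)"
    unfolding set_lebesgue_integral_def using eq
    by (intro Bochner_Integration.integral_cong) (auto simp: indicator_def)
  also have "\<dots> = expectation (\<lambda>\<omega>. indicator S (X 1 \<omega>) * g (X 1 \<omega>))"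
    using g S rv[of 1] by (intro integral_distr) auto
  also have "\<dots> = expectation (\<lambda>\<omega>. g (X 1 \<omega>))"
    using in_S by (intro Bochner_Integration.integral_cong) auto
  finally show ?thesis .
qed

lemma bounded_density_interval_le:
  assumes p: "\<And>x. p x \<le> K" "distributed M lborel (X 1) (\<lambda>x. ennreal (p x))" and K: "K \<ge> 0"
    and i: "i \<ge> 1" and \<delta>: "\<delta> > 0"
  shows "expectation (\<lambda>\<omega>. indicator {t - \<delta>..t} (X i \<omega>)) \<le> K * \<delta>"
proof -
  let ?I = "{t - \<delta>..t}"
  have X1: "X 1 \<in> borel_measurable M" by (rule rv) simp
  have "expectation (\<lambda>\<omega>. indicator ?I (X i \<omega>)) = expectation (\<lambda>\<omega>. indicator ?I (X 1 \<omega>) :: real)"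
    by (rule integral_shift_one[of "indicator ?I", OF _ i]) simp
  also have "\<dots> = expectation (indicator (X 1 -` ?I \<inter> space M))"
    by (intro Bochner_Integration.integral_cong) (auto simp: indicator_def)
  also have "\<dots> = prob (X 1 -` ?I \<inter> space M)"
    using measurable_sets[OF X1, of ?I] by simp
  finally have 1: "expectation (\<lambda>\<omega>. indicator ?I (X i \<omega>)) = prob (X 1 -` ?I \<inter> space M)" .
  have "emeasure M (X 1 -` ?I \<inter> space M) = (\<integral>\<^sup>+x. ennreal (p x) * indicator ?I x \<partial>lborel)"
    by (rule distributed_emeasure[OF p(2)]) simp
  also have "\<dots> \<le> (\<integral>\<^sup>+x. ennreal K * indicator ?I x \<partial>lborel)"
    using p(1) by (intro nn_integral_mono mult_right_mono ennreal_leI) auto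
  also have "\<dots> = ennreal K * emeasure lborel ?I" by (rule nn_integral_cmult_indicator) simp
  also have "\<dots> = ennreal (K * \<delta>)" using \<delta> K by (simp add: ennreal_mult)
  finally have "ennreal (prob (X 1 -` ?I \<inter> space M)) \<le> ennreal (K * \<delta>)"
    by (simp add: emeasure_eq_measure)
  then show ?thesis unfolding 1 using K \<delta> by (subst (asm) ennreal_le_iff) auto
qed

text \<open>\<open>E\<close> is the error of approximating the centred statistic by its linear
  projection. It equals the full degenerate double sum minus the diagonal, divided by
  \<open>n * (n - 1)\<close>. Both parts are of order \<open>n\<close> in mean, the diagonal simply
  because its \<open>n\<close> terms are bounded by \<open>4 * B\<close>. The resulting order
  \<open>1 / n\<close> survives multiplication by \<open>sqrt n\<close>.\<close>

lemma U_statistic_remainder_le: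
  assumes ap: "uniformly_step_approximable \<rho> V"
    and B: "\<And>x y. \<bar>\<rho> x y\<bar> \<le> B" and sym: "\<And>x y. \<rho> x y = \<rho> y x"
    and var: "\<And>u :: real \<Rightarrow> real. mono u \<Longrightarrow> (\<And>x. u x \<in> {0, 1}) \<Longrightarrow>
        cov M (\<lambda>\<omega>. \<Sum>i=1..n. u (X i \<omega>)) (\<lambda>\<omega>. \<Sum>i=1..n. u (X i \<omega>)) \<le> W * real n"
    and W: "W \<ge> 0" and n: "n \<ge> 2"
    and r: "\<And>x. r x = expectation (\<lambda>\<omega>. \<rho> x (X 1 \<omega>))"
    and \<theta>: "\<theta> = expectation (\<lambda>\<omega>. r (X 1 \<omega>))"
  defines "E \<equiv> \<lambda>\<omega>. (\<Sum>(i, j) | 1 \<le> i \<and> i < j \<and> j \<le> n. \<rho> (X i \<omega>) (X j \<omega>)) / real (n choose 2) - \<theta>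
      - 2 / real n * (\<Sum>i=1..n. r (X i \<omega>) - \<theta>)"
  shows "bounded_rv M E" "expectation (\<lambda>\<omega>. \<bar>E \<omega>\<bar>) \<le> 2 * (V * W + 4 * B) / real n"
proof -
  let ?h = "\<lambda>x y. \<rho> x y - r x - r y + \<theta>"
  define T where "T \<omega> = (\<Sum>i=1..n. \<Sum>j=1..n. ?h (X i \<omega>) (X j \<omega>))" for \<omega>
  define Dg where "Dg \<omega> = (\<Sum>i=1..n. ?h (X i \<omega>) (X i \<omega>))" for \<omega>
  note \<rho>b = bounded_rv_kernel(1)[OF ap B]
  have rm: "r \<in> borel_measurable borel" by (rule marginal_measurable[OF ap r])
  have rB: "\<bar>r x\<bar> \<le> B" for x by (rule abs_marginal_le[OF ap B r])
  have rb: "bounded_rv M (\<lambda>\<omega>. r (X i \<omega>))" if "i \<ge> 1" for i by (rule bounded_rv_comp[OF rm rB that])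
  have \<theta>B: "\<bar>\<theta>\<bar> \<le> B"
  proof -
    have "\<bar>\<theta>\<bar> \<le> expectation (\<lambda>\<omega>. B)"
      unfolding \<theta> using bounded_rv_integrable[OF rb, of 1] rB
      by (intro order.trans[OF integral_abs_bound] integral_mono) auto
    then show ?thesis by (simp add: prob_space)
  qed
  have bh: "bounded_rv M (\<lambda>\<omega>. ?h (X i \<omega>) (X j \<omega>))" if "i \<ge> 1" "j \<ge> 1" for i j
    using that by (intro bounded_rv_add bounded_rv_diff \<rho>b rb) auto
  have bT: "bounded_rv M T" and bD: "bounded_rv M Dg"
    unfolding T_def Dg_def by (intro bounded_rv_sum bh; simp)+
  have hB: "\<bar>?h x y\<bar> \<le> 4 * B" for x y using B[of x y] rB[of x] rB[of y] \<theta>B by linarith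
  have B0: "B \<ge> 0" using B[of 0 0] by linarith
  have choose: "real (n choose 2) = real n * (real n - 1) / 2"
    using n by (simp add: choose_two real_of_nat_div of_nat_diff)
  have E_eq: "E \<omega> = inverse (real n * (real n - 1)) * (T \<omega> - Dg \<omega>)" for \<omega>
  proof -
    define P where "P = (\<Sum>(i, j) | 1 \<le> i \<and> i < j \<and> j \<le> n. \<rho> (X i \<omega>) (X j \<omega>))"
    define Q where "Q = (\<Sum>i=1..n. r (X i \<omega>))"
    have "T \<omega> = (\<Sum>i=1..n. \<Sum>j=1..n. \<rho> (X i \<omega>) (X j \<omega>)) - 2 * real n * Q + (real n)\<^sup>2 * \<theta>"
      unfolding T_def Q_def by (simp add: sum.distrib sum_subtractf power2_eq_square sum_distrib_left[symmetric])
    moreover have "Dg \<omega> = (\<Sum>i=1..n. \<rho> (X i \<omega>) (X i \<omega>)) - 2 * Q + real n * \<theta>"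
      unfolding Dg_def Q_def by (simp add: sum.distrib sum_subtractf sum_distrib_left)
    moreover have "2 * P = (\<Sum>i=1..n. \<Sum>j=1..n. \<rho> (X i \<omega>) (X j \<omega>)) - (\<Sum>i=1..n. \<rho> (X i \<omega>) (X i \<omega>))"
      unfolding P_def using sym by (intro sum_upper_triangle)
    ultimately have TD: "T \<omega> - Dg \<omega> = 2 * P - 2 * (real n - 1) * Q + real n * (real n - 1) * \<theta>"
      by (simp add: algebra_simps power2_eq_square)
    have "E \<omega> = P / (real n * (real n - 1) / 2) - \<theta> - 2 / real n * (Q - real n * \<theta>)"
      unfolding E_def P_def Q_def choose by (simp add: sum_subtractf)
    moreover have "P / (x * y / 2) - \<theta> - 2 / x * (Q - x * \<theta>) = inverse (x * y) * (2 * P - 2 * y * Q + x * y * \<theta>)"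
      if "x \<noteq> 0" "y \<noteq> 0" for x y :: real
      using that by (simp add: field_simps)
    ultimately show ?thesis unfolding TD using n by simp
  qed
  then have E_fun: "E = (\<lambda>\<omega>. inverse (real n * (real n - 1)) * (T \<omega> - Dg \<omega>))" by auto
  show "bounded_rv M E"
    unfolding E_fun by (intro bounded_rv_mult bounded_rv_diff bT bD bounded_rv_const)
  have ET: "expectation (\<lambda>\<omega>. \<bar>T \<omega>\<bar>) \<le> V * (W * real n)"
    unfolding T_def using W by (intro degenerate_double_sum_le[OF ap B sym var r \<theta>]) auto
  have ED: "expectation (\<lambda>\<omega>. \<bar>Dg \<omega>\<bar>) \<le> real n * (4 * B)"
  proof -
    have "expectation (\<lambda>\<omega>. \<bar>Dg \<omega>\<bar>) \<le> expectation (\<lambda>\<omega>. real n * (4 * B))"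
    proof (rule integral_mono)
      show "\<bar>Dg \<omega>\<bar> \<le> real n * (4 * B)" for \<omega>
      proof -
        have "\<bar>Dg \<omega>\<bar> \<le> (\<Sum>i=1..n. 4 * B)"
          unfolding Dg_def by (intro order.trans[OF sum_abs] sum_mono hB)
        then show ?thesis by simp
      qed
    qed (auto intro: bounded_rv_integrable bD)
    then show ?thesis by (simp add: prob_space)
  qed
  have i: "integrable M (\<lambda>\<omega>. \<bar>T \<omega>\<bar>)" "integrable M (\<lambda>\<omega>. \<bar>Dg \<omega>\<bar>)"
    by (intro integrable_abs bounded_rv_integrable bT bD)+
  have "expectation (\<lambda>\<omega>. \<bar>E \<omega>\<bar>) = inverse (real n * (real n - 1)) * expectation (\<lambda>\<omega>. \<bar>T \<omega> - Dg \<omega>\<bar>)"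
    unfolding E_fun using n by (simp add: abs_mult)
  also have "\<dots> \<le> inverse (real n * (real n - 1)) * expectation (\<lambda>\<omega>. \<bar>T \<omega>\<bar> + \<bar>Dg \<omega>\<bar>)"
    using n by (intro mult_left_mono integral_mono integrable_abs bounded_rv_integrable bounded_rv_diff bT bD
        Bochner_Integration.integrable_add abs_triangle_ineq4) auto
  also have "\<dots> = inverse (real n * (real n - 1)) * (expectation (\<lambda>\<omega>. \<bar>T \<omega>\<bar>) + expectation (\<lambda>\<omega>. \<bar>Dg \<omega>\<bar>))"
    by (simp only: Bochner_Integration.integral_add[OF i])
  also have "\<dots> \<le> inverse (real n * (real n - 1)) * (V * (W * real n) + real n * (4 * B))"
    using n by (intro mult_left_mono add_mono ET ED) auto
  also have "\<dots> = (V * W + 4 * B) / (real n - 1)"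
    using n by (simp add: field_simps)
  also have "\<dots> \<le> (V * W + 4 * B) / (real n / 2)"
  proof (rule divide_left_mono)
    \<comment> \<open>The sign of \<open>V\<close> is not assumed; that of \<open>V * W\<close>
      follows because \<open>V * (W * real n)\<close> bounds an expected absolute value.\<close>
    have "V * (W * real n) \<ge> 0" using order.trans[OF _ ET] by simp
    then have "V * W \<ge> 0" using n by (simp add: mult.assoc[symmetric] zero_le_mult_iff)
    then show "0 \<le> V * W + 4 * B" using B0 by simp
  qed (use n in auto)
  finally show "expectation (\<lambda>\<omega>. \<bar>E \<omega>\<bar>) \<le> 2 * (V * W + 4 * B) / real n" by (simp add: mult.commute)
qed

end

text \<open>Composing with the clamp turns estimates on the square into estimates on the plane: it
  maps nondecreasing grids on the line to nondecreasing grids in \<open>[a, b]\<close>, and repeated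
  grid points do no harm.\<close>

lemma bounded_hk_variation_step_approximable:
  fixes \<rho> :: "real \<Rightarrow> real \<Rightarrow> real" and a b :: real
  assumes ab: "a < b"
    and hk: "bounded_hk_variation {1, 2::nat} (\<lambda>_. a) (\<lambda>_. b) (\<lambda>v. \<rho> (v 1) (v 2))"
    and sym: "\<And>x y. x \<in> {a..b} \<Longrightarrow> y \<in> {a..b} \<Longrightarrow> \<rho> x y = \<rho> y x"
  defines "\<kappa> \<equiv> \<lambda>x. max a (min b x)"
  obtains V B where "uniformly_step_approximable (\<lambda>x y. \<rho> (\<kappa> x) (\<kappa> y)) V"
    "\<And>x y. \<bar>\<rho> (\<kappa> x) (\<kappa> y)\<bar> \<le> B"
proof -
  obtain v V where v: "mono_on {a..b} v"
    and mod: "\<And>x x' y. x \<in> {a..b} \<Longrightarrow> x' \<in> {a..b} \<Longrightarrow> y \<in> {a..b} \<Longrightarrow> \<bar>\<rho> x y - \<rho> x' y\<bar> \<le> \<bar>v x - v x'\<bar>"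
    and grid: "\<And>g N. mono g \<Longrightarrow> range g \<subseteq> {a..b} \<Longrightarrow>
           (\<Sum>s<N. \<Sum>t<N. \<bar>mixed_difference \<rho> (g s) (g (Suc s)) (g t) (g (Suc t))\<bar>) \<le> V"
    using bounded_hk_variation_modulus[OF ab hk] by blast
  have \<kappa>: "\<kappa> x \<in> {a..b}" "\<kappa> a = a" "\<kappa> b = b" for x using ab by (auto simp: \<kappa>_def)
  have \<kappa>_mono: "mono \<kappa>" by (rule monoI) (auto simp: \<kappa>_def)
  have v_mono: "v (\<kappa> x) \<le> v (\<kappa> y)" if "x \<le> y" for x y
    by (rule mono_onD[OF v \<kappa>(1) \<kappa>(1) monoD[OF \<kappa>_mono that]])
  have va: "v (\<kappa> a) \<le> v (\<kappa> x)" "v (\<kappa> x) \<le> v (\<kappa> b)" for x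
    using mono_onD[OF v, of a "\<kappa> x"] mono_onD[OF v, of "\<kappa> x" b] \<kappa>(1)[of x] \<kappa>(2,3) ab by auto
  show thesis
  proof (rule that)
    show "uniformly_step_approximable (\<lambda>x y. \<rho> (\<kappa> x) (\<kappa> y)) V"
      unfolding uniformly_step_approximable_def
    proof (intro allI impI)
      fix \<epsilon> :: real assume \<epsilon>: "\<epsilon> > 0"
      have grid': "(\<Sum>s<N. \<Sum>t<N. \<bar>mixed_difference (\<lambda>x y. \<rho> (\<kappa> x) (\<kappa> y)) (g s) (g (Suc s)) (g t) (g (Suc t))\<bar>) \<le> V"
        if "mono g" for g :: "nat \<Rightarrow> real" and N
      proof -
        have "mono (\<lambda>k. \<kappa> (g k))" using that \<kappa>_mono by (simp add: mono_def)
        moreover have "range (\<lambda>k. \<kappa> (g k)) \<subseteq> {a..b}" using \<kappa>(1) by blast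
        ultimately show ?thesis using grid[of "\<lambda>k. \<kappa> (g k)" N] by (simp add: mixed_difference_def)
      qed
      have "mono (\<lambda>x. v (\<kappa> x))" using v_mono by (rule monoI)
      note approx = kernel_step_approximation[where v = "\<lambda>x. v (\<kappa> x)" and a = a and b = b, OF this va
          sym[OF \<kappa>(1) \<kappa>(1)] mod[OF \<kappa>(1) \<kappa>(1) \<kappa>(1)] grid' \<epsilon>]
      obtain N :: nat and u :: "nat \<Rightarrow> real \<Rightarrow> real" and \<alpha> \<beta> \<Delta>
        where u: "\<And>s. mono (u s)" "\<And>s x. u s x \<in> {0, 1}" and \<Delta>: "(\<Sum>s<N. \<Sum>t<N. \<bar>\<Delta> s t\<bar>) \<le> V"
          and a: "\<And>x y. \<bar>\<rho> (\<kappa> x) (\<kappa> y) - (\<alpha> + (\<Sum>s<N. \<beta> s * u s x) + (\<Sum>t<N. \<beta> t * u t y)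
              + (\<Sum>s<N. \<Sum>t<N. \<Delta> s t * u s x * u t y))\<bar> \<le> \<epsilon>"
        by (rule approx) (assumption, rule that)
      show "\<exists>(N::nat) (u :: nat \<Rightarrow> real \<Rightarrow> real) \<alpha> \<beta> \<Delta>.
         (\<forall>s. mono (u s)) \<and> (\<forall>s x. u s x \<in> {0, 1}) \<and> (\<Sum>s<N. \<Sum>t<N. \<bar>\<Delta> s t\<bar>) \<le> V \<and>
         (\<forall>x y. \<bar>\<rho> (\<kappa> x) (\<kappa> y) - (\<alpha> + (\<Sum>s<N. \<beta> s * u s x) + (\<Sum>t<N. \<beta> t * u t y)
                  + (\<Sum>s<N. \<Sum>t<N. \<Delta> s t * u s x * u t y))\<bar> \<le> \<epsilon>)"
        by (rule exI[of _ N], rule exI[of _ u], rule exI[of _ \<alpha>], rule exI[of _ \<beta>], rule exI[of _ \<Delta>])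
          (intro conjI allI u \<Delta> a)
    qed
    fix x y
    \<comment> \<open>Boundedness is obtained by walking to the corner \<open>(a, a)\<close>: first
      the left argument moves, then symmetry exchanges the arguments and the other one
      moves.\<close>
    have "\<bar>\<rho> (\<kappa> x) (\<kappa> y) - \<rho> a (\<kappa> y)\<bar> \<le> v b - v a" "\<bar>\<rho> (\<kappa> y) a - \<rho> a a\<bar> \<le> v b - v a"
      using mod[of "\<kappa> x" a "\<kappa> y"] mod[of "\<kappa> y" a a] va[of x] va[of y] \<kappa>(1)[of x] \<kappa>(1)[of y] \<kappa>(2,3) ab by auto
    moreover have "\<rho> a (\<kappa> y) = \<rho> (\<kappa> y) a" using ab \<kappa>(1) by (intro sym) auto
    moreover have "\<bar>p\<bar> \<le> \<bar>c\<bar> + 2 * d" if "\<bar>p - q\<bar> \<le> d" "\<bar>q - c\<bar> \<le> d" for p q c d :: real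
      using that by linarith
    ultimately show "\<bar>\<rho> (\<kappa> x) (\<kappa> y)\<bar> \<le> \<bar>\<rho> a a\<bar> + 2 * (v b - v a)" by metis
  qed
qed

text \<open>Summability forces the terms to be eventually at most 1, where raising the exponent
  lowers the power. This passes from \<gamma> to the exponent 1/3 of the indicator estimate.\<close>

lemma summable_powr_mono:
  fixes c :: "nat \<Rightarrow> real"
  assumes sm: "summable (\<lambda>d. c d powr \<gamma>)" and c: "\<And>d. c d \<ge> 0" and \<gamma>: "0 < \<gamma>" "\<gamma> \<le> \<beta>"
  shows "summable (\<lambda>d. c d powr \<beta>)"
proof (rule summable_comparison_test_ev[OF _ sm])
  have "\<forall>\<^sub>F d in sequentially. c d powr \<gamma> < 1"
    by (rule order_tendstoD[OF summable_LIMSEQ_zero[OF sm]]) simp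
  then show "\<forall>\<^sub>F d in sequentially. norm (c d powr \<beta>) \<le> c d powr \<gamma>"
  proof eventually_elim
    case (elim d)
    have "c d \<le> 1"
    proof (rule ccontr)
      assume "\<not> c d \<le> 1"
      then have "c d powr \<gamma> \<ge> 1" using \<gamma> by (intro ge_one_powr_ge_zero) auto
      with elim show False by simp
    qed
    then show ?case using c[of d] \<gamma> by (simp add: powr_mono')
  qed
qed

text \<open>Stieltjes integrals with respect to the distribution function thereby become
  expectations.\<close>

lemma interval_measure_cdf:
  assumes "real_distribution \<mu>" shows "interval_measure (cdf \<mu>) = \<mu>"
proof -
  interpret real_distribution \<mu> by fact
  show ?thesis
    using cdf_is_right_cont cdf_lim_at_bot cdf_lim_at_top_prob
    by (intro cdf_unique real_distribution_interval_measure cdf_interval_measure real_distribution_axioms)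
      (auto intro: cdf_nondecreasing)
qed

lemma (in prob_space) weak_conv_std_normalI:
  assumes m: "\<And>n. Y n \<in> borel_measurable M"
    and lim: "\<And>t. (\<lambda>n. LINT \<omega>|M. iexp (t * Y n \<omega>)) \<longlonglongrightarrow> complex_of_real (exp (- (t\<^sup>2 / 2)))"
  shows "weak_conv_m (\<lambda>n. distr M borel (Y n)) std_normal_distribution"
proof (rule levy_continuity[OF _ real_dist_normal_dist])
  show "real_distribution (distr M borel (Y n))" for n using m by (rule real_distribution_distr)
  show "(\<lambda>n. char (distr M borel (Y n)) t) \<longlonglongrightarrow> char std_normal_distribution t" for t
  proof -
    have "char (distr M borel (Y n)) t = (LINT \<omega>|M. iexp (t * Y n \<omega>))" for n
      unfolding char_def using m by (intro integral_distr) auto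
    moreover have "char std_normal_distribution t = complex_of_real (exp (- (t\<^sup>2 / 2)))"
      by (simp add: char_std_normal_distribution)
    ultimately show ?thesis using lim[of t] by (simp only:)
  qed
qed

theorem theorem3p3:
  fixes M :: "'a measure"
    and X :: "nat \<Rightarrow> 'a \<Rightarrow> real"
    and C\<^sub>1 \<gamma> \<theta> \<sigma>\<^sub>U :: real
    and F \<rho>\<^sub>1 \<rho>\<^sub>1' :: "real \<Rightarrow> real"
    and \<rho> :: "real \<Rightarrow> real \<Rightarrow> real"
    and U :: "nat \<Rightarrow> 'a \<Rightarrow> real"
  assumes "prob_space M"
    and "\<And>n. n \<ge> 1 \<Longrightarrow> X n \<in> borel_measurable M"
    and "strictly_stationary M X"
    and "associated M {1..} X"
    and "\<And>n \<omega>. n \<ge> 1 \<Longrightarrow> \<omega> \<in> space M \<Longrightarrow> \<bar>X n \<omega>\<bar> < C\<^sub>1"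
    and F: "F = cdf (distr M borel (X 1))"
    and density: "\<exists>p. (\<forall>x::real. 0 \<le> p x) \<and> bounded (range p) \<and>
                      distributed M lborel (X 1) (\<lambda>x. ennreal (p x))"
    and "0 < \<gamma>" "\<gamma> < 1 / 6"
    and "summable (\<lambda>j. cov M (X 1) (X (Suc j)) powr \<gamma>)"
    and sym: "\<And>x y. x \<in> {- C\<^sub>1..C\<^sub>1} \<Longrightarrow> y \<in> {- C\<^sub>1..C\<^sub>1} \<Longrightarrow> \<rho> x y = \<rho> y x"
    and bhk: "bounded_hk_variation {1, 2::nat} (\<lambda>_. - C\<^sub>1) (\<lambda>_. C\<^sub>1) (\<lambda>v. \<rho> (v 1) (v 2))"
    and left: "left_continuous_hk {1, 2::nat} (\<lambda>_. - C\<^sub>1) (\<lambda>_. C\<^sub>1) (\<lambda>v. \<rho> (v 1) (v 2))"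
    and U: "\<And>n \<omega>. U n \<omega> =
              (\<Sum>(i, j) | 1 \<le> i \<and> i < j \<and> j \<le> n. \<rho> (X i \<omega>) (X j \<omega>)) / real (n choose 2)"
    and \<theta>: "\<theta> = (LINT y:{- C\<^sub>1..C\<^sub>1}|interval_measure F.
                    LINT x:{- C\<^sub>1..C\<^sub>1}|interval_measure F. \<rho> x y)"
    and \<rho>\<^sub>1: "\<And>x. x \<in> {- C\<^sub>1..C\<^sub>1} \<Longrightarrow>
                \<rho>\<^sub>1 x = (LINT y:{- C\<^sub>1..C\<^sub>1}|interval_measure F. \<rho> x y)"
    and "integrable M (\<lambda>\<omega>. (\<rho>\<^sub>1 (X 1 \<omega>))\<^sup>2)"
    and "summable (\<lambda>j. cov M (\<lambda>\<omega>. \<rho>\<^sub>1 (X 1 \<omega>)) (\<lambda>\<omega>. \<rho>\<^sub>1 (X (1 + Suc j) \<omega>)))"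
    and \<sigma>\<^sub>U: "\<sigma>\<^sub>U = sqrt (prob_space.variance M (\<lambda>\<omega>. \<rho>\<^sub>1 (X 1 \<omega>)) +
                2 * (\<Sum>j. cov M (\<lambda>\<omega>. \<rho>\<^sub>1 (X 1 \<omega>)) (\<lambda>\<omega>. \<rho>\<^sub>1 (X (1 + Suc j) \<omega>))))"
    and "prob_space.variance M (\<lambda>\<omega>. \<rho>\<^sub>1 (X 1 \<omega>)) +
           2 * (\<Sum>j. cov M (\<lambda>\<omega>. \<rho>\<^sub>1 (X 1 \<omega>)) (\<lambda>\<omega>. \<rho>\<^sub>1 (X (1 + Suc j) \<omega>))) > 0"
    and "ll_on {- C\<^sub>1..C\<^sub>1} \<rho>\<^sub>1 \<rho>\<^sub>1'"
    and "summable (\<lambda>j. cov M (\<lambda>\<omega>. \<rho>\<^sub>1' (X 1 \<omega>)) (\<lambda>\<omega>. \<rho>\<^sub>1' (X (Suc j) \<omega>)))"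
  shows "weak_conv_m
           (\<lambda>n. distr M borel (\<lambda>\<omega>. sqrt (real n) * (U n \<omega> - \<theta>) / (2 * \<sigma>\<^sub>U)))
           std_normal_distribution"
proof -
  interpret prob_space M by fact
  interpret associated_sequence M X by unfold_locales fact+
  note bnd = assms(5)
  obtain \<omega>0 where "\<omega>0 \<in> space M" using not_empty by blast
  then have C: "C\<^sub>1 > 0" using bnd[of 1 \<omega>0] by simp
  \<comment> \<open>The clamp onto the closed interval; the variables already take their values
    there.\<close>
  define \<kappa> where "\<kappa> x = max (- C\<^sub>1) (min C\<^sub>1 x)" for x
  have \<kappa>_mono: "mono \<kappa>" by (rule monoI) (auto simp: \<kappa>_def)
  have \<kappa>_in: "\<kappa> x \<in> {- C\<^sub>1..C\<^sub>1}" for x using C by (auto simp: \<kappa>_def)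
  have \<kappa>_id: "\<kappa> x = x" if "x \<in> {- C\<^sub>1..C\<^sub>1}" for x using that by (auto simp: \<kappa>_def)
  have \<kappa>_bound: "\<bar>\<kappa> x\<bar> \<le> C\<^sub>1" for x using \<kappa>_in[of x] by auto
  have X_in: "X i \<omega> \<in> {- C\<^sub>1..C\<^sub>1}" if "i \<ge> 1" "\<omega> \<in> space M" for i \<omega>
    using bnd[OF that] by auto
  have \<kappa>X: "\<kappa> (X i \<omega>) = X i \<omega>" if "i \<ge> 1" "\<omega> \<in> space M" for i \<omega>
    by (rule \<kappa>_id[OF X_in[OF that]])

  define g where "g x y = \<rho> (\<kappa> x) (\<kappa> y)" for x y
  obtain V B where ap: "uniformly_step_approximable g V" and B: "\<And>x y. \<bar>g x y\<bar> \<le> B"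
    unfolding g_def[abs_def] \<kappa>_def
    using bounded_hk_variation_step_approximable[OF _ bhk sym] C by auto
  have g_sym: "g x y = g y x" for x y unfolding g_def using \<kappa>_in by (intro sym)

  have X1: "X 1 \<in> borel_measurable M" by (rule rv) simp
  have F\<mu>: "interval_measure F = distr M borel (X 1)"
    unfolding F using X1 by (intro interval_measure_cdf real_distribution_distr)
  define r where "r x = \<rho>\<^sub>1 (\<kappa> x)" for x
  have r_eq: "r x = expectation (\<lambda>\<omega>. g x (X 1 \<omega>))" for x
  proof -
    have "(\<lambda>y. g x y) \<in> borel_measurable borel"
      using measurable_compose[OF _ uniformly_step_approximable_measurable[OF ap], of "\<lambda>y. (x, y)" borel] by simp
    then have "(LINT y:{- C\<^sub>1..C\<^sub>1}|distr M borel (X 1). \<rho> (\<kappa> x) y) = expectation (\<lambda>\<omega>. g x (X 1 \<omega>))"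
      using X_in by (intro set_lebesgue_integral_distr_first) (auto simp: g_def \<kappa>_id)
    then show ?thesis unfolding r_def \<rho>\<^sub>1[OF \<kappa>_in] F\<mu> .
  qed
  have rm: "r \<in> borel_measurable borel" by (rule marginal_measurable[OF ap r_eq])
  have rB: "\<bar>r x\<bar> \<le> B" for x by (rule abs_marginal_le[OF ap B r_eq])
  have \<theta>_eq: "\<theta> = expectation (\<lambda>\<omega>. r (X 1 \<omega>))"
  proof -
    \<comment> \<open>The inner integral of \<theta> runs over the first argument, that of
      \<open>\<rho>\<^sub>1\<close> over the second; symmetry of the kernel identifies them.\<close>
    have inner: "(LINT x:{- C\<^sub>1..C\<^sub>1}|interval_measure F. \<rho> x y) = r y" if y: "y \<in> {- C\<^sub>1..C\<^sub>1}" for y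
    proof -
      have "(LINT x:{- C\<^sub>1..C\<^sub>1}|interval_measure F. \<rho> x y) = (LINT x:{- C\<^sub>1..C\<^sub>1}|interval_measure F. \<rho> y x)"
        unfolding set_lebesgue_integral_def using sym[OF _ y]
        by (intro Bochner_Integration.integral_cong refl) (auto simp: indicator_def)
      then show ?thesis unfolding r_def \<kappa>_id[OF y] \<rho>\<^sub>1[OF y] .
    qed
    show ?thesis
      unfolding \<theta> F\<mu>
      by (rule set_lebesgue_integral_distr_first[OF rm]) (use inner[unfolded F\<mu>] X_in in auto)
  qed

  \<comment> \<open>Centring gives mean zero, as the Taylor expansion of a block requires. The
    dominating function is left uncentred, since neither covariances nor domination see
    constants.\<close>
  define f where "f x = r x - \<theta>" for x
  define f' where "f' x = \<rho>\<^sub>1' (\<kappa> x)" for x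
  have ll1: "ll_on {- C\<^sub>1..C\<^sub>1} \<rho>\<^sub>1 \<rho>\<^sub>1'" by fact
  have ll: "ll_on UNIV f f'"
    using ll_onD[OF ll1 \<kappa>_in \<kappa>_in monoD[OF \<kappa>_mono]] by (intro ll_onI) (simp add: f_def f'_def r_def)
  have f_bound: "\<bar>f x\<bar> \<le> B + \<bar>\<theta>\<bar>" for x using rB[of x] by (simp add: f_def)
  have f'_bound: "\<bar>f' x\<bar> \<le> \<bar>\<rho>\<^sub>1' C\<^sub>1\<bar> + \<bar>\<rho>\<^sub>1' (- C\<^sub>1)\<bar>" for x
  proof -
    have "\<rho>\<^sub>1' (- C\<^sub>1) \<le> f' x" "f' x \<le> \<rho>\<^sub>1' C\<^sub>1"
      using ll_onD[OF ll1, of "- C\<^sub>1" "\<kappa> x"] ll_onD[OF ll1, of "\<kappa> x" "C\<^sub>1"] \<kappa>_in[of x] C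
      by (auto simp: f'_def)
    then show ?thesis by linarith
  qed
  have rb: "bounded_rv M (\<lambda>\<omega>. r (X i \<omega>))" if "i \<ge> 1" for i by (rule bounded_rv_comp[OF rm rB that])
  have Ef: "expectation (\<lambda>\<omega>. f (X 1 \<omega>)) = 0"
    using bounded_rv_integrable[OF rb[OF order_refl]] by (simp add: f_def \<theta>_eq prob_space)
  have sm': "summable (\<lambda>d. cov M (\<lambda>\<omega>. f' (X 1 \<omega>)) (\<lambda>\<omega>. f' (X (1 + d) \<omega>)))"
  proof -
    have "cov M (\<lambda>\<omega>. f' (X 1 \<omega>)) (\<lambda>\<omega>. f' (X (1 + d) \<omega>)) = cov M (\<lambda>\<omega>. \<rho>\<^sub>1' (X 1 \<omega>)) (\<lambda>\<omega>. \<rho>\<^sub>1' (X (Suc d) \<omega>))" for d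
      using \<kappa>X by (intro cov_cong) (auto simp: f'_def)
    then show ?thesis using assms(22) by simp
  qed
  define c where "c d = cov M (\<lambda>\<omega>. f (X 1 \<omega>)) (\<lambda>\<omega>. f (X (1 + d) \<omega>))" for d
  have c_eq: "c d = cov M (\<lambda>\<omega>. \<rho>\<^sub>1 (X 1 \<omega>)) (\<lambda>\<omega>. \<rho>\<^sub>1 (X (1 + d) \<omega>))" for d
  proof -
    have "c d = cov M (\<lambda>\<omega>. r (X 1 \<omega>)) (\<lambda>\<omega>. r (X (1 + d) \<omega>))"
      unfolding c_def f_def cov_def
      using bounded_rv_integrable[OF rb[of 1]] bounded_rv_integrable[OF rb[of "1 + d"]] by (simp add: prob_space)
    also have "\<dots> = cov M (\<lambda>\<omega>. \<rho>\<^sub>1 (X 1 \<omega>)) (\<lambda>\<omega>. \<rho>\<^sub>1 (X (1 + d) \<omega>))"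
      using \<kappa>X by (intro cov_cong) (auto simp: r_def)
    finally show ?thesis .
  qed
  define \<sigma>2 where "\<sigma>2 = c 0 + 2 * (\<Sum>d. c (Suc d))"
  have var_eq: "variance (\<lambda>\<omega>. \<rho>\<^sub>1 (X 1 \<omega>)) = c 0"
    unfolding c_eq by (simp add: cov_def power2_eq_square)
  have \<sigma>2: "\<sigma>2 > 0" "\<sigma>\<^sub>U = sqrt \<sigma>2"
    using assms(20) \<sigma>\<^sub>U unfolding \<sigma>2_def var_eq c_eq by simp_all
  have \<sigma>: "\<sigma>\<^sub>U > 0" "\<sigma>\<^sub>U\<^sup>2 = \<sigma>2" using \<sigma>2 by auto

  let ?w = "\<lambda>d. cov M (\<lambda>\<omega>. \<kappa> (X 1 \<omega>)) (\<lambda>\<omega>. \<kappa> (X (1 + d) \<omega>))"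
  have "?w d = cov M (X 1) (X (Suc d))" for d using \<kappa>X by (intro cov_cong) auto
  then have "summable (\<lambda>d. ?w d powr \<gamma>)" using assms(10) by simp
  \<comment> \<open>\<gamma> lies below 1/6 and hence below 1/3.\<close>
  then have sm3: "summable (\<lambda>d. ?w d powr (1/3))"
    using assms(8,9) cov_comp_nonneg[OF \<kappa>_mono \<kappa>_bound, of 1]
    by (intro summable_powr_mono[of _ \<gamma> "1/3"]) auto
  obtain p where p: "\<forall>x::real. 0 \<le> p x" "bounded (range p)" "distributed M lborel (X 1) (\<lambda>x. ennreal (p x))"
    using density by blast
  obtain K where "\<forall>y\<in>range p. \<bar>y\<bar> \<le> K" using p(2) unfolding bounded_iff by auto
  then have pK: "p x \<le> K" for x using abs_le_D1 by blast
  have K: "K \<ge> 0" using order.trans[OF _ pK[of 0]] p(1) by blast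
  note dens = bounded_density_interval_le[OF pK p(3) K]
  define W where "W = 2 * (1 + 4 * K) * (\<Sum>d. ?w d powr (1/3))"
  have var: "cov M (\<lambda>\<omega>. \<Sum>i=1..n. u (X i \<omega>)) (\<lambda>\<omega>. \<Sum>i=1..n. u (X i \<omega>)) \<le> W * real n"
    if "mono u" "\<And>x. u x \<in> {0, 1}" for u :: "real \<Rightarrow> real" and n
    unfolding W_def by (rule cov_indicator_sum_le[OF that dens K \<kappa>_mono \<kappa>_bound \<kappa>X sm3])
  have W: "W \<ge> 0" unfolding W_def using K by (intro mult_nonneg_nonneg suminf_nonneg sm3) auto

  define Y where "Y n \<omega> = sqrt (real n) * (U n \<omega> - \<theta>) / (2 * \<sigma>\<^sub>U)" for n \<omega>
  \<comment> \<open>The projection carries the factor \<open>2 / n\<close>; its 2 cancels against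
    the one in the normalization \<open>2 * \<sigma>\<^sub>U\<close> of \<open>Y\<close>.\<close>
  define Z where "Z n \<omega> = 1 / \<sigma>\<^sub>U / sqrt (real n) * (\<Sum>i=1..n. f (X i \<omega>))" for n \<omega>
  have U_eq: "U n \<omega> = (\<Sum>(i, j) | 1 \<le> i \<and> i < j \<and> j \<le> n. g (X i \<omega>) (X j \<omega>)) / real (n choose 2)"
    if "\<omega> \<in> space M" for n \<omega>
    unfolding U using that by (intro arg_cong2[where f = "(/)"] sum.cong refl) (auto simp: g_def \<kappa>X)
  have bU: "bounded_rv M (\<lambda>\<omega>. (\<Sum>(i, j) | 1 \<le> i \<and> i < j \<and> j \<le> n. g (X i \<omega>) (X j \<omega>)))" for n
    unfolding split_beta by (intro bounded_rv_sum bounded_rv_kernel(1)[OF ap B]) auto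
  have mU: "U n \<in> borel_measurable M" for n
    using bounded_rv_measurable[OF bU[of n]] U_eq by (subst measurable_cong[OF U_eq]) auto
  have mY: "Y n \<in> borel_measurable M" for n unfolding Y_def[abs_def] using mU by measurable
  have bf: "bounded_rv M (\<lambda>\<omega>. \<Sum>i=1..n. f (X i \<omega>))" for n
    unfolding f_def by (intro bounded_rv_sum bounded_rv_diff rb) auto
  have mZ: "Z n \<in> borel_measurable M" for n
    unfolding Z_def[abs_def] using bounded_rv_measurable[OF bf] by measurable

  have close: "cmod ((LINT \<omega>|M. iexp (t * Y n \<omega>)) - (LINT \<omega>|M. iexp (t * Z n \<omega>)))
      \<le> (\<bar>t\<bar> * (V * W + 4 * B) / \<sigma>\<^sub>U) / sqrt (real n)" if n: "n \<ge> 2" for n t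
  proof -
    define E where "E \<omega> = (\<Sum>(i, j) | 1 \<le> i \<and> i < j \<and> j \<le> n. g (X i \<omega>) (X j \<omega>)) / real (n choose 2) - \<theta>
      - 2 / real n * (\<Sum>i=1..n. r (X i \<omega>) - \<theta>)" for \<omega>
    have bE: "bounded_rv M E" and EE: "expectation (\<lambda>\<omega>. \<bar>E \<omega>\<bar>) \<le> 2 * (V * W + 4 * B) / real n"
      unfolding E_def[abs_def] using U_statistic_remainder_le[OF ap B g_sym var W n r_eq \<theta>_eq] by auto
    define q where "q = sqrt (real n)"
    have q: "q > 0" "real n = q\<^sup>2" using n by (auto simp: q_def)
    \<comment> \<open>The two normalized sums differ exactly by the remainder \<open>E\<close> times
      a factor of order \<open>sqrt n\<close>, and \<open>E\<close> has mean absolute value of order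
      \<open>1 / n\<close>.\<close>
    have diff: "t * Y n \<omega> - t * Z n \<omega> = t * q / (2 * \<sigma>\<^sub>U) * E \<omega>" if "\<omega> \<in> space M" for \<omega>
      unfolding Y_def Z_def E_def U_eq[OF that] q_def[symmetric] q(2) f_def
      using q(1) \<sigma>(1) by (simp add: field_simps power2_eq_square)
    have iE: "integrable M (\<lambda>\<omega>. t * q / (2 * \<sigma>\<^sub>U) * E \<omega>)"
      using bounded_rv_integrable[OF bE] by simp
    have "cmod ((LINT \<omega>|M. iexp (t * Y n \<omega>)) - (LINT \<omega>|M. iexp (t * Z n \<omega>)))
        \<le> expectation (\<lambda>\<omega>. \<bar>t * Y n \<omega> - t * Z n \<omega>\<bar>)"
      using mY mZ iE
      by (intro cmod_expectation_iexp_diff_le) (auto simp: diff cong: Bochner_Integration.integrable_cong)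
    also have "\<dots> = expectation (\<lambda>\<omega>. \<bar>t\<bar> * q / (2 * \<sigma>\<^sub>U) * \<bar>E \<omega>\<bar>)"
      using diff q(1) \<sigma>(1) by (intro Bochner_Integration.integral_cong refl) (simp add: abs_mult)
    also have "\<dots> = \<bar>t\<bar> * q / (2 * \<sigma>\<^sub>U) * expectation (\<lambda>\<omega>. \<bar>E \<omega>\<bar>)" by simp
    also have "\<dots> \<le> \<bar>t\<bar> * q / (2 * \<sigma>\<^sub>U) * (2 * (V * W + 4 * B) / real n)"
      using q(1) \<sigma>(1) by (intro mult_left_mono EE) auto
    also have "\<dots> = (\<bar>t\<bar> * (V * W + 4 * B) / \<sigma>\<^sub>U) / sqrt (real n)"
      unfolding q_def[symmetric] q(2) using q(1) \<sigma>(1) by (simp add: field_simps power2_eq_square)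
    finally show ?thesis .
  qed

  have "(\<lambda>n. LINT \<omega>|M. iexp (t * Y n \<omega>)) \<longlonglongrightarrow> complex_of_real (exp (- (t\<^sup>2 / 2)))" for t
  proof -
    have "(\<lambda>n. LINT \<omega>|M. iexp (t / \<sigma>\<^sub>U / sqrt (real n) * (\<Sum>i=1..n. f (X i \<omega>))))
           \<longlonglongrightarrow> complex_of_real (exp (- ((t / \<sigma>\<^sub>U)\<^sup>2 * \<sigma>2 / 2)))"
      unfolding \<sigma>2_def c_def by (rule char_partial_sum_tendsto[OF ll f_bound f'_bound Ef sm'])
    moreover have "(t / \<sigma>\<^sub>U)\<^sup>2 * \<sigma>2 / 2 = t\<^sup>2 / 2"
      using \<sigma> by (simp add: power_divide flip: \<sigma>(2))
    moreover have "t / \<sigma>\<^sub>U / sqrt (real n) * (\<Sum>i=1..n. f (X i \<omega>)) = t * Z n \<omega>" for n \<omega>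
      by (simp add: Z_def)
    ultimately have lim: "(\<lambda>n. LINT \<omega>|M. iexp (t * Z n \<omega>)) \<longlonglongrightarrow> complex_of_real (exp (- (t\<^sup>2 / 2)))"
      by (simp only:)
    have "(\<lambda>n. (LINT \<omega>|M. iexp (t * Y n \<omega>)) - (LINT \<omega>|M. iexp (t * Z n \<omega>))) \<longlonglongrightarrow> 0"
    proof (rule Lim_null_comparison[OF _ tendsto_divide_sqrt_0])
      show "\<forall>\<^sub>F n in sequentially. norm ((LINT \<omega>|M. iexp (t * Y n \<omega>)) - (LINT \<omega>|M. iexp (t * Z n \<omega>)))
          \<le> (\<bar>t\<bar> * (V * W + 4 * B) / \<sigma>\<^sub>U) / sqrt (real n)"
        using eventually_ge_at_top[of "2::nat"] by eventually_elim (rule close)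
    qed
    from tendsto_add[OF this lim] show ?thesis by simp
  qed
  then show ?thesis
    using weak_conv_std_normalI[OF mY] unfolding Y_def[abs_def] by simp
qed

end
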